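(* Let $\theta,\theta'\in\mathbb{R}$, set $q=e^{i\theta}$ and $q'=e^{i\theta'}$, and put $\gamma=\theta'-\theta$. Let $U,V$ be two $q$-commuting unitaries. Then $U,V$ can be dilated to a pair of $q'$-commuting scalar multiples of unitaries with norm $$\frac{4}{\|u_\gamma+u_\gamma^*+v_\gamma+v_\gamma^*\|}.$$ Furthermore, if $\frac{q'}{q}=e^{i\gamma}$ is a primitive $n$th root of unity and $U,V\in B(\mathcal{H})$, then such a dilation can be constructed on $\mathcal{H}\otimes\mathcal{L}$, where $\mathcal{L}$ is a Hilbert space with $\dim(\mathcal{L})=n$.
   Context: For $q\in\mathbb{T}$, a pair of operators $U,V$ on a Hilbert space is $q$-commuting if $VU=qUV$. For $\gamma\in\mathbb{R}$, $A_\gamma=C^*(u,v \text{ unitary}\mid vu=e^{i\gamma}uv)$ denotes the universal C*-algebra generated by a pair of $e^{i\gamma}$-commuting unitaries; its generators are denoted $u_\gamma,v_\gamma$. A pair $(B_1,B_2)$ of operators on a Hilbert space $\mathcal{K}$ is a dilation of a pair $(A_1,A_2)$ of operators on a Hilbert space $\mathcal{H}$ if $\mathcal{H}\subseteq\mathcal{K}$, up to an isometric embedding $W\colon\mathcal{H}\to\mathcal{K}$, and $A_i$ is the compression of $B_i$ to $\mathcal{H}$ for $i=1,2$ (i.e. $A_i=W^*B_iW$). That the dilation is constructed on $\mathcal{H}\otimes\mathcal{L}$ means that one can take $\mathcal{K}=\mathcal{H}\otimes\mathcal{L}$. *)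

theory Defs
  imports Complex_Main "HOL-Algebra.Module" "HOL-Library.Poly_Mapping"
begin

section \<open>Hilbert spaces\<close>

text \<open>A complex Hilbert space is a module, in the sense of HOL-Algebra, over the field of complex
  numbers together with a complete inner product.  The multiplicative part of the module record is
  irrelevant.  The inner product is linear in its second argument.  Operators are plain functions,
  of which only the values on the carrier matter.  Spaces live on carriers rather than on whole types
  because the existence of a dilation space has to be stated as an existential over a fixed type; the
  type \<open>nat \<Rightarrow> 'a \<times> complex\<close> has room for the square-summable sequences in a space on \<open>'a\<close>, and
  for an infinite-dimensional space even when \<open>'a\<close> is a singleton.\<close>

definition complex_ring :: "complex ring"
  where "complex_ring = \<lparr>carrier = UNIV, mult = (*), one = 1, zero = 0, add = (+)\<rparr>"

record 'a hspace = "(complex, 'a) module" +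
  hinner :: "'a \<Rightarrow> 'a \<Rightarrow> complex"

definition hnorm :: "'a hspace \<Rightarrow> 'a \<Rightarrow> real"
  where "hnorm H x = sqrt (Re (hinner H x x))"

locale hilbert_space = module complex_ring H for H :: "'a hspace" (structure) +
  assumes inner_add_right:
      "\<lbrakk>x \<in> carrier H; y \<in> carrier H; z \<in> carrier H\<rbrakk>
        \<Longrightarrow> hinner H x (y \<oplus>\<^bsub>H\<^esub> z) = hinner H x y + hinner H x z"
    and inner_smult_right:
      "\<lbrakk>x \<in> carrier H; y \<in> carrier H\<rbrakk> \<Longrightarrow> hinner H x (a \<odot>\<^bsub>H\<^esub> y) = a * hinner H x y"
    and inner_cnj:
      "\<lbrakk>x \<in> carrier H; y \<in> carrier H\<rbrakk> \<Longrightarrow> hinner H y x = cnj (hinner H x y)"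
    and inner_nonneg: "x \<in> carrier H \<Longrightarrow> 0 \<le> Re (hinner H x x)"
    and inner_definite: "\<lbrakk>x \<in> carrier H; hinner H x x = 0\<rbrakk> \<Longrightarrow> x = \<zero>\<^bsub>H\<^esub>"
    and complete:
      "\<lbrakk>\<And>k::nat. X k \<in> carrier H;
        \<forall>e>0. \<exists>N. \<forall>k\<ge>N. \<forall>l\<ge>N. hnorm H (X k \<ominus>\<^bsub>H\<^esub> X l) < e\<rbrakk>
        \<Longrightarrow> \<exists>x\<in>carrier H. (\<lambda>k. hnorm H (X k \<ominus>\<^bsub>H\<^esub> x)) \<longlonglongrightarrow> 0"

inductive_set hspan :: "'a hspace \<Rightarrow> 'a set \<Rightarrow> 'a set" for H S
  where
    zero: "\<zero>\<^bsub>H\<^esub> \<in> hspan H S"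
  | base: "x \<in> S \<Longrightarrow> x \<in> hspan H S"
  | add: "\<lbrakk>x \<in> hspan H S; y \<in> hspan H S\<rbrakk> \<Longrightarrow> x \<oplus>\<^bsub>H\<^esub> y \<in> hspan H S"
  | smult: "x \<in> hspan H S \<Longrightarrow> a \<odot>\<^bsub>H\<^esub> x \<in> hspan H S"

definition total_in :: "'a hspace \<Rightarrow> 'a set \<Rightarrow> bool"
  where "total_in H S \<longleftrightarrow> S \<subseteq> carrier H \<and>
    (\<forall>x\<in>carrier H. \<forall>e>0. \<exists>y\<in>hspan H S. hnorm H (x \<ominus>\<^bsub>H\<^esub> y) < e)"

definition orthonormal_basis :: "'a hspace \<Rightarrow> 'a set \<Rightarrow> bool"
  where "orthonormal_basis H S \<longleftrightarrow> total_in H S \<and>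
    (\<forall>x\<in>S. \<forall>y\<in>S. hinner H x y = (if x = y then 1 else 0))"

definition has_dim :: "'a hspace \<Rightarrow> nat \<Rightarrow> bool"
  where "has_dim H n \<longleftrightarrow> (\<exists>S. orthonormal_basis H S \<and> finite S \<and> card S = n)"

text \<open>\<open>T\<close> is a realization of the Hilbert space tensor product of \<open>H\<close> and \<open>L\<close>, the elementary
  tensor of \<open>x\<close> and \<open>y\<close> being \<open>t x y\<close>: it is the completion of the span of the elementary
  tensors.  These conditions determine \<open>T\<close> up to a unitary respecting elementary tensors.\<close>

definition tensor_product ::
    "'a hspace \<Rightarrow> 'b hspace \<Rightarrow> 'c hspace \<Rightarrow> ('a \<Rightarrow> 'b \<Rightarrow> 'c) \<Rightarrow> bool"
  where "tensor_product H L T t \<longleftrightarrow>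
    (\<forall>x\<in>carrier H. \<forall>x'\<in>carrier H. \<forall>y\<in>carrier L.
       t (x \<oplus>\<^bsub>H\<^esub> x') y = t x y \<oplus>\<^bsub>T\<^esub> t x' y) \<and>
    (\<forall>x\<in>carrier H. \<forall>y\<in>carrier L. \<forall>y'\<in>carrier L.
       t x (y \<oplus>\<^bsub>L\<^esub> y') = t x y \<oplus>\<^bsub>T\<^esub> t x y') \<and>
    (\<forall>a. \<forall>x\<in>carrier H. \<forall>y\<in>carrier L.
       t (a \<odot>\<^bsub>H\<^esub> x) y = a \<odot>\<^bsub>T\<^esub> t x y \<and> t x (a \<odot>\<^bsub>L\<^esub> y) = a \<odot>\<^bsub>T\<^esub> t x y) \<and>
    (\<forall>x\<in>carrier H. \<forall>x'\<in>carrier H. \<forall>y\<in>carrier L. \<forall>y'\<in>carrier L.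
       hinner T (t x y) (t x' y') = hinner H x x' * hinner L y y') \<and>
    total_in T {t x y | x y. x \<in> carrier H \<and> y \<in> carrier L}"

section \<open>Operators and dilations\<close>

definition bounded_op :: "'a hspace \<Rightarrow> 'b hspace \<Rightarrow> ('a \<Rightarrow> 'b) \<Rightarrow> bool"
  where "bounded_op H K T \<longleftrightarrow>
    (\<forall>x\<in>carrier H. T x \<in> carrier K) \<and>
    (\<forall>x\<in>carrier H. \<forall>y\<in>carrier H. T (x \<oplus>\<^bsub>H\<^esub> y) = T x \<oplus>\<^bsub>K\<^esub> T y) \<and>
    (\<forall>a. \<forall>x\<in>carrier H. T (a \<odot>\<^bsub>H\<^esub> x) = a \<odot>\<^bsub>K\<^esub> T x) \<and>
    (\<exists>C. \<forall>x\<in>carrier H. hnorm K (T x) \<le> C * hnorm H x)"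

definition op_norm :: "'a hspace \<Rightarrow> 'b hspace \<Rightarrow> ('a \<Rightarrow> 'b) \<Rightarrow> real"
  where "op_norm H K T = (SUP x\<in>{x \<in> carrier H. hnorm H x \<le> 1}. hnorm K (T x))"

definition adj :: "'a hspace \<Rightarrow> 'b hspace \<Rightarrow> ('a \<Rightarrow> 'b) \<Rightarrow> 'b \<Rightarrow> 'a"
  where "adj H K T y =
    (THE z. z \<in> carrier H \<and> (\<forall>x\<in>carrier H. hinner K (T x) y = hinner H x z))"

definition unitary_op :: "'a hspace \<Rightarrow> ('a \<Rightarrow> 'a) \<Rightarrow> bool"
  where "unitary_op H T \<longleftrightarrow> bounded_op H H T \<and>
    (\<forall>x\<in>carrier H. adj H H T (T x) = x \<and> T (adj H H T x) = x)"

definition scalar_multiple_of_unitary :: "'a hspace \<Rightarrow> ('a \<Rightarrow> 'a) \<Rightarrow> bool"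
  where "scalar_multiple_of_unitary H B \<longleftrightarrow>
    (\<exists>a T. unitary_op H T \<and> (\<forall>x\<in>carrier H. B x = a \<odot>\<^bsub>H\<^esub> T x))"

definition isometric_op :: "'a hspace \<Rightarrow> 'b hspace \<Rightarrow> ('a \<Rightarrow> 'b) \<Rightarrow> bool"
  where "isometric_op H K W \<longleftrightarrow> bounded_op H K W \<and>
    (\<forall>x\<in>carrier H. hnorm K (W x) = hnorm H x)"

definition q_commuting :: "complex \<Rightarrow> 'a hspace \<Rightarrow> ('a \<Rightarrow> 'a) \<Rightarrow> ('a \<Rightarrow> 'a) \<Rightarrow> bool"
  where "q_commuting q H U V \<longleftrightarrow> (\<forall>x\<in>carrier H. V (U x) = q \<odot>\<^bsub>H\<^esub> U (V x))"

definition is_dilation ::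
    "'a hspace \<Rightarrow> ('a \<Rightarrow> 'a) \<Rightarrow> ('a \<Rightarrow> 'a) \<Rightarrow> 'b hspace \<Rightarrow> ('b \<Rightarrow> 'b) \<Rightarrow> ('b \<Rightarrow> 'b) \<Rightarrow> bool"
  where "is_dilation H A\<^sub>1 A\<^sub>2 K B\<^sub>1 B\<^sub>2 \<longleftrightarrow>
    bounded_op K K B\<^sub>1 \<and> bounded_op K K B\<^sub>2 \<and>
    (\<exists>W. isometric_op H K W \<and>
      (\<forall>x\<in>carrier H. A\<^sub>1 x = adj H K W (B\<^sub>1 (W x)) \<and> A\<^sub>2 x = adj H K W (B\<^sub>2 (W x))))"

section \<open>The free unital *-algebra on two generators\<close>

text \<open>The primed letters stand for the adjoints of the two generators.  Words form the free
  monoid on the four letters (written additively, as required by the convolution product of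
  \<^theory>\<open>HOL-Library.Poly_Mapping\<close>), so finitely supported complex functions on words are the
  noncommutative *-polynomials in two variables.\<close>

datatype letter = U | U' | V | V'

datatype star_word = Word (letters: "letter list")

instantiation star_word :: monoid_add
begin

definition "0 = Word []"

definition "w + w' = Word (letters w @ letters w')"

instance
  by standard (simp_all add: zero_star_word_def plus_star_word_def)

end

type_synonym star_poly = "star_word \<Rightarrow>\<^sub>0 complex"

fun star_letter :: "letter \<Rightarrow> letter"
  where
    "star_letter U = U'"
  | "star_letter U' = U"
  | "star_letter V = V'"
  | "star_letter V' = V"

definition word_star :: "star_word \<Rightarrow> star_word"
  where "word_star w = Word (rev (map star_letter (letters w)))"

definition gen :: "letter \<Rightarrow> star_poly"
  where "gen l = Poly_Mapping.single (Word [l]) 1"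

definition poly_smult :: "complex \<Rightarrow> star_poly \<Rightarrow> star_poly"
  where "poly_smult a f = Poly_Mapping.map ((*) a) f"

definition poly_star :: "star_poly \<Rightarrow> star_poly"
  where "poly_star f = Poly_Mapping.map_key word_star (Poly_Mapping.map cnj f)"

section \<open>The universal C*-algebra of two commuting-up-to-a-phase unitaries\<close>

text \<open>Universal C*-algebras are built in the usual way: the *-algebra of polynomials carries the
  largest C*-seminorm vanishing on the relations, and the universal C*-algebra is the
  Hausdorff completion with respect to it.  The C*-seminorms vanishing on the relations are
  precisely the functions \<open>\<lambda>f. \<parallel>\<pi> f\<parallel>\<close> for unital *-homomorphisms \<open>\<pi>\<close> into C*-algebras
  respecting the relations.\<close>

definition cstar_seminorm :: "(star_poly \<Rightarrow> real) \<Rightarrow> bool"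
  where "cstar_seminorm p \<longleftrightarrow>
    (\<forall>f. 0 \<le> p f) \<and>
    (\<forall>f g. p (f + g) \<le> p f + p g) \<and>
    (\<forall>a f. p (poly_smult a f) = cmod a * p f) \<and>
    (\<forall>f g. p (f * g) \<le> p f * p g) \<and>
    (\<forall>f. p (poly_star f * f) = (p f)\<^sup>2)"

definition vanishes_on_relations :: "real \<Rightarrow> (star_poly \<Rightarrow> real) \<Rightarrow> bool"
  where "vanishes_on_relations \<gamma> p \<longleftrightarrow>
    p (gen U' * gen U - 1) = 0 \<and> p (gen U * gen U' - 1) = 0 \<and>
    p (gen V' * gen V - 1) = 0 \<and> p (gen V * gen V' - 1) = 0 \<and>
    p (gen V * gen U - poly_smult (exp (\<i> * of_real \<gamma>)) (gen U * gen V)) = 0"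

definition universal_seminorm :: "real \<Rightarrow> star_poly \<Rightarrow> real"
  where "universal_seminorm \<gamma> f = (SUP p\<in>{p. cstar_seminorm p \<and> vanishes_on_relations \<gamma> p}. p f)"

definition cauchy_seqs :: "real \<Rightarrow> (nat \<Rightarrow> star_poly) set"
  where "cauchy_seqs \<gamma> =
    {X. \<forall>e>0. \<exists>N. \<forall>k\<ge>N. \<forall>l\<ge>N. universal_seminorm \<gamma> (X k - X l) < e}"

definition null_rel :: "real \<Rightarrow> ((nat \<Rightarrow> star_poly) \<times> (nat \<Rightarrow> star_poly)) set"
  where "null_rel \<gamma> = {(X, Y). X \<in> cauchy_seqs \<gamma> \<and> Y \<in> cauchy_seqs \<gamma> \<and>
    (\<lambda>k. universal_seminorm \<gamma> (X k - Y k)) \<longlonglongrightarrow> 0}"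

record 'a cstar_alg = "(complex, 'a) module" +
  star :: "'a \<Rightarrow> 'a"
  cnorm :: "'a \<Rightarrow> real"

definition rotation_algebra :: "real \<Rightarrow> (nat \<Rightarrow> star_poly) set cstar_alg"
  where "rotation_algebra \<gamma> =
    \<lparr>carrier = cauchy_seqs \<gamma> // null_rel \<gamma>,
     mult = (\<lambda>a b. \<Union>X\<in>a. \<Union>Y\<in>b. null_rel \<gamma> `` {\<lambda>k. X k * Y k}),
     one = null_rel \<gamma> `` {\<lambda>k. 1},
     zero = null_rel \<gamma> `` {\<lambda>k. 0},
     add = (\<lambda>a b. \<Union>X\<in>a. \<Union>Y\<in>b. null_rel \<gamma> `` {\<lambda>k. X k + Y k}),
     smult = (\<lambda>c a. \<Union>X\<in>a. null_rel \<gamma> `` {\<lambda>k. poly_smult c (X k)}),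
     star = (\<lambda>a. \<Union>X\<in>a. null_rel \<gamma> `` {\<lambda>k. poly_star (X k)}),
     cnorm = (\<lambda>a. THE r. \<forall>X\<in>a. (\<lambda>k. universal_seminorm \<gamma> (X k)) \<longlonglongrightarrow> r)\<rparr>"

definition rotation_u :: "real \<Rightarrow> (nat \<Rightarrow> star_poly) set"
  where "rotation_u \<gamma> = null_rel \<gamma> `` {\<lambda>k. gen U}"

definition rotation_v :: "real \<Rightarrow> (nat \<Rightarrow> star_poly) set"
  where "rotation_v \<gamma> = null_rel \<gamma> `` {\<lambda>k. gen V}"

section \<open>Primitive roots of unity\<close>

definition primitive_root_of_unity :: "nat \<Rightarrow> complex \<Rightarrow> bool"
  where "primitive_root_of_unity n z \<longleftrightarrow>
    0 < n \<and> z ^ n = 1 \<and> (\<forall>k. 0 < k \<and> k < n \<longrightarrow> z ^ k \<noteq> 1)"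

hide_const (open) U U' V V'

end

theory Submission
  imports "HOL-Analysis.Analysis" "HOL-Library.Function_Algebras" Defs
begin

text \<open>Write \<open>h = u + u\<^sup>* + v + v\<^sup>*\<close> in the rotation algebra of parameter \<open>\<gamma>\<close>. If \<open>\<pi>\<close> is a representation with a
  unit vector \<open>\<xi>\<close> such that \<open>\<langle>\<xi>, \<pi>(u) \<xi>\<rangle> = \<langle>\<xi>, \<pi>(v) \<xi>\<rangle> = \<parallel>h\<parallel> / 4\<close>, then \<open>U \<otimes> \<pi>(u)\<close> and \<open>V \<otimes> \<pi>(v)\<close>,
  multiplied by \<open>4 / \<parallel>h\<parallel>\<close>, dilate \<open>U\<close> and \<open>V\<close> along \<open>x \<mapsto> x \<otimes> \<xi>\<close>.

  The norm of \<open>h\<close> is computed in the twisted regular representation on the square-summable functions on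
  \<open>\<int>\<^sup>2\<close>: for every C*-seminorm \<open>p\<close> and \<open>m\<close> a power of two, \<open>p(h)\<^sup>m = p(h\<^sup>m)\<close> is at most the
  \<open>\<ell>\<^sup>1\<close>-norm of the coefficients of \<open>h\<^sup>m\<close>, hence at most \<open>2 m + 1\<close> times their \<open>\<ell>\<^sup>2\<close>-norm. So there are
  unit vectors whose expectation of \<open>h\<close> is almost \<open>\<parallel>h\<parallel>\<close>, and a sum of four representations that are permuted
  by the automorphism \<open>u \<mapsto> v \<mapsto> u\<^sup>*\<close> equalizes the expectations of the generators. In an orthonormal basis
  adapted to the generators these act by banded matrices, and a pointwise limit of banded unitary matrices is
  unitary; the limit is the required \<open>\<pi>\<close> on square-summable sequences.

  If \<open>e\<^sup>i\<^sup>\<gamma>\<close> is a primitive root of unity of order \<open>n\<close>, the representations by multiples \<open>z\<close>, \<open>w\<close> of the clock and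
  shift matrices exhaust the norm of \<open>h\<close>. Replacing a vector by its absolute values removes \<open>w\<close>, and
  the Fourier transform exchanges \<open>z\<close> and \<open>w\<close>, so the norm is attained at \<open>z = w = 1\<close>, by a vector invariant
  under the Fourier transform, which intertwines \<open>u\<close> and \<open>v\<close>.\<close>

section \<open>Hilbert spaces\<close>

text \<open>The constant comes from the fact that the expectations of the four letters in a unit
  vector add up to at most \<parallel>h\<parallel>. If all four agree, \<parallel>h\<parallel> / 4
  is their largest possible value, and scaling by its inverse makes the compressions exactly
  \<open>U\<close> and \<open>V\<close>. Two obstacles shape the proof. A supremum over abstract
  C*-seminorms offers no vectors, so \<open>universal_seminorm\<close> is bounded by computing in
  the algebra: modulo the relations, a polynomial is the combination of monomials u^a v^b read off
  from its action on one lattice point, and the lattice grows only polynomially. Secondly, the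
  regular representation need not attain the norm, and limits of unitaries in infinite dimension are
  in general only contractions. With a band profile fixed in advance, each entry of a product is a
  sum of boundedly many terms, so the relations survive entrywise limits. At a root of unity,
  compactness of the unit sphere replaces the limit, and a vector fixed by the Fourier transform
  replaces the four copies, which keeps the dimension at n.\<close>

lemma complex_ring_simps [simp]:
  "carrier complex_ring = UNIV" "mult complex_ring = (*)" "one complex_ring = 1"
  "zero complex_ring = 0" "add complex_ring = (+)"
  by (simp_all add: complex_ring_def)

lemma cring_complex_ring: "cring complex_ring"
proof (rule cringI)
  show "abelian_group complex_ring"
  proof (rule abelian_groupI)
    fix x :: complex
    have "- x + x = 0" by simp
    then show "\<exists>y\<in>carrier complex_ring. y \<oplus>\<^bsub>complex_ring\<^esub> x = \<zero>\<^bsub>complex_ring\<^esub>"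
      unfolding complex_ring_simps by blast
  qed simp_all
  show "comm_monoid complex_ring"
    by (rule comm_monoidI) simp_all
qed (simp add: distrib_right)

lemma uminus_complex_ring [simp]: "\<ominus>\<^bsub>complex_ring\<^esub> a = - a"
proof -
  interpret cring complex_ring by (rule cring_complex_ring)
  show ?thesis
    using minus_equality[of "- a" a] by simp
qed

context hilbert_space
begin

lemma smult_complex [simp]:
  "x \<in> carrier H \<Longrightarrow> a \<odot> x \<in> carrier H"
  "x \<in> carrier H \<Longrightarrow> 1 \<odot> x = x"
  "x \<in> carrier H \<Longrightarrow> 0 \<odot> x = \<zero>"
  "a \<odot> \<zero> = \<zero>"
  using smult_closed[of a x] smult_one[of x] smult_l_null[of x] smult_r_null[of a] by simp_all

lemma smult_distrib:
  "\<lbrakk>x \<in> carrier H; y \<in> carrier H\<rbrakk> \<Longrightarrow> a \<odot> (x \<oplus> y) = a \<odot> x \<oplus> a \<odot> y"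
  "x \<in> carrier H \<Longrightarrow> (a + b) \<odot> x = a \<odot> x \<oplus> b \<odot> x"
  "x \<in> carrier H \<Longrightarrow> (a * b) \<odot> x = a \<odot> (b \<odot> x)"
  using smult_r_distr[of a x y] smult_l_distr[of a b x] smult_assoc1[of a b x] by simp_all

lemma uminus_eq_smult: "x \<in> carrier H \<Longrightarrow> \<ominus> x = (-1) \<odot> x"
  using smult_l_minus[of 1 x] by simp

lemma inner_add_left:
  "\<lbrakk>x \<in> carrier H; y \<in> carrier H; z \<in> carrier H\<rbrakk>
    \<Longrightarrow> hinner H (x \<oplus> y) z = hinner H x z + hinner H y z"
  using inner_cnj[of z "x \<oplus> y"] inner_cnj[of z x] inner_cnj[of z y]
  by (simp add: inner_add_right)

lemma inner_smult_left:
  "\<lbrakk>x \<in> carrier H; y \<in> carrier H\<rbrakk> \<Longrightarrow> hinner H (a \<odot> x) y = cnj a * hinner H x y"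
  using inner_cnj[of y "a \<odot> x"] inner_cnj[of y x] by (simp add: inner_smult_right)

lemma inner_minus_right:
  "\<lbrakk>x \<in> carrier H; y \<in> carrier H; z \<in> carrier H\<rbrakk>
    \<Longrightarrow> hinner H x (y \<ominus> z) = hinner H x y - hinner H x z"
  by (simp add: minus_eq uminus_eq_smult inner_add_right inner_smult_right)

lemma inner_minus_left:
  "\<lbrakk>x \<in> carrier H; y \<in> carrier H; z \<in> carrier H\<rbrakk>
    \<Longrightarrow> hinner H (y \<ominus> z) x = hinner H y x - hinner H z x"
  by (simp add: minus_eq uminus_eq_smult inner_add_left inner_smult_left)

lemma inner_zero [simp]:
  "x \<in> carrier H \<Longrightarrow> hinner H x \<zero> = 0" "x \<in> carrier H \<Longrightarrow> hinner H \<zero> x = 0"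
  using inner_smult_right[of x "\<zero>" 0] inner_smult_left[of "\<zero>" x 0] by simp_all

lemma inner_finsum_right:
  "\<lbrakk>finite F; x \<in> carrier H; \<And>i. i \<in> F \<Longrightarrow> f i \<in> carrier H\<rbrakk>
    \<Longrightarrow> hinner H x (finsum H f F) = (\<Sum>i\<in>F. hinner H x (f i))"
proof (induction F rule: finite_induct)
  case (insert i F)
  then have "f \<in> F \<rightarrow> carrier H" by blast
  with insert show ?case
    by (simp add: inner_add_right finsum_closed)
qed simp

lemma inner_finsum_left:
  "\<lbrakk>finite F; x \<in> carrier H; \<And>i. i \<in> F \<Longrightarrow> f i \<in> carrier H\<rbrakk>
    \<Longrightarrow> hinner H (finsum H f F) x = (\<Sum>i\<in>F. hinner H (f i) x)"
  using inner_cnj[of x "finsum H f F"] inner_finsum_right[of F x f] inner_cnj[of x]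
  by (simp add: finsum_closed Pi_iff)

lemma hnorm_sq: "x \<in> carrier H \<Longrightarrow> (hnorm H x)\<^sup>2 = Re (hinner H x x)"
  by (simp add: hnorm_def inner_nonneg)

lemma hnorm_nonneg [simp]: "x \<in> carrier H \<Longrightarrow> 0 \<le> hnorm H x"
  by (simp add: hnorm_def inner_nonneg)

lemma inner_self: "x \<in> carrier H \<Longrightarrow> hinner H x x = of_real ((hnorm H x)\<^sup>2)"
  using inner_cnj[of x x] by (simp add: hnorm_sq complex_eq_iff)

lemma hnorm_eq_0_iff: "x \<in> carrier H \<Longrightarrow> hnorm H x = 0 \<longleftrightarrow> x = \<zero>"
  using inner_definite[of x] inner_self[of x] by auto

lemma hnorm_smult: "x \<in> carrier H \<Longrightarrow> hnorm H (a \<odot> x) = cmod a * hnorm H x"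
proof -
  assume x: "x \<in> carrier H"
  have "(hnorm H (a \<odot> x))\<^sup>2 = Re (a * cnj a * of_real ((hnorm H x)\<^sup>2))"
    unfolding inner_self[OF x, symmetric]
    using x by (simp add: hnorm_sq inner_smult_left inner_smult_right mult.assoc mult.left_commute del: times_complex.simps)
  also have "\<dots> = (cmod a)\<^sup>2 * (hnorm H x)\<^sup>2"
    unfolding complex_norm_square[symmetric] by (simp flip: of_real_power of_real_mult)
  finally show ?thesis
    using x by (simp add: power_mult_distrib[symmetric])
qed

lemma cauchy_schwarz:
  assumes x: "x \<in> carrier H" and y: "y \<in> carrier H"
  shows "cmod (hinner H x y) \<le> hnorm H x * hnorm H y"
proof (cases "y = \<zero>")
  case False
  define t where "t = hinner H y x / hinner H y y"
  have ny: "hnorm H y \<noteq> 0" using False y by (simp add: hnorm_eq_0_iff)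
  have yx: "hinner H y x = cnj (hinner H x y)" using inner_cnj[OF x y] .
  have "hinner H (x \<ominus> t \<odot> y) (x \<ominus> t \<odot> y) = hinner H x x - t * hinner H x y
      - cnj t * (hinner H y x - t * hinner H y y)"
    using x y by (simp add: inner_minus_left inner_minus_right inner_smult_left inner_smult_right)
      (simp add: algebra_simps)
  also have "hinner H y x - t * hinner H y y = 0"
    using ny y by (simp add: t_def inner_self)
  also have "hinner H x x - t * hinner H x y - cnj t * 0
      = of_real ((hnorm H x)\<^sup>2 - (cmod (hinner H x y))\<^sup>2 / (hnorm H y)\<^sup>2)"
    using x y by (simp add: t_def inner_self yx mult.commute[of "cnj _"] complex_norm_square
        flip: of_real_power)
  finally have "0 \<le> (hnorm H x)\<^sup>2 - (cmod (hinner H x y))\<^sup>2 / (hnorm H y)\<^sup>2"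
    using inner_nonneg[of "x \<ominus> t \<odot> y"] x y by simp
  then have "(cmod (hinner H x y))\<^sup>2 \<le> (hnorm H x * hnorm H y)\<^sup>2"
    using ny by (simp add: field_simps power_mult_distrib)
  then show ?thesis
    using x y by (simp add: power2_le_iff_abs_le)
qed (use x y in simp)

text \<open>Identities between vectors are mostly checked weakly from here on: pairing with an
  arbitrary vector turns sums in the module into sums of complex numbers.\<close>

lemma inner_eqI:
  assumes x: "x \<in> carrier H" and y: "y \<in> carrier H"
    and eq: "\<And>z. z \<in> carrier H \<Longrightarrow> hinner H z x = hinner H z y"
  shows "x = y"
proof -
  have "hinner H (x \<ominus> y) (x \<ominus> y) = 0"
    using x y eq[of "x \<ominus> y"] by (simp add: inner_minus_right)
  then have "x \<ominus> y = \<zero>" by (rule inner_definite[OF minus_closed[OF x y]])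
  moreover have "(x \<ominus> y) \<oplus> y = x"
    using x y by (simp add: minus_eq a_assoc l_neg)
  ultimately show ?thesis using y by simp
qed

lemma parallelogram_le:
  assumes x: "x \<in> carrier H" and y: "y \<in> carrier H"
  shows "(hnorm H (x \<oplus> y))\<^sup>2 \<le> 2 * (hnorm H x)\<^sup>2 + 2 * (hnorm H y)\<^sup>2"
  using inner_nonneg[of "x \<ominus> y"] x y
  by (simp add: hnorm_sq inner_add_left inner_add_right inner_minus_left inner_minus_right)

lemma hnorm_triangle:
  assumes x: "x \<in> carrier H" and y: "y \<in> carrier H"
  shows "hnorm H (x \<oplus> y) \<le> hnorm H x + hnorm H y"
proof -
  have "(hnorm H (x \<oplus> y))\<^sup>2 = (hnorm H x)\<^sup>2 + (hnorm H y)\<^sup>2 + 2 * Re (hinner H x y)"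
    using x y inner_cnj[of x y] by (simp add: hnorm_sq inner_add_left inner_add_right)
  also have "\<dots> \<le> (hnorm H x + hnorm H y)\<^sup>2"
    using cauchy_schwarz[OF x y] complex_Re_le_cmod[of "hinner H x y"] by (simp add: power2_sum)
  finally show ?thesis
    using x y by (meson hnorm_nonneg add_nonneg_nonneg power2_le_imp_le)
qed

lemma hnorm_minus_commute:
  assumes "x \<in> carrier H" "y \<in> carrier H"
  shows "hnorm H (x \<ominus> y) = hnorm H (y \<ominus> x)"
proof -
  have "(hnorm H (x \<ominus> y))\<^sup>2 = (hnorm H (y \<ominus> x))\<^sup>2"
    using assms by (simp add: hnorm_sq inner_minus_left inner_minus_right)
  then show ?thesis using assms by (simp add: power2_eq_iff_nonneg)
qed

lemma hnorm_dist_triangle: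
  assumes "x \<in> carrier H" "y \<in> carrier H" "z \<in> carrier H"
  shows "hnorm H (x \<ominus> z) \<le> hnorm H (x \<ominus> y) + hnorm H (y \<ominus> z)"
proof -
  have "x \<ominus> z = (x \<ominus> y) \<oplus> (y \<ominus> z)"
    using assms
    by (intro inner_eqI) (simp_all add: inner_minus_right inner_add_right)
  then show ?thesis using hnorm_triangle assms by simp
qed

end

section \<open>Square-summable sequences in a Hilbert space\<close>

text \<open>This is l^2(I) \<otimes> G. Indexing by the naturals and forcing the coordinates outside
  \<open>I\<close> to vanish lets the infinite case and the n-dimensional case share one
  type.\<close>

definition ell2 :: "nat set \<Rightarrow> 'a hspace \<Rightarrow> (nat \<Rightarrow> 'a) hspace"
  where "ell2 I G =
    \<lparr>carrier = {x. (\<forall>i. x i \<in> carrier G) \<and> (\<forall>i. i \<notin> I \<longrightarrow> x i = \<zero>\<^bsub>G\<^esub>) \<and>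
       summable (\<lambda>i. (hnorm G (x i))\<^sup>2)},
     mult = (\<lambda>x y. x), one = (\<lambda>i. \<zero>\<^bsub>G\<^esub>), zero = (\<lambda>i. \<zero>\<^bsub>G\<^esub>),
     add = (\<lambda>x y i. x i \<oplus>\<^bsub>G\<^esub> y i), smult = (\<lambda>a x i. a \<odot>\<^bsub>G\<^esub> x i),
     hinner = (\<lambda>x y. suminf (\<lambda>i. hinner G (x i) (y i)))\<rparr>"

lemma ell2_simps [simp]:
  "zero (ell2 I G) = (\<lambda>i. \<zero>\<^bsub>G\<^esub>)" "add (ell2 I G) x y = (\<lambda>i. x i \<oplus>\<^bsub>G\<^esub> y i)"
  "smult (ell2 I G) a x = (\<lambda>i. a \<odot>\<^bsub>G\<^esub> x i)"
  "hinner (ell2 I G) x y = (suminf (\<lambda>i. hinner G (x i) (y i)))"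
  by (simp_all add: ell2_def)

lemma ell2_carrier:
  "x \<in> carrier (ell2 I G) \<longleftrightarrow> (\<forall>i. x i \<in> carrier G) \<and> (\<forall>i. i \<notin> I \<longrightarrow> x i = \<zero>\<^bsub>G\<^esub>) \<and>
     summable (\<lambda>i. (hnorm G (x i))\<^sup>2)"
  by (simp add: ell2_def)

context hilbert_space
begin

lemma ell2_D:
  assumes "x \<in> carrier (ell2 I H)"
  shows "x i \<in> carrier H" "i \<notin> I \<Longrightarrow> x i = \<zero>" "summable (\<lambda>i. (hnorm H (x i))\<^sup>2)"
  using assms by (auto simp: ell2_carrier)

lemma ell2_finite_support:
  assumes "\<And>i. x i \<in> carrier H" "\<And>i. i \<notin> I \<Longrightarrow> x i = \<zero>" "\<And>i. i \<ge> N \<Longrightarrow> x i = \<zero>"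
  shows "x \<in> carrier (ell2 I H)"
proof -
  have "summable (\<lambda>i. (hnorm H (x i))\<^sup>2)"
    by (rule summable_finite[of "{..<N}"]) (use assms(3) in \<open>auto simp: hnorm_eq_0_iff\<close>)
  then show ?thesis using assms by (simp add: ell2_carrier)
qed

lemma ell2_inner_summable:
  assumes x: "x \<in> carrier (ell2 I H)" and y: "y \<in> carrier (ell2 I H)"
  shows "summable (\<lambda>i. hinner H (x i) (y i))"
proof (rule summable_norm_cancel, rule summable_comparison_test')
  show "summable (\<lambda>i. (hnorm H (x i))\<^sup>2 + (hnorm H (y i))\<^sup>2)"
    using ell2_D[OF x] ell2_D[OF y] by (intro summable_add)
  fix i :: nat assume "0 \<le> i"
  have "cmod (hinner H (x i) (y i)) \<le> hnorm H (x i) * hnorm H (y i)"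
    using ell2_D[OF x] ell2_D[OF y] by (intro cauchy_schwarz)
  also have "\<dots> \<le> (hnorm H (x i))\<^sup>2 + (hnorm H (y i))\<^sup>2"
    using sum_squares_bound[of "hnorm H (x i)" "hnorm H (y i)"]
      mult_nonneg_nonneg[OF hnorm_nonneg[OF ell2_D(1)[OF x, of i]] hnorm_nonneg[OF ell2_D(1)[OF y, of i]]]
    by linarith
  finally show "norm (norm (hinner H (x i) (y i))) \<le> (hnorm H (x i))\<^sup>2 + (hnorm H (y i))\<^sup>2"
    by simp
qed

lemma ell2_add_closed:
  assumes x: "x \<in> carrier (ell2 I H)" and y: "y \<in> carrier (ell2 I H)"
  shows "(\<lambda>i. x i \<oplus> y i) \<in> carrier (ell2 I H)"
proof -
  have "summable (\<lambda>i. (hnorm H (x i \<oplus> y i))\<^sup>2)"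
  proof (rule summable_comparison_test')
    show "summable (\<lambda>i. 2 * (hnorm H (x i))\<^sup>2 + 2 * (hnorm H (y i))\<^sup>2)"
      using ell2_D[OF x] ell2_D[OF y] by (intro summable_add summable_mult)
  qed (use ell2_D[OF x] ell2_D[OF y] parallelogram_le in simp)
  then show ?thesis
    using ell2_D(1,2)[OF x] ell2_D(1,2)[OF y] by (simp add: ell2_carrier)
qed

lemma ell2_smult_closed:
  assumes x: "x \<in> carrier (ell2 I H)"
  shows "(\<lambda>i. a \<odot> x i) \<in> carrier (ell2 I H)"
proof -
  have "summable (\<lambda>i. (hnorm H (a \<odot> x i))\<^sup>2)"
    using ell2_D[OF x] by (simp add: hnorm_smult power_mult_distrib summable_mult)
  then show ?thesis
    using ell2_D(1,2)[OF x] by (simp add: ell2_carrier)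
qed

lemma ell2_hnorm_sq:
  assumes x: "x \<in> carrier (ell2 I H)"
  shows "Re (hinner (ell2 I H) x x) = (suminf (\<lambda>i. (hnorm H (x i))\<^sup>2))"
proof -
  have "hinner (ell2 I H) x x = of_real (suminf (\<lambda>i. (hnorm H (x i))\<^sup>2))"
    using suminf_of_real[OF ell2_D(3)[OF x], where 'a = complex]
    by (simp only: ell2_simps inner_self[OF ell2_D(1)[OF x]])
  then show ?thesis by simp
qed

lemma ell2_hnorm:
  assumes x: "x \<in> carrier (ell2 I H)"
  shows "hnorm (ell2 I H) x = sqrt (suminf (\<lambda>i. (hnorm H (x i))\<^sup>2))"
  unfolding hnorm_def[of "ell2 I H"] ell2_hnorm_sq[OF x] ..

lemma module_ell2: "module complex_ring (ell2 I H)"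
proof (rule moduleI)
  show "abelian_group (ell2 I H)"
  proof (rule abelian_groupI)
    fix x y z assume x: "x \<in> carrier (ell2 I H)"
    have "(\<lambda>i. (-1) \<odot> x i) \<oplus>\<^bsub>ell2 I H\<^esub> x = \<zero>\<^bsub>ell2 I H\<^esub>"
    proof (simp, rule ext)
      fix i
      have "x i \<in> carrier H" using ell2_D(1)[OF x] .
      then show "(-1) \<odot> x i \<oplus> x i = \<zero>"
        by (simp add: uminus_eq_smult[symmetric] l_neg)
    qed
    then show "\<exists>y\<in>carrier (ell2 I H). y \<oplus>\<^bsub>ell2 I H\<^esub> x = \<zero>\<^bsub>ell2 I H\<^esub>"
      using ell2_smult_closed[OF x, of "-1"] by blast
    show "\<zero>\<^bsub>ell2 I H\<^esub> \<oplus>\<^bsub>ell2 I H\<^esub> x = x"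
      using ell2_D(1)[OF x] by simp
    assume y: "y \<in> carrier (ell2 I H)"
    show "x \<oplus>\<^bsub>ell2 I H\<^esub> y \<in> carrier (ell2 I H)"
      using ell2_add_closed[OF x y] by simp
    show "x \<oplus>\<^bsub>ell2 I H\<^esub> y = y \<oplus>\<^bsub>ell2 I H\<^esub> x"
      using ell2_D(1)[OF x] ell2_D(1)[OF y] by (simp add: a_comm)
    assume z: "z \<in> carrier (ell2 I H)"
    show "x \<oplus>\<^bsub>ell2 I H\<^esub> y \<oplus>\<^bsub>ell2 I H\<^esub> z = x \<oplus>\<^bsub>ell2 I H\<^esub> (y \<oplus>\<^bsub>ell2 I H\<^esub> z)"
      using ell2_D(1)[OF x] ell2_D(1)[OF y] ell2_D(1)[OF z] by (simp add: a_assoc)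
  next
    show "\<zero>\<^bsub>ell2 I H\<^esub> \<in> carrier (ell2 I H)"
      by (simp add: ell2_finite_support)
  qed
qed (use ell2_D(1) in \<open>auto simp: cring_complex_ring ell2_smult_closed smult_distrib\<close>)

lemma ell2_minus:
  assumes x: "x \<in> carrier (ell2 I H)" and y: "y \<in> carrier (ell2 I H)"
  shows "x \<ominus>\<^bsub>ell2 I H\<^esub> y = (\<lambda>i. x i \<ominus> y i)"
proof -
  interpret L: module complex_ring "ell2 I H" by (rule module_ell2)
  have "\<ominus>\<^bsub>ell2 I H\<^esub> y = (-1) \<odot>\<^bsub>ell2 I H\<^esub> y"
    using L.smult_l_minus[of 1 y] L.smult_one[of y] y by simp
  then show ?thesis
    using ell2_D(1)[OF y] by (simp add: a_minus_def uminus_eq_smult)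
qed

lemma ell2_complete:
  assumes X: "\<And>k::nat. X k \<in> carrier (ell2 I H)"
    and cauchy: "\<forall>e>0. \<exists>N. \<forall>k\<ge>N. \<forall>l\<ge>N. hnorm (ell2 I H) (X k \<ominus>\<^bsub>ell2 I H\<^esub> X l) < e"
  shows "\<exists>x\<in>carrier (ell2 I H). (\<lambda>k. hnorm (ell2 I H) (X k \<ominus>\<^bsub>ell2 I H\<^esub> x)) \<longlonglongrightarrow> 0"
proof -
  interpret L: module complex_ring "ell2 I H" by (rule module_ell2)
  note XH [simp] = ell2_D(1)[OF X]
  have diff: "(\<lambda>i. X k i \<ominus> X l i) \<in> carrier (ell2 I H)" for k l
    using L.minus_closed[OF X[of k] X[of l]] by (simp add: ell2_minus X)
  have part: "(\<Sum>i<M. (hnorm H (X k i \<ominus> X l i))\<^sup>2)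
      \<le> (hnorm (ell2 I H) (X k \<ominus>\<^bsub>ell2 I H\<^esub> X l))\<^sup>2" for M k l
    unfolding ell2_minus[OF X X] ell2_hnorm[OF diff]
    using ell2_D(3)[OF diff[of k l]] by (simp add: sum_le_suminf suminf_nonneg)
  have coord: "\<exists>x\<in>carrier H. (\<lambda>k. hnorm H (X k i \<ominus> x)) \<longlonglongrightarrow> 0" for i
  proof (rule complete)
    show "\<forall>e>0. \<exists>N. \<forall>k\<ge>N. \<forall>l\<ge>N. hnorm H (X k i \<ominus> X l i) < e"
    proof (intro allI impI)
      fix e :: real assume e: "e > 0"
      then obtain N where N: "\<And>k l. k \<ge> N \<Longrightarrow> l \<ge> N \<Longrightarrow> hnorm (ell2 I H) (X k \<ominus>\<^bsub>ell2 I H\<^esub> X l) < e"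
        using cauchy by blast
      have "hnorm H (X k i \<ominus> X l i) < e" if "k \<ge> N" "l \<ge> N" for k l
      proof -
        have "(hnorm H (X k i \<ominus> X l i))\<^sup>2 \<le> (\<Sum>i<Suc i. (hnorm H (X k i \<ominus> X l i))\<^sup>2)"
          by (simp add: sum_nonneg)
        also have "\<dots> \<le> (hnorm (ell2 I H) (X k \<ominus>\<^bsub>ell2 I H\<^esub> X l))\<^sup>2" by (rule part)
        finally have "hnorm H (X k i \<ominus> X l i) \<le> hnorm (ell2 I H) (X k \<ominus>\<^bsub>ell2 I H\<^esub> X l)"
          by (rule power2_le_imp_le) (simp add: ell2_minus X ell2_hnorm diff suminf_nonneg ell2_D(3)[OF diff])
        then show ?thesis using N[OF that] by simp
      qed
      then show "\<exists>N. \<forall>k\<ge>N. \<forall>l\<ge>N. hnorm H (X k i \<ominus> X l i) < e" by blast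
    qed
  qed simp
  then obtain x where xH [simp]: "\<And>i. x i \<in> carrier H"
    and lim: "\<And>i. (\<lambda>k. hnorm H (X k i \<ominus> x i)) \<longlonglongrightarrow> 0" by metis
  have x0: "x i = \<zero>" if "i \<notin> I" for i
  proof -
    have "hnorm H (\<zero> \<ominus> x i) = 0"
      using lim[of i] ell2_D(2)[OF X that] by (simp add: LIMSEQ_const_iff)
    then have "hnorm H ((-1) \<odot> x i) = 0" by (simp add: minus_eq uminus_eq_smult)
    then show ?thesis by (simp add: hnorm_smult hnorm_eq_0_iff)
  qed
  \<comment> \<open>Only finite partial sums are controlled at first: for fixed \<open>M\<close> the
    limit in \<open>l\<close> can be taken term by term, and the bound is uniform in
    \<open>M\<close>.\<close>
  have tail: "(\<Sum>i<M. (hnorm H (X k i \<ominus> x i))\<^sup>2) \<le> e\<^sup>2"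
    if N: "\<And>k l. k \<ge> N \<Longrightarrow> l \<ge> N \<Longrightarrow> hnorm (ell2 I H) (X k \<ominus>\<^bsub>ell2 I H\<^esub> X l) < e" and k: "k \<ge> N"
    for M k N e
  proof (rule tendsto_upperbound)
    have "(\<lambda>l. hnorm H (X k i \<ominus> X l i)) \<longlonglongrightarrow> hnorm H (X k i \<ominus> x i)" for i
    proof (rule LIM_zero_cancel, rule Lim_null_comparison[OF _ lim[of i]], rule always_eventually, rule allI)
      fix l
      have "hnorm H (X k i \<ominus> X l i) \<le> hnorm H (X k i \<ominus> x i) + hnorm H (x i \<ominus> X l i)"
        by (rule hnorm_dist_triangle) simp_all
      moreover have "hnorm H (X k i \<ominus> x i) \<le> hnorm H (X k i \<ominus> X l i) + hnorm H (X l i \<ominus> x i)"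
        by (rule hnorm_dist_triangle) simp_all
      moreover have "hnorm H (x i \<ominus> X l i) = hnorm H (X l i \<ominus> x i)"
        by (rule hnorm_minus_commute) simp_all
      ultimately show "norm (hnorm H (X k i \<ominus> X l i) - hnorm H (X k i \<ominus> x i))
          \<le> hnorm H (X l i \<ominus> x i)" by (simp add: abs_le_iff)
    qed
    then show "(\<lambda>l. \<Sum>i<M. (hnorm H (X k i \<ominus> X l i))\<^sup>2) \<longlonglongrightarrow> (\<Sum>i<M. (hnorm H (X k i \<ominus> x i))\<^sup>2)"
      by (intro tendsto_intros)
    have "(\<Sum>i<M. (hnorm H (X k i \<ominus> X l i))\<^sup>2) \<le> e\<^sup>2" if "l \<ge> N" for l
    proof -
      have "0 \<le> hnorm (ell2 I H) (X k \<ominus>\<^bsub>ell2 I H\<^esub> X l)"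
        by (simp add: ell2_minus X ell2_hnorm diff suminf_nonneg ell2_D(3)[OF diff])
      then have "(hnorm (ell2 I H) (X k \<ominus>\<^bsub>ell2 I H\<^esub> X l))\<^sup>2 \<le> e\<^sup>2"
        using N[OF k that] by (intro power_mono) auto
      then show ?thesis using part[of k l M] by linarith
    qed
    then show "\<forall>\<^sub>F l in sequentially. (\<Sum>i<M. (hnorm H (X k i \<ominus> X l i))\<^sup>2) \<le> e\<^sup>2"
      using eventually_sequentially by blast
  qed simp
  have close: "(\<lambda>i. X k i \<ominus> x i) \<in> carrier (ell2 I H) \<and>
      (suminf (\<lambda>i. (hnorm H (X k i \<ominus> x i))\<^sup>2)) \<le> e\<^sup>2"
    if N: "\<And>k l. k \<ge> N \<Longrightarrow> l \<ge> N \<Longrightarrow> hnorm (ell2 I H) (X k \<ominus>\<^bsub>ell2 I H\<^esub> X l) < e" and k: "k \<ge> N"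
    for k N e
  proof -
    have s: "summable (\<lambda>i. (hnorm H (X k i \<ominus> x i))\<^sup>2)"
      by (rule summableI_nonneg_bounded[where x = "e\<^sup>2"]) (simp_all add: tail[OF N k])
    moreover have "X k i \<ominus> x i = \<zero>" if "i \<notin> I" for i
      using ell2_D(2)[OF X that] x0[OF that] by (simp add: minus_eq uminus_eq_smult)
    ultimately show ?thesis
      using suminf_le_const[OF s, of "e\<^sup>2"] tail[OF N k] by (simp add: ell2_carrier)
  qed
  obtain N1 where N1: "\<And>k l. k \<ge> N1 \<Longrightarrow> l \<ge> N1 \<Longrightarrow> hnorm (ell2 I H) (X k \<ominus>\<^bsub>ell2 I H\<^esub> X l) < 1"
    using cauchy zero_less_one by meson
  have xl: "x \<in> carrier (ell2 I H)"
  proof -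
    \<comment> \<open>The limit is recovered as X - (X - x), both terms of which are already known
      to be square-summable.\<close>
    have "X N1 \<ominus>\<^bsub>ell2 I H\<^esub> (\<lambda>i. X N1 i \<ominus> x i) \<in> carrier (ell2 I H)"
      using close[where e = 1, OF N1 order_refl] X by (intro L.minus_closed) auto
    also have "X N1 \<ominus>\<^bsub>ell2 I H\<^esub> (\<lambda>i. X N1 i \<ominus> x i) = (\<lambda>i. X N1 i \<ominus> (X N1 i \<ominus> x i))"
      using close[where e = 1, OF N1 order_refl] X by (intro ell2_minus) auto
    also have "\<dots> = x"
      by (rule ext, rule inner_eqI) (simp_all add: inner_minus_right)
    finally show ?thesis .
  qed
  have "(\<lambda>k. hnorm (ell2 I H) (X k \<ominus>\<^bsub>ell2 I H\<^esub> x)) \<longlonglongrightarrow> 0"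
  proof (rule LIMSEQ_I)
    fix r :: real assume r: "0 < r"
    then obtain N where N: "\<And>k l. k \<ge> N \<Longrightarrow> l \<ge> N \<Longrightarrow> hnorm (ell2 I H) (X k \<ominus>\<^bsub>ell2 I H\<^esub> X l) < r / 2"
      using cauchy half_gt_zero[OF r] by meson
    have "norm (hnorm (ell2 I H) (X k \<ominus>\<^bsub>ell2 I H\<^esub> x) - 0) < r" if "k \<ge> N" for k
    proof -
      note c = close[OF N that]
      have "sqrt (suminf (\<lambda>i. (hnorm H (X k i \<ominus> x i))\<^sup>2)) \<le> sqrt ((r / 2)\<^sup>2)"
        using c by (intro real_sqrt_le_mono) blast
      moreover have "0 \<le> (suminf (\<lambda>i. (hnorm H (X k i \<ominus> x i))\<^sup>2))"
        using c by (intro suminf_nonneg) (auto simp: ell2_carrier)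
      ultimately show ?thesis
        using c r by (simp add: ell2_minus[OF X xl] ell2_hnorm)
    qed
    then show "\<exists>N. \<forall>k\<ge>N. norm (hnorm (ell2 I H) (X k \<ominus>\<^bsub>ell2 I H\<^esub> x) - 0) < r" by blast
  qed
  with xl show ?thesis by blast
qed

lemma hilbert_space_ell2: "hilbert_space (ell2 I H)"
proof (intro hilbert_space.intro module_ell2 hilbert_space_axioms.intro)
  fix x y z a
  assume x: "x \<in> carrier (ell2 I H)"
  show "0 \<le> Re (hinner (ell2 I H) x x)"
    using ell2_D[OF x] by (simp only: ell2_hnorm_sq[OF x]) (simp add: suminf_nonneg)
  show "x = \<zero>\<^bsub>ell2 I H\<^esub>" if "hinner (ell2 I H) x x = 0"
  proof -
    have "(suminf (\<lambda>i. (hnorm H (x i))\<^sup>2)) = 0" using ell2_hnorm_sq[OF x] that by simp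
    then show ?thesis
      using suminf_eq_zero_iff[OF ell2_D(3)[OF x]] hnorm_eq_0_iff[OF ell2_D(1)[OF x]] by auto
  qed
  assume y: "y \<in> carrier (ell2 I H)"
  show "hinner (ell2 I H) x (a \<odot>\<^bsub>ell2 I H\<^esub> y) = a * hinner (ell2 I H) x y"
    using ell2_D(1)[OF x] ell2_D(1)[OF y]
    by (simp add: inner_smult_right suminf_mult ell2_inner_summable[OF x y])
  show "hinner (ell2 I H) y x = cnj (hinner (ell2 I H) x y)"
  proof -
    have "hinner H (y i) (x i) = cnj (hinner H (x i) (y i))" for i
      by (rule inner_cnj[OF ell2_D(1)[OF x] ell2_D(1)[OF y]])
    then have "hinner (ell2 I H) y x = (suminf (\<lambda>i. cnj (hinner H (x i) (y i))))" by simp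
    also have "\<dots> = cnj (hinner (ell2 I H) x y)"
      using sums_cnj[THEN iffD2, OF summable_sums[OF ell2_inner_summable[OF x y]]]
      by (simp add: sums_unique[symmetric])
    finally show ?thesis .
  qed
  assume z: "z \<in> carrier (ell2 I H)"
  show "hinner (ell2 I H) x (y \<oplus>\<^bsub>ell2 I H\<^esub> z) = hinner (ell2 I H) x y + hinner (ell2 I H) x z"
    using ell2_D(1)[OF x] ell2_D(1)[OF y] ell2_D(1)[OF z]
    by (simp add: inner_add_right suminf_add[symmetric] ell2_inner_summable[OF x y] ell2_inner_summable[OF x z])
qed (rule ell2_complete)

end

section \<open>Adjoints and unitary operators\<close>

lemma (in hilbert_space) adj_eqI:
  assumes z: "z \<in> carrier H" and eq: "\<And>x. x \<in> carrier H \<Longrightarrow> hinner K (T x) y = hinner H x z"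
  shows "adj H K T y = z"
  unfolding adj_def
proof (rule the_equality)
  fix z' assume "z' \<in> carrier H \<and> (\<forall>x\<in>carrier H. hinner K (T x) y = hinner H x z')"
  then show "z' = z" using z eq by (intro inner_eqI) auto
qed (use z eq in blast)

context hilbert_space
begin

lemma unitary_op_closed: "unitary_op H T \<Longrightarrow> x \<in> carrier H \<Longrightarrow> T x \<in> carrier H"
  by (simp add: unitary_op_def bounded_op_def)

lemma unitary_op_add:
  "\<lbrakk>unitary_op H T; x \<in> carrier H; y \<in> carrier H\<rbrakk> \<Longrightarrow> T (x \<oplus> y) = T x \<oplus> T y"
  by (simp add: unitary_op_def bounded_op_def)

lemma unitary_op_smult:
  "\<lbrakk>unitary_op H T; x \<in> carrier H\<rbrakk> \<Longrightarrow> T (a \<odot> x) = a \<odot> T x"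
  by (simp add: unitary_op_def bounded_op_def)

text \<open>The definite description in \<open>adj\<close> has an unspecified value where no adjoint vector exists. This value does
  not depend on the vector, so if there were none at \<open>y\<close>, hence none at \<open>2 y\<close>, then applying \<open>T\<close> to it
  would give \<open>2 y = y\<close>.\<close>

lemma unitary_op_adj_exists:
  assumes T: "unitary_op H T" and y: "y \<in> carrier H"
  shows "\<exists>z\<in>carrier H. \<forall>x\<in>carrier H. hinner H (T x) y = hinner H x z"
proof (rule ccontr)
  assume no: "\<not> ?thesis"
  have no2: "\<not> (\<exists>z\<in>carrier H. \<forall>x\<in>carrier H. hinner H (T x) (2 \<odot> y) = hinner H x z)"
  proof
    assume "\<exists>z\<in>carrier H. \<forall>x\<in>carrier H. hinner H (T x) (2 \<odot> y) = hinner H x z"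
    then obtain z where z: "z \<in> carrier H"
      and eq: "\<And>x. x \<in> carrier H \<Longrightarrow> hinner H (T x) (2 \<odot> y) = hinner H x z" by blast
    have "hinner H (T x) y = hinner H x ((1/2) \<odot> z)" if "x \<in> carrier H" for x
      using eq[OF that] that z y unitary_op_closed[OF T that] by (simp add: inner_smult_right mult.commute)
    then show False using no z by (meson smult_complex(1))
  qed
  have "adj H H T y = (THE z. False)" "adj H H T (2 \<odot> y) = (THE z. False)"
    unfolding adj_def using no no2 by (auto intro!: arg_cong[where f = The] ext)
  moreover have "T (adj H H T y) = y" "T (adj H H T (2 \<odot> y)) = 2 \<odot> y"
    using T y by (simp_all add: unitary_op_def)
  ultimately have two: "2 \<odot> y = y" by metis
  have "hinner H z y = 0" if "z \<in> carrier H" for z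
    using inner_smult_right[OF that y, of 2] two by simp
  then have "\<forall>x\<in>carrier H. hinner H (T x) y = hinner H x \<zero>"
    using unitary_op_closed[OF T] by simp
  then show False using no zero_closed by blast
qed

lemma unitary_op_adj:
  assumes T: "unitary_op H T" and y: "y \<in> carrier H"
  shows "adj H H T y \<in> carrier H"
    and "x \<in> carrier H \<Longrightarrow> hinner H (T x) y = hinner H x (adj H H T y)"
    and "T (adj H H T y) = y" and "adj H H T (T y) = y"
proof -
  obtain z where "z \<in> carrier H" "\<And>x. x \<in> carrier H \<Longrightarrow> hinner H (T x) y = hinner H x z"
    using unitary_op_adj_exists[OF T y] by blast
  then show "adj H H T y \<in> carrier H" "x \<in> carrier H \<Longrightarrow> hinner H (T x) y = hinner H x (adj H H T y)"
    using adj_eqI[of z H T y] by auto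
  show "T (adj H H T y) = y" "adj H H T (T y) = y"
    using T y by (simp_all add: unitary_op_def)
qed

lemma unitary_op_inner:
  "\<lbrakk>unitary_op H T; x \<in> carrier H; y \<in> carrier H\<rbrakk> \<Longrightarrow> hinner H (T x) (T y) = hinner H x y"
  using unitary_op_adj(2)[of T "T y" x] unitary_op_adj(4)[of T y] unitary_op_closed by simp

text \<open>A right inverse \<open>S\<close> of an inner product preserving map is its adjoint:
  \<langle>T x, y\<rangle> = \<langle>T x, T (S y)\<rangle> = \<langle>x, S y\<rangle>.\<close>

lemma unitary_opI:
  assumes "\<And>x. x \<in> carrier H \<Longrightarrow> T x \<in> carrier H"
    and "\<And>x y. \<lbrakk>x \<in> carrier H; y \<in> carrier H\<rbrakk> \<Longrightarrow> T (x \<oplus> y) = T x \<oplus> T y"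
    and "\<And>a x. x \<in> carrier H \<Longrightarrow> T (a \<odot> x) = a \<odot> T x"
    and inner: "\<And>x y. \<lbrakk>x \<in> carrier H; y \<in> carrier H\<rbrakk> \<Longrightarrow> hinner H (T x) (T y) = hinner H x y"
    and S: "\<And>x. x \<in> carrier H \<Longrightarrow> S x \<in> carrier H" "\<And>x. x \<in> carrier H \<Longrightarrow> T (S x) = x"
  shows "unitary_op H T"
proof -
  have "hnorm H (T x) \<le> 1 * hnorm H x" if "x \<in> carrier H" for x
    by (simp add: hnorm_def inner that)
  then have "bounded_op H H T" unfolding bounded_op_def using assms(1-3) by blast
  moreover have "adj H H T (T x) = x" if "x \<in> carrier H" for x
    using that inner by (intro adj_eqI) auto
  moreover have "adj H H T x = S x" if "x \<in> carrier H" for x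
    using that S inner[of _ "S x"] by (intro adj_eqI) auto
  ultimately show ?thesis using S by (simp add: unitary_op_def)
qed

lemma unitary_op_adj_unitary:
  assumes T: "unitary_op H T"
  shows "unitary_op H (adj H H T)"
proof (rule unitary_opI[where S = T])
  let ?S = "adj H H T"
  note S = unitary_op_adj(1)[OF T]
  fix x y a assume x: "x \<in> carrier H"
  show "?S x \<in> carrier H" using S[OF x] .
  show "?S (a \<odot> x) = a \<odot> ?S x"
    using x S unitary_op_adj(2)[OF T x] unitary_op_closed[OF T]
    by (intro adj_eqI) (auto simp: inner_smult_right)
  assume y: "y \<in> carrier H"
  show "?S (x \<oplus> y) = ?S x \<oplus> ?S y"
    using x y S unitary_op_adj(2)[OF T x] unitary_op_adj(2)[OF T y] unitary_op_closed[OF T]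
    by (intro adj_eqI) (auto simp: inner_add_right)
  show "hinner H (?S x) (?S y) = hinner H x y"
    using unitary_op_inner[OF T S[OF x] S[OF y]] unitary_op_adj(3)[OF T] x y by simp
qed (use unitary_op_adj(4)[OF T] unitary_op_closed[OF T] in auto)

text \<open>Polarization: the vector x + y yields the real parts, and replacing y by \<i> y yields
  the imaginary parts.\<close>

lemma inner_preserving:
  assumes K: "hilbert_space K" and T: "\<And>x. x \<in> carrier H \<Longrightarrow> T x \<in> carrier K"
    "\<And>x y. \<lbrakk>x \<in> carrier H; y \<in> carrier H\<rbrakk> \<Longrightarrow> T (x \<oplus> y) = T x \<oplus>\<^bsub>K\<^esub> T y"
    "\<And>a x. x \<in> carrier H \<Longrightarrow> T (a \<odot> x) = a \<odot>\<^bsub>K\<^esub> T x"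
    and norm: "\<And>x. x \<in> carrier H \<Longrightarrow> hnorm K (T x) = hnorm H x"
    and x: "x \<in> carrier H" and y: "y \<in> carrier H"
  shows "hinner K (T x) (T y) = hinner H x y"
proof -
  interpret K: hilbert_space K by (rule K)
  have re: "Re (hinner K (T x) (T y)) = Re (hinner H x y)" if x: "x \<in> carrier H" and y: "y \<in> carrier H" for x y
  proof -
    have "(hnorm K (T (x \<oplus> y)))\<^sup>2 = (hnorm H (x \<oplus> y))\<^sup>2"
      using norm x y by simp
    then show ?thesis
      using x y norm[OF x] norm[OF y] inner_cnj[OF x y] K.inner_cnj[OF T(1)[OF x] T(1)[OF y]]
        hnorm_sq[OF x] hnorm_sq[OF y] K.hnorm_sq[OF T(1)[OF x]] K.hnorm_sq[OF T(1)[OF y]]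
      by (simp add: T hnorm_sq K.hnorm_sq inner_add_left inner_add_right K.inner_add_left K.inner_add_right)
  qed
  have "Re (hinner K (T x) (T (\<i> \<odot> y))) = Re (hinner H x (\<i> \<odot> y))"
    using x y by (intro re) auto
  then have "Im (hinner K (T x) (T y)) = Im (hinner H x y)"
    using x y by (simp add: T inner_smult_right K.inner_smult_right)
  then show ?thesis using re[OF x y] by (simp add: complex_eq_iff)
qed

end

section \<open>Banded unitary matrices and their tensor products with operators\<close>

text \<open>Products of infinite matrices are finite sums: the row and the column number \<open>i\<close> vanish from the
  position \<open>\<beta> i\<close> on.\<close>

definition unitary_matrix :: "nat set \<Rightarrow> (nat \<Rightarrow> nat) \<Rightarrow> (nat \<Rightarrow> nat \<Rightarrow> complex) \<Rightarrow> bool"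
  where "unitary_matrix I \<beta> a \<longleftrightarrow>
    (\<forall>i j. a i j \<noteq> 0 \<longrightarrow> i \<in> I \<and> j \<in> I \<and> j < \<beta> i \<and> i < \<beta> j) \<and>
    (\<forall>i j. (\<Sum>l<\<beta> j. cnj (a l i) * a l j) = of_bool (i = j \<and> i \<in> I)) \<and>
    (\<forall>i j. (\<Sum>l<\<beta> i. a i l * cnj (a j l)) = of_bool (i = j \<and> i \<in> I))"

definition adj_matrix :: "(nat \<Rightarrow> nat \<Rightarrow> complex) \<Rightarrow> nat \<Rightarrow> nat \<Rightarrow> complex"
  where "adj_matrix a i j = cnj (a j i)"

lemma unitary_matrixD:
  assumes "unitary_matrix I \<beta> a"
  shows "i \<notin> I \<Longrightarrow> a i j = 0" "j \<notin> I \<Longrightarrow> a i j = 0" "\<beta> i \<le> j \<Longrightarrow> a i j = 0" "\<beta> j \<le> i \<Longrightarrow> a i j = 0"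
    "(\<Sum>l<\<beta> j. cnj (a l i) * a l j) = of_bool (i = j \<and> i \<in> I)"
    "(\<Sum>l<\<beta> i. a i l * cnj (a j l)) = of_bool (i = j \<and> i \<in> I)"
  using assms unfolding unitary_matrix_def by (force simp: not_less[symmetric])+

lemma unitary_matrix_adj:
  assumes a: "unitary_matrix I \<beta> a"
  shows "unitary_matrix I \<beta> (adj_matrix a)"
  unfolding unitary_matrix_def adj_matrix_def
proof (intro conjI allI impI)
  fix i j
  show "(\<Sum>l<\<beta> j. cnj (cnj (a i l)) * cnj (a j l)) = of_bool (i = j \<and> i \<in> I)"
    using arg_cong[OF unitary_matrixD(6)[OF a, of j i], of cnj] by (auto simp: mult.commute)
  show "(\<Sum>l<\<beta> i. cnj (a l i) * cnj (cnj (a l j))) = of_bool (i = j \<and> i \<in> I)"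
    using arg_cong[OF unitary_matrixD(5)[OF a, of j i], of cnj] by (auto simp: mult.commute)
qed (use unitary_matrixD(1-4)[OF a] in \<open>fastforce simp: not_less[symmetric]\<close>)+

text \<open>The operator a \<otimes> T on l^2 \<otimes> G. For a matrix of profile
  \<open>\<beta>\<close> the sum stops beyond the last nonzero entry of the row.\<close>

definition mat_op :: "'a hspace \<Rightarrow> (nat \<Rightarrow> nat) \<Rightarrow> (nat \<Rightarrow> nat \<Rightarrow> complex) \<Rightarrow> ('a \<Rightarrow> 'a)
    \<Rightarrow> (nat \<Rightarrow> 'a) \<Rightarrow> nat \<Rightarrow> 'a"
  where "mat_op G \<beta> a T x i = finsum G (\<lambda>j. a i j \<odot>\<^bsub>G\<^esub> T (x j)) {..<\<beta> i}"

context hilbert_space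
begin

context
  fixes I \<beta> a T
  assumes a: "unitary_matrix I \<beta> a" and T: "unitary_op H T"
begin

lemma mat_op_closed: "(\<And>i. x i \<in> carrier H) \<Longrightarrow> mat_op H \<beta> a T x i \<in> carrier H"
  unfolding mat_op_def using unitary_op_closed[OF T] by (intro finsum_closed) auto

lemma inner_mat_op:
  assumes x: "\<And>i. x i \<in> carrier H" and z: "z \<in> carrier H" and N: "\<beta> i \<le> N"
  shows "hinner H z (mat_op H \<beta> a T x i) = (\<Sum>j<N. a i j * hinner H z (T (x j)))"
proof -
  have "hinner H z (mat_op H \<beta> a T x i) = (\<Sum>j<\<beta> i. a i j * hinner H z (T (x j)))"
    unfolding mat_op_def using unitary_op_closed[OF T] x z
    by (subst inner_finsum_right) (auto simp: inner_smult_right)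
  also have "\<dots> = (\<Sum>j<N. a i j * hinner H z (T (x j)))"
    using N unitary_matrixD(3)[OF a] by (intro sum.mono_neutral_left) auto
  finally show ?thesis .
qed

lemma mat_op_outside: 
  assumes x: "\<And>i. x i \<in> carrier H" and "i \<notin> I"
  shows "mat_op H \<beta> a T x i = \<zero>"
  using mat_op_closed[of x i] inner_mat_op[of x _ i "\<beta> i"] x unitary_matrixD(1)[OF a \<open>i \<notin> I\<close>]
  by (intro inner_eqI) auto

text \<open>With \<open>c\<close> the image of \<open>x\<close> and \<open>d = a\<^sup>* (1\<^bsub>i<m\<^esub> c)\<close>, expand \<open>0 \<le> \<parallel>d - T x\<parallel>\<^sup>2\<close>; only finitely many
  entries of \<open>x\<close> are involved.\<close>

lemma mat_op_partial_norm:
  assumes x: "\<And>i. x i \<in> carrier H"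
  shows "\<exists>J. (\<Sum>i<m. (hnorm H (mat_op H \<beta> a T x i))\<^sup>2) \<le> (\<Sum>j<J. (hnorm H (x j))\<^sup>2)"
proof -
  define c where "c = mat_op H \<beta> a T x"
  define J where "J = (\<Sum>i<m. \<beta> i)"
  define d where "d j = finsum H (\<lambda>i. cnj (a i j) \<odot> c i) {..<m}" for j
  have J: "\<beta> i \<le> J" if "i < m" for i
    unfolding J_def using that by (intro member_le_sum) auto
  have c: "c i \<in> carrier H" for i using mat_op_closed x by (simp add: c_def)
  have d: "d j \<in> carrier H" for j unfolding d_def using c by (intro finsum_closed) auto
  have Tx: "T (x j) \<in> carrier H" for j using unitary_op_closed[OF T x] .
  have inner_d: "hinner H (d j) z = (\<Sum>i<m. a i j * hinner H (c i) z)" if "z \<in> carrier H" for j z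
    unfolding d_def using that c by (subst inner_finsum_left) (auto simp: inner_smult_left)
  have inner_d2: "hinner H z (d j) = (\<Sum>i<m. cnj (a i j) * hinner H z (c i))" if "z \<in> carrier H" for j z
    unfolding d_def using that c by (subst inner_finsum_right) (auto simp: inner_smult_right)
  have aa: "(\<Sum>j<J. a i j * cnj (a i' j)) = of_bool (i = i' \<and> i \<in> I)" if "i < m" for i i'
    using unitary_matrixD(6)[OF a, of i i'] J[OF that] unitary_matrixD(3)[OF a]
    by (subst sum.mono_neutral_right[of _ "{..<\<beta> i}"]) auto
  have c0: "c i = \<zero>" if "i \<notin> I" for i
    using mat_op_outside[OF x that] by (simp add: c_def)
  let ?S = "\<Sum>i<m. hinner H (c i) (c i)"
  have "(\<Sum>j<J. hinner H (d j) (d j))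
      = (\<Sum>j<J. \<Sum>i<m. \<Sum>i'<m. a i j * (cnj (a i' j) * hinner H (c i) (c i')))"
    by (simp only: inner_d[OF d] inner_d2[OF c] sum_distrib_left)
  also have "\<dots> = (\<Sum>i<m. \<Sum>j<J. \<Sum>i'<m. a i j * (cnj (a i' j) * hinner H (c i) (c i')))"
    by (rule sum.swap)
  also have "\<dots> = (\<Sum>i<m. \<Sum>i'<m. \<Sum>j<J. a i j * (cnj (a i' j) * hinner H (c i) (c i')))"
    by (rule sum.cong[OF refl], rule sum.swap)
  also have "\<dots> = (\<Sum>i<m. \<Sum>i'<m. (\<Sum>j<J. a i j * cnj (a i' j)) * hinner H (c i) (c i'))"
    by (simp add: sum_distrib_right mult.assoc)
  also have "\<dots> = (\<Sum>i<m. \<Sum>i'<m. (if i = i' then hinner H (c i) (c i) else 0))"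
    using c c0 by (intro sum.cong refl) (auto simp: aa)
  also have "\<dots> = ?S" by (simp add: sum.delta)
  finally have dd: "(\<Sum>j<J. hinner H (d j) (d j)) = ?S" .
  have "(\<Sum>j<J. hinner H (d j) (T (x j))) = (\<Sum>i<m. \<Sum>j<J. a i j * hinner H (c i) (T (x j)))"
    using Tx by (simp add: inner_d) (rule sum.swap)
  also have "\<dots> = ?S"
    using inner_mat_op[OF x c J] by (intro sum.cong refl) (simp add: c_def)
  finally have dx: "(\<Sum>j<J. hinner H (d j) (T (x j))) = ?S" .
  have "0 \<le> (\<Sum>j<J. Re (hinner H (d j \<ominus> T (x j)) (d j \<ominus> T (x j))))"
    using d Tx by (intro sum_nonneg inner_nonneg) auto
  also have "\<dots> = (\<Sum>j<J. Re (hinner H (d j) (d j)) - 2 * Re (hinner H (d j) (T (x j))) + (hnorm H (x j))\<^sup>2)"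
  proof (rule sum.cong[OF refl])
    fix j
    have "hinner H (T (x j)) (d j) = cnj (hinner H (d j) (T (x j)))"
      by (rule inner_cnj[OF d Tx])
    then show "Re (hinner H (d j \<ominus> T (x j)) (d j \<ominus> T (x j)))
        = Re (hinner H (d j) (d j)) - 2 * Re (hinner H (d j) (T (x j))) + (hnorm H (x j))\<^sup>2"
      using d Tx unitary_op_inner[OF T x x] by (simp add: inner_minus_left inner_minus_right hnorm_sq x)
  qed
  also have "\<dots> = Re (\<Sum>j<J. hinner H (d j) (d j)) - 2 * Re (\<Sum>j<J. hinner H (d j) (T (x j)))
      + (\<Sum>j<J. (hnorm H (x j))\<^sup>2)"
    by (simp add: sum.distrib sum_subtractf sum_distrib_left)
  also have "\<dots> = (\<Sum>j<J. (hnorm H (x j))\<^sup>2) - (\<Sum>i<m. (hnorm H (c i))\<^sup>2)"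
    unfolding dd dx using c by (simp add: hnorm_sq)
  finally show ?thesis unfolding c_def by (intro exI[of _ J]) simp
qed

lemma mat_op_ell2:
  assumes x: "x \<in> carrier (ell2 I H)"
  shows "mat_op H \<beta> a T x \<in> carrier (ell2 I H)"
    and "hnorm (ell2 I H) (mat_op H \<beta> a T x) \<le> hnorm (ell2 I H) x"
proof -
  note xH = ell2_D(1)[OF x]
  have le: "(\<Sum>i<m. (hnorm H (mat_op H \<beta> a T x i))\<^sup>2) \<le> suminf (\<lambda>i. (hnorm H (x i))\<^sup>2)" for m
  proof -
    obtain J where "(\<Sum>i<m. (hnorm H (mat_op H \<beta> a T x i))\<^sup>2) \<le> (\<Sum>j<J. (hnorm H (x j))\<^sup>2)"
      using mat_op_partial_norm[of x m] xH by blast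
    also have "\<dots> \<le> suminf (\<lambda>i. (hnorm H (x i))\<^sup>2)"
      by (rule sum_le_suminf[OF ell2_D(3)[OF x]]) auto
    finally show ?thesis .
  qed
  have s: "summable (\<lambda>i. (hnorm H (mat_op H \<beta> a T x i))\<^sup>2)"
    by (rule summableI_nonneg_bounded[OF _ le]) simp
  then show mem: "mat_op H \<beta> a T x \<in> carrier (ell2 I H)"
    using mat_op_closed[OF xH] mat_op_outside[OF xH] by (simp add: ell2_carrier)
  show "hnorm (ell2 I H) (mat_op H \<beta> a T x) \<le> hnorm (ell2 I H) x"
    unfolding ell2_hnorm[OF mem] ell2_hnorm[OF x]
    by (intro real_sqrt_le_mono suminf_le_const[OF s] le)
qed

end

text \<open>The product rule (a \<otimes> S) (b \<otimes> T) = a b \<otimes> S T, tested at one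
  coordinate. \<open>N\<close> has to exceed the bandwidth of every row of \<open>b\<close> that
  meets row \<open>i\<close> of \<open>a\<close>; the sum of these bandwidths is a convenient
  bound.\<close>

lemma inner_mat_op_comp:
  assumes a: "unitary_matrix I \<beta> a" and b: "unitary_matrix I \<beta> b"
    and S: "unitary_op H S" and T: "unitary_op H T"
    and x: "\<And>i. x i \<in> carrier H" and z: "z \<in> carrier H" and N: "(\<Sum>j<\<beta> i. \<beta> j) \<le> N"
  shows "hinner H z (mat_op H \<beta> a S (mat_op H \<beta> b T x) i)
    = (\<Sum>k<N. (\<Sum>j<\<beta> i. a i j * b j k) * hinner H z (S (T (x k))))"
proof -
  let ?y = "mat_op H \<beta> b T x"
  \<comment> \<open>Writing z = S w removes \<open>S\<close> from the inner products, so that the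
    expansion of the inner factor applies.\<close>
  define w where "w = adj H H S z"
  have w: "w \<in> carrier H" and Sw: "S w = z"
    using unitary_op_adj[OF S z] by (simp_all add: w_def)
  have y: "?y j \<in> carrier H" for j using mat_op_closed[OF b T] x .
  have SS: "hinner H z (S v) = hinner H w v" if "v \<in> carrier H" for v
    using unitary_op_inner[OF S w that] Sw by simp
  have "hinner H z (mat_op H \<beta> a S ?y i) = (\<Sum>j<\<beta> i. a i j * hinner H w (?y j))"
    using inner_mat_op[OF a S y z order_refl] by (simp add: SS y)
  also have "\<dots> = (\<Sum>j<\<beta> i. a i j * (\<Sum>k<N. b j k * hinner H z (S (T (x k)))))"
  proof (rule sum.cong[OF refl])
    fix j assume "j \<in> {..<\<beta> i}"
    then have "\<beta> j \<le> N" using N member_le_sum[of j "{..<\<beta> i}" \<beta>] by auto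
    then show "a i j * hinner H w (?y j) = a i j * (\<Sum>k<N. b j k * hinner H z (S (T (x k))))"
      using inner_mat_op[OF b T x w] unitary_op_closed[OF T x] by (simp add: SS)
  qed
  also have "\<dots> = (\<Sum>k<N. (\<Sum>j<\<beta> i. a i j * b j k) * hinner H z (S (T (x k))))"
    by (simp add: sum_distrib_left sum_distrib_right mult.assoc) (rule sum.swap)
  finally show ?thesis .
qed

lemma mat_op_inverse:
  assumes a: "unitary_matrix I \<beta> a" and T: "unitary_op H T" and x: "x \<in> carrier (ell2 I H)"
    and S: "unitary_op H S" and ST: "\<And>x. x \<in> carrier H \<Longrightarrow> S (T x) = x"
  shows "mat_op H \<beta> (adj_matrix a) S (mat_op H \<beta> a T x) = x"
proof (rule ext, rule inner_eqI)
  fix i z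
  note xH = ell2_D(1)[OF x]
  show "mat_op H \<beta> (adj_matrix a) S (mat_op H \<beta> a T x) i \<in> carrier H"
    using mat_op_closed[OF unitary_matrix_adj[OF a] S mat_op_closed[OF a T xH]] .
  assume z: "z \<in> carrier H"
  \<comment> \<open>The summand \<open>Suc i\<close> guarantees that the index \<open>i\<close>
    itself is in the range, where the Kronecker delta picks it.\<close>
  let ?N = "Suc i + (\<Sum>j<\<beta> i. \<beta> j)"
  have aa: "(\<Sum>j<\<beta> i. adj_matrix a i j * a j k) = of_bool (i = k \<and> i \<in> I)" for k
  proof -
    have "(\<Sum>j<\<beta> i. adj_matrix a i j * a j k) = cnj (\<Sum>j<\<beta> i. cnj (a j k) * a j i)"
      by (simp add: adj_matrix_def mult.commute)
    then show ?thesis by (subst (asm) unitary_matrixD(5)[OF a]) auto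
  qed
  have "hinner H z (mat_op H \<beta> (adj_matrix a) S (mat_op H \<beta> a T x) i)
      = (\<Sum>k<?N. of_bool (i = k \<and> i \<in> I) * hinner H z (x k))"
    using inner_mat_op_comp[OF unitary_matrix_adj[OF a] a S T xH z, of i ?N] by (simp add: aa ST xH)
  also have "\<dots> = (\<Sum>k<?N. if k = i then hinner H z (x i) else 0)"
    using ell2_D(2)[OF x] z by (intro sum.cong) auto
  also have "\<dots> = hinner H z (x i)" by (subst sum.delta) auto
  finally show "hinner H z (mat_op H \<beta> (adj_matrix a) S (mat_op H \<beta> a T x) i) = hinner H z (x i)" .
qed (use ell2_D(1)[OF x] in simp)

lemma unitary_mat_op:
  assumes a: "unitary_matrix I \<beta> a" and T: "unitary_op H T"
  shows "unitary_op (ell2 I H) (mat_op H \<beta> a T)"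
proof -
  interpret E: hilbert_space "ell2 I H" by (rule hilbert_space_ell2)
  define S where "S = adj H H T"
  have S: "unitary_op H S" unfolding S_def using T by (rule unitary_op_adj_unitary)
  have ST: "S (T x) = x" "T (S x) = x" if "x \<in> carrier H" for x
    using unitary_op_adj[OF T that] by (simp_all add: S_def)
  let ?B = "mat_op H \<beta> a T" and ?B' = "mat_op H \<beta> (adj_matrix a) S"
  note a' = unitary_matrix_adj[OF a]
  note Tc = unitary_op_closed[OF T]
  have add: "?B (x \<oplus>\<^bsub>ell2 I H\<^esub> y) = ?B x \<oplus>\<^bsub>ell2 I H\<^esub> ?B y"
    if x: "x \<in> carrier (ell2 I H)" and y: "y \<in> carrier (ell2 I H)" for x y
  proof -
    note xH = ell2_D(1)[OF x] and yH = ell2_D(1)[OF y]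
    have xy: "\<And>i. x i \<oplus> y i \<in> carrier H" using xH yH by simp
    have "?B (\<lambda>i. x i \<oplus> y i) i = ?B x i \<oplus> ?B y i" for i
    proof (rule inner_eqI)
      fix z assume z: "z \<in> carrier H"
      show "hinner H z (?B (\<lambda>i. x i \<oplus> y i) i) = hinner H z (?B x i \<oplus> ?B y i)"
        using z xH yH xy mat_op_closed[OF a T xH] mat_op_closed[OF a T yH]
        by (simp add: inner_mat_op[OF a T _ _ order_refl] inner_add_right unitary_op_add[OF T] Tc
            sum.distrib distrib_left)
    qed (use mat_op_closed[OF a T] xH yH xy in simp_all)
    then show ?thesis by (simp add: fun_eq_iff)
  qed
  have smult: "?B (c \<odot>\<^bsub>ell2 I H\<^esub> x) = c \<odot>\<^bsub>ell2 I H\<^esub> ?B x" if x: "x \<in> carrier (ell2 I H)" for x c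
  proof -
    note xH = ell2_D(1)[OF x]
    have cx: "\<And>i. c \<odot> x i \<in> carrier H" using xH by simp
    have "?B (\<lambda>i. c \<odot> x i) i = c \<odot> ?B x i" for i
    proof (rule inner_eqI)
      fix z assume z: "z \<in> carrier H"
      show "hinner H z (?B (\<lambda>i. c \<odot> x i) i) = hinner H z (c \<odot> ?B x i)"
        using z xH cx mat_op_closed[OF a T xH]
        by (simp add: inner_mat_op[OF a T _ _ order_refl] inner_smult_right unitary_op_smult[OF T] Tc
            sum_distrib_left mult.left_commute)
    qed (use mat_op_closed[OF a T] xH cx in simp_all)
    then show ?thesis by (simp add: fun_eq_iff)
  qed
  \<comment> \<open>Both the operator and its inverse are contractions, hence both are
    isometric.\<close>
  have norm: "hnorm (ell2 I H) (?B x) = hnorm (ell2 I H) x" if x: "x \<in> carrier (ell2 I H)" for x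
    using mat_op_ell2[OF a T x] mat_op_ell2(2)[OF a' S, of "?B x"] mat_op_inverse[OF a T x S ST(1)]
    by simp
  show ?thesis
  proof (rule E.unitary_opI[where S = ?B'])
    fix x assume x: "x \<in> carrier (ell2 I H)"
    show "?B x \<in> carrier (ell2 I H)" using mat_op_ell2(1)[OF a T x] .
    show "?B' x \<in> carrier (ell2 I H)" using mat_op_ell2(1)[OF a' S x] .
    have "adj_matrix (adj_matrix a) = a" by (simp add: adj_matrix_def fun_eq_iff)
    then show "?B (?B' x) = x" using mat_op_inverse[OF a' S x T ST(2)] by simp
  next
    fix x y assume "x \<in> carrier (ell2 I H)" "y \<in> carrier (ell2 I H)"
    then show "hinner (ell2 I H) (?B x) (?B y) = hinner (ell2 I H) x y"
      by (intro E.inner_preserving[OF hilbert_space_ell2] add smult norm mat_op_ell2(1)[OF a T])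
  qed (use add smult in auto)
qed

text \<open>Here the parameter changes: the phase of the matrices and the phase of the operators
  multiply.\<close>

lemma mat_op_commute:
  assumes a: "unitary_matrix I \<beta> a" and b: "unitary_matrix I \<beta> b"
    and U: "unitary_op H U" and V: "unitary_op H V"
    and ba: "\<And>i k. (\<Sum>j<\<beta> i. b i j * a j k) = \<omega> * (\<Sum>j<\<beta> i. a i j * b j k)"
    and UV: "q_commuting q H U V" and x: "x \<in> carrier (ell2 I H)"
  shows "mat_op H \<beta> b V (mat_op H \<beta> a U x) = (\<omega> * q) \<odot>\<^bsub>ell2 I H\<^esub> mat_op H \<beta> a U (mat_op H \<beta> b V x)"
proof -
  note xH = ell2_D(1)[OF x]
  have cl: "mat_op H \<beta> b V (mat_op H \<beta> a U x) i \<in> carrier H"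
    "mat_op H \<beta> a U (mat_op H \<beta> b V x) i \<in> carrier H" for i
    by (rule mat_op_closed[OF b V mat_op_closed[OF a U xH]])
      (rule mat_op_closed[OF a U mat_op_closed[OF b V xH]])
  note Uc = unitary_op_closed[OF U] and Vc = unitary_op_closed[OF V]
  have "mat_op H \<beta> b V (mat_op H \<beta> a U x) i = (\<omega> * q) \<odot> mat_op H \<beta> a U (mat_op H \<beta> b V x) i" for i
  proof (rule inner_eqI)
    fix z assume z: "z \<in> carrier H"
    have "V (U (x k)) = q \<odot> U (V (x k))" for k using UV xH by (simp add: q_commuting_def)
    then have "hinner H z (mat_op H \<beta> b V (mat_op H \<beta> a U x) i)
        = (\<Sum>k<(\<Sum>j<\<beta> i. \<beta> j). (\<omega> * (\<Sum>j<\<beta> i. a i j * b j k)) * (q * hinner H z (U (V (x k)))))"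
      using z xH Uc Vc
      by (simp only: inner_mat_op_comp[OF b a V U xH z order_refl] ba) (simp add: inner_smult_right)
    also have "\<dots> = (\<omega> * q) * hinner H z (mat_op H \<beta> a U (mat_op H \<beta> b V x) i)"
      unfolding inner_mat_op_comp[OF a b U V xH z order_refl] sum_distrib_left[of "\<omega> * q"]
      by (intro sum.cong refl) (simp add: mult_ac)
    finally show "hinner H z (mat_op H \<beta> b V (mat_op H \<beta> a U x) i)
        = hinner H z ((\<omega> * q) \<odot> mat_op H \<beta> a U (mat_op H \<beta> b V x) i)"
      using z cl by (simp add: inner_smult_right)
  qed (use cl in simp_all)
  then show ?thesis by (simp add: fun_eq_iff)
qed

end

context hilbert_space
begin

lemma bounded_scaled_unitary:
  assumes T: "unitary_op H T"
  shows "bounded_op H H (\<lambda>x. c \<odot> T x)"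
proof -
  have "hnorm H (c \<odot> T x) \<le> cmod c * hnorm H x" if "x \<in> carrier H" for x
    using unitary_op_inner[OF T that that] unitary_op_closed[OF T that]
    by (simp add: hnorm_smult) (simp add: hnorm_def)
  then show ?thesis
    using unitary_op_closed[OF T] unitary_op_add[OF T] unitary_op_smult[OF T]
    unfolding bounded_op_def by (auto simp: smult_distrib(1) smult_distrib(3)[symmetric] mult.commute)
qed

lemma op_norm_scaled_unitary:
  assumes T: "unitary_op H T" and c: "0 \<le> c" and nontrivial: "carrier H \<noteq> {\<zero>}"
  shows "op_norm H H (\<lambda>x. of_real c \<odot> T x) = c"
proof -
  have norm: "hnorm H (of_real c \<odot> T x) = c * hnorm H x" if "x \<in> carrier H" for x
    using unitary_op_inner[OF T that that] unitary_op_closed[OF T that] c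
    by (simp add: hnorm_smult) (simp add: hnorm_def)
  obtain y where y: "y \<in> carrier H" "y \<noteq> \<zero>" using nontrivial zero_closed by blast
  then have ny: "hnorm H y \<noteq> 0" by (simp add: hnorm_eq_0_iff)
  define x where "x = of_real (1 / hnorm H y) \<odot> y"
  have x: "x \<in> carrier H" "hnorm H x = 1"
    using y ny by (simp_all add: x_def hnorm_smult norm_divide)
  show ?thesis
    unfolding op_norm_def
  proof (rule cSup_eq_maximum)
    show "c \<in> (\<lambda>x. hnorm H (of_real c \<odot> T x)) ` {x \<in> carrier H. hnorm H x \<le> 1}"
      using x norm[OF x(1)] by (intro image_eqI[of _ _ x]) auto
  next
    fix r assume "r \<in> (\<lambda>x. hnorm H (of_real c \<odot> T x)) ` {x \<in> carrier H. hnorm H x \<le> 1}"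
    then show "r \<le> c" using norm c by (auto simp: mult_left_le)
  qed
qed

lemma ell2_nontrivial:
  assumes "i\<^sub>0 \<in> I" "carrier H \<noteq> {\<zero>}"
  shows "carrier (ell2 I H) \<noteq> {\<zero>\<^bsub>ell2 I H\<^esub>}"
proof -
  obtain y where y: "y \<in> carrier H" "y \<noteq> \<zero>" using assms zero_closed by blast
  have "(\<lambda>i. if i = i\<^sub>0 then y else \<zero>) \<in> carrier (ell2 I H)"
    by (rule ell2_finite_support[of _ _ "Suc i\<^sub>0"]) (use y assms in auto)
  moreover have "(\<lambda>i. if i = i\<^sub>0 then y else \<zero>) \<noteq> \<zero>\<^bsub>ell2 I H\<^esub>"
    using y by (auto dest: fun_cong[of _ _ i\<^sub>0])
  ultimately show ?thesis by blast
qed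

text \<open>Collects all that concerns the dilating pair by itself; its compression is treated in
  \<open>is_dilation_mat_ops\<close>.\<close>

lemma commuting_scaled_mat_ops:
  fixes c :: real
  assumes a: "unitary_matrix I \<beta> a" and b: "unitary_matrix I \<beta> b"
    and U: "unitary_op H U" and V: "unitary_op H V"
    and ba: "\<And>i k. (\<Sum>j<\<beta> i. b i j * a j k) = \<omega> * (\<Sum>j<\<beta> i. a i j * b j k)"
    and UV: "q_commuting q H U V" and nontrivial: "i\<^sub>0 \<in> I" "carrier H \<noteq> {\<zero>}" and c: "0 \<le> c"
    and K: "K = ell2 I H" and B: "B\<^sub>1 = (\<lambda>x. of_real c \<odot>\<^bsub>K\<^esub> mat_op H \<beta> a U x)"
      "B\<^sub>2 = (\<lambda>x. of_real c \<odot>\<^bsub>K\<^esub> mat_op H \<beta> b V x)"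
  shows "hilbert_space K" "bounded_op K K B\<^sub>1" "bounded_op K K B\<^sub>2" "q_commuting (\<omega> * q) K B\<^sub>1 B\<^sub>2"
    "scalar_multiple_of_unitary K B\<^sub>1" "scalar_multiple_of_unitary K B\<^sub>2"
    "op_norm K K B\<^sub>1 = c" "op_norm K K B\<^sub>2 = c"
proof -
  interpret K: hilbert_space K unfolding K by (rule hilbert_space_ell2)
  note ua = unitary_mat_op[OF a U, folded K] and ub = unitary_mat_op[OF b V, folded K]
  note nt = ell2_nontrivial[OF nontrivial, folded K]
  show "hilbert_space K" by (rule K.hilbert_space_axioms)
  show "bounded_op K K B\<^sub>1" "bounded_op K K B\<^sub>2"
    unfolding B by (rule K.bounded_scaled_unitary[OF ua] K.bounded_scaled_unitary[OF ub])+
  show "scalar_multiple_of_unitary K B\<^sub>1" "scalar_multiple_of_unitary K B\<^sub>2"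
    unfolding scalar_multiple_of_unitary_def B using ua ub by blast+
  show "op_norm K K B\<^sub>1 = c" "op_norm K K B\<^sub>2 = c"
    unfolding B by (rule K.op_norm_scaled_unitary[OF ua c nt] K.op_norm_scaled_unitary[OF ub c nt])+
  show "q_commuting (\<omega> * q) K B\<^sub>1 B\<^sub>2"
    unfolding q_commuting_def
  proof
    fix x assume x: "x \<in> carrier K"
    let ?A = "mat_op H \<beta> a U" and ?B = "mat_op H \<beta> b V"
    have Ax: "?A x \<in> carrier K" and Bx: "?B x \<in> carrier K"
      using K.unitary_op_closed ua ub x by auto
    then have AB: "?A (?B x) \<in> carrier K" "?B (?A x) \<in> carrier K"
      using K.unitary_op_closed ua ub by auto
    have "?B (?A x) = (\<omega> * q) \<odot>\<^bsub>K\<^esub> ?A (?B x)"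
      using mat_op_commute[OF a b U V ba UV] x by (simp only: K)
    then show "B\<^sub>2 (B\<^sub>1 x) = (\<omega> * q) \<odot>\<^bsub>K\<^esub> B\<^sub>1 (B\<^sub>2 x)"
      unfolding B K.unitary_op_smult[OF ua Bx] K.unitary_op_smult[OF ub Ax]
      using AB by (simp add: K.smult_distrib(3)[symmetric] mult_ac)
  qed
qed

end

section \<open>Change of the underlying type, and compressions\<close>

text \<open>The dilation space must consist of sequences in \<open>'a \<times> complex\<close>. A
  space is moved there along an injection \<open>e\<close> with left inverse \<open>d\<close>: the
  given space with second component 0, or, when it is trivial, the complex numbers with first
  component zero.\<close>

definition transport :: "('a \<Rightarrow> 'b) \<Rightarrow> ('b \<Rightarrow> 'a) \<Rightarrow> 'a hspace \<Rightarrow> 'b hspace"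
  where "transport e d H =
    \<lparr>carrier = e ` carrier H, mult = (\<lambda>x y. x), one = e \<zero>\<^bsub>H\<^esub>, zero = e \<zero>\<^bsub>H\<^esub>,
     add = (\<lambda>x y. e (d x \<oplus>\<^bsub>H\<^esub> d y)), smult = (\<lambda>a x. e (a \<odot>\<^bsub>H\<^esub> d x)),
     hinner = (\<lambda>x y. hinner H (d x) (d y))\<rparr>"

lemma transport_simps [simp]:
  "carrier (transport e d H) = e ` carrier H" "zero (transport e d H) = e \<zero>\<^bsub>H\<^esub>"
  "add (transport e d H) x y = e (d x \<oplus>\<^bsub>H\<^esub> d y)" "smult (transport e d H) a x = e (a \<odot>\<^bsub>H\<^esub> d x)"
  "hinner (transport e d H) x y = hinner H (d x) (d y)"
  by (simp_all add: transport_def)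

context hilbert_space
begin

context
  fixes e :: "'a \<Rightarrow> 'b" and d :: "'b \<Rightarrow> 'a"
  assumes de [simp]: "\<And>x. d (e x) = x"
begin

lemma hilbert_space_transport: "hilbert_space (transport e d H)"
proof -
  let ?G = "transport e d H"
  have mod: "module complex_ring ?G"
  proof (rule moduleI)
    show "abelian_group ?G"
    proof (rule abelian_groupI)
      fix x assume "x \<in> carrier ?G"
      then obtain y where y: "y \<in> carrier H" "x = e y" by auto
      then show "\<exists>y\<in>carrier ?G. y \<oplus>\<^bsub>?G\<^esub> x = \<zero>\<^bsub>?G\<^esub>"
        by (intro bexI[of _ "e (\<ominus> y)"]) (auto simp: l_neg)
    qed (auto simp: a_assoc a_comm a_lcomm)
  qed (auto simp: cring_complex_ring smult_distrib)
  interpret G: module complex_ring ?G by (rule mod)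
  have minus: "d (e x \<ominus>\<^bsub>?G\<^esub> e y) = x \<ominus> y" if "x \<in> carrier H" "y \<in> carrier H" for x y
  proof -
    have "\<ominus>\<^bsub>?G\<^esub> e y = (-1) \<odot>\<^bsub>?G\<^esub> e y"
      using G.smult_l_minus[of 1 "e y"] G.smult_one[of "e y"] that by simp
    then show ?thesis using that by (simp add: a_minus_def uminus_eq_smult)
  qed
  have inj [simp]: "e x = e y \<longleftrightarrow> x = y" for x y by (metis de)
  show ?thesis
  proof (intro hilbert_space.intro mod hilbert_space_axioms.intro)
    fix X :: "nat \<Rightarrow> 'b"
    assume X: "\<And>k. X k \<in> carrier ?G"
      and cauchy: "\<forall>r>0. \<exists>N. \<forall>k\<ge>N. \<forall>l\<ge>N. hnorm ?G (X k \<ominus>\<^bsub>?G\<^esub> X l) < r"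
    define Y where "Y k = d (X k)" for k
    have Y: "Y k \<in> carrier H" "X k = e (Y k)" for k using X[of k] by (auto simp: Y_def)
    have n: "hnorm ?G (e x \<ominus>\<^bsub>?G\<^esub> e y) = hnorm H (x \<ominus> y)" if "x \<in> carrier H" "y \<in> carrier H" for x y
      using minus[OF that] by (simp add: hnorm_def)
    have "\<exists>x\<in>carrier H. (\<lambda>k. hnorm H (Y k \<ominus> x)) \<longlonglongrightarrow> 0"
      by (rule complete[OF Y(1)]) (use cauchy in \<open>simp add: Y n\<close>)
    then show "\<exists>x\<in>carrier ?G. (\<lambda>k. hnorm ?G (X k \<ominus>\<^bsub>?G\<^esub> x)) \<longlonglongrightarrow> 0"
      by (auto simp: Y n)
  qed (auto simp: inner_add_right inner_smult_right inner_nonneg intro: inner_cnj inner_definite)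
qed

lemma unitary_op_transport:
  assumes T: "unitary_op H T"
  shows "unitary_op (transport e d H) (\<lambda>x. e (T (d x)))"
proof (rule hilbert_space.unitary_opI[OF hilbert_space_transport, where S = "\<lambda>x. e (adj H H T (d x))"])
qed (auto simp: unitary_op_closed[OF T] unitary_op_add[OF T] unitary_op_smult[OF T]
    unitary_op_inner[OF T] unitary_op_adj[OF T])

lemma q_commuting_transport:
  assumes "q_commuting q H U V"
  shows "q_commuting q (transport e d H) (\<lambda>x. e (U (d x))) (\<lambda>x. e (V (d x)))"
  using assms by (simp add: q_commuting_def)

text \<open>With W x = \<xi> \<otimes> x one has \<langle>W w, (m \<otimes> T) W x\<rangle> =
  \<langle>\<xi>, m \<xi>\<rangle> \<langle>w, T x\<rangle>. So the compression multiplies each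
  operator by the common expectation \<open>\<kappa>\<close>, which the factor \<open>c\<close>
  cancels. Finite support of \<open>\<xi>\<close> keeps all sums finite.\<close>

lemma is_dilation_mat_ops:
  fixes c :: real and \<kappa> :: complex
  assumes a: "unitary_matrix I \<beta> a" and b: "unitary_matrix I \<beta> b"
    and U: "unitary_op H U" and V: "unitary_op H V"
    and \<xi>: "\<And>i. i \<notin> I \<Longrightarrow> \<xi> i = 0" "\<And>i. i \<ge> N \<Longrightarrow> \<xi> i = 0" "(\<Sum>i<N. cnj (\<xi> i) * \<xi> i) = 1"
      "(\<Sum>i<N. \<Sum>j<N. cnj (\<xi> i) * a i j * \<xi> j) = \<kappa>" "(\<Sum>i<N. \<Sum>j<N. cnj (\<xi> i) * b i j * \<xi> j) = \<kappa>"
    and c: "of_real c * \<kappa> = 1"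
    and G: "G = transport e d H" and K: "K = ell2 I G"
    and B: "B\<^sub>1 = (\<lambda>x. of_real c \<odot>\<^bsub>K\<^esub> mat_op G \<beta> a (\<lambda>x. e (U (d x))) x)"
      "B\<^sub>2 = (\<lambda>x. of_real c \<odot>\<^bsub>K\<^esub> mat_op G \<beta> b (\<lambda>x. e (V (d x))) x)"
    and bounded: "bounded_op K K B\<^sub>1" "bounded_op K K B\<^sub>2"
  shows "is_dilation H U V K B\<^sub>1 B\<^sub>2"
proof -
  interpret G: hilbert_space G unfolding G by (rule hilbert_space_transport)
  interpret K: hilbert_space K unfolding K by (rule G.hilbert_space_ell2)
  define W where "W x = (\<lambda>i. e (\<xi> i \<odot> x))" for x
  have WG: "W x i \<in> carrier G" if "x \<in> carrier H" for x i using that by (simp add: W_def G)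
  have W: "W x \<in> carrier K" if "x \<in> carrier H" for x
    unfolding K by (rule G.ell2_finite_support[of _ _ N]) (use that \<xi> in \<open>auto simp: W_def G\<close>)
  have innerW: "hinner K (W x) y = (\<Sum>i<N. cnj (\<xi> i) * hinner G (e x) (y i))"
    if x: "x \<in> carrier H" and y: "y \<in> carrier K" for x y
  proof -
    have yi: "y i \<in> e ` carrier H" for i using G.ell2_D(1)[of y I i] y by (simp add: K G)
    have eq: "hinner G (W x i) (y i) = cnj (\<xi> i) * hinner G (e x) (y i)" for i
      using yi[of i] x by (auto simp: G W_def inner_smult_left)
    have "hinner K (W x) y = (\<Sum>i<N. hinner G (W x i) (y i))"
      unfolding K ell2_simps by (rule suminf_finite) (auto simp: eq \<xi>(2))
    then show ?thesis by (simp add: eq)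
  qed
  have WW: "hinner K (W x) (W y) = hinner H x y" if "x \<in> carrier H" "y \<in> carrier H" for x y
  proof -
    have "hinner K (W x) (W y) = (\<Sum>i<N. cnj (\<xi> i) * (\<xi> i * hinner H x y))"
      using that by (simp add: innerW W) (simp add: W_def G inner_smult_right)
    also have "\<dots> = (\<Sum>i<N. cnj (\<xi> i) * \<xi> i) * hinner H x y"
      by (simp add: sum_distrib_right mult.assoc)
    finally show ?thesis by (simp add: \<xi>(3))
  qed
  have compress: "adj H K W (of_real c \<odot>\<^bsub>K\<^esub> mat_op G \<beta> m (\<lambda>x. e (T (d x))) (W x)) = T x"
    if x: "x \<in> carrier H" and T: "unitary_op H T" and m: "unitary_matrix I \<beta> m"
      and \<kappa>: "(\<Sum>i<N. \<Sum>j<N. cnj (\<xi> i) * m i j * \<xi> j) = \<kappa>" for x T m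
  proof (rule adj_eqI)
    show Tx: "T x \<in> carrier H" using unitary_op_closed[OF T x] .
    fix w assume w: "w \<in> carrier H"
    let ?T = "\<lambda>x. e (T (d x))"
    have T': "unitary_op G ?T" unfolding G by (rule unitary_op_transport[OF T])
    note M = G.unitary_mat_op[OF m T', folded K]
    have ew: "e w \<in> carrier G" using w by (simp add: G)
    have MW: "hinner G (e w) (mat_op G \<beta> m ?T (W x) i) = (\<Sum>j<N. m i j * \<xi> j) * hinner H w (T x)" for i
    proof -
      \<comment> \<open>The range \<open>\<beta> i + N\<close> contains both row \<open>i\<close> of
        the matrix and the support of \<open>\<xi>\<close>.\<close>
      have "hinner G (e w) (mat_op G \<beta> m ?T (W x) i)
          = (\<Sum>j<\<beta> i + N. m i j * hinner G (e w) (?T (W x j)))"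
        by (rule G.inner_mat_op[OF m T' WG[OF x] ew]) simp
      also have "\<dots> = (\<Sum>j<\<beta> i + N. m i j * \<xi> j * hinner H w (T x))"
        using w x Tx by (simp add: W_def G unitary_op_smult[OF T] inner_smult_right mult.assoc)
      also have "\<dots> = (\<Sum>j<N. m i j * \<xi> j * hinner H w (T x))"
        by (rule sum.mono_neutral_right) (auto simp: \<xi>(2))
      finally show ?thesis by (simp add: sum_distrib_right)
    qed
    have "hinner K (W w) (of_real c \<odot>\<^bsub>K\<^esub> mat_op G \<beta> m ?T (W x))
        = of_real c * (\<Sum>i<N. cnj (\<xi> i) * hinner G (e w) (mat_op G \<beta> m ?T (W x) i))"
      using K.unitary_op_closed[OF M] W w x by (simp only: K.inner_smult_right innerW)
    also have "\<dots> = of_real c * ((\<Sum>i<N. \<Sum>j<N. cnj (\<xi> i) * m i j * \<xi> j) * hinner H w (T x))"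
      by (simp add: MW sum_distrib_left sum_distrib_right mult.assoc)
    also have "\<dots> = hinner H w (T x)"
      using c by (simp add: \<kappa> mult.assoc[symmetric])
    finally show "hinner K (W w) (of_real c \<odot>\<^bsub>K\<^esub> mat_op G \<beta> m ?T (W x)) = hinner H w (T x)" .
  qed
  have norm: "hnorm K (W x) = hnorm H x" if "x \<in> carrier H" for x
    using WW[OF that that] by (simp add: hnorm_def)
  have iso: "isometric_op H K W"
  proof -
    have "hnorm K (W x) \<le> 1 * hnorm H x" if "x \<in> carrier H" for x using norm[OF that] by simp
    moreover have "W (x \<oplus> y) = W x \<oplus>\<^bsub>K\<^esub> W y" if "x \<in> carrier H" "y \<in> carrier H" for x y
      using that by (simp add: W_def K G smult_distrib)
    moreover have "W (r \<odot> x) = r \<odot>\<^bsub>K\<^esub> W x" if "x \<in> carrier H" for x r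
      using that by (simp add: W_def K G smult_distrib(3)[symmetric] mult.commute)
    ultimately show ?thesis using W norm unfolding isometric_op_def bounded_op_def by blast
  qed
  show ?thesis
    unfolding is_dilation_def
  proof (intro conjI bounded exI[of _ W] iso ballI)
    fix x assume x: "x \<in> carrier H"
    show "U x = adj H K W (B\<^sub>1 (W x))"
      unfolding B by (rule compress[OF x U a \<xi>(4), symmetric])
    show "V x = adj H K W (B\<^sub>2 (W x))"
      unfolding B by (rule compress[OF x V b \<xi>(5), symmetric])
  qed
qed

end

end

section \<open>Finite-dimensional spaces and the tensor product\<close>

definition complex_hspace :: "complex hspace"
  where "complex_hspace =
    \<lparr>carrier = UNIV, mult = (*), one = 1, zero = 0, add = (+), smult = (*), hinner = (\<lambda>x y. cnj x * y)\<rparr>"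

lemma complex_hspace_simps [simp]:
  "carrier complex_hspace = UNIV" "zero complex_hspace = 0" "add complex_hspace = (+)"
  "smult complex_hspace = (*)" "hinner complex_hspace x y = cnj x * y"
  by (simp_all add: complex_hspace_def)

lemma hilbert_space_complex: "hilbert_space complex_hspace"
proof -
  have mod: "module complex_ring complex_hspace"
  proof (rule moduleI)
    show "abelian_group complex_hspace"
    proof (rule abelian_groupI)
      fix x :: complex
      have "- x + x = 0" by simp
      then show "\<exists>y\<in>carrier complex_hspace. y \<oplus>\<^bsub>complex_hspace\<^esub> x = \<zero>\<^bsub>complex_hspace\<^esub>"
        unfolding complex_hspace_simps by blast
    qed simp_all
  qed (auto simp: cring_complex_ring algebra_simps)
  interpret module complex_ring complex_hspace by (rule mod)
  have minus: "x \<ominus>\<^bsub>complex_hspace\<^esub> y = x - y" for x y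
    using smult_l_minus[of 1 y] by (simp add: a_minus_def)
  have norm: "hnorm complex_hspace x = cmod x" for x
    by (simp add: hnorm_def cmod_def power2_eq_square)
  show ?thesis
  proof (intro hilbert_space.intro mod hilbert_space_axioms.intro)
    fix X :: "nat \<Rightarrow> complex"
    assume "\<forall>e>0. \<exists>N. \<forall>k\<ge>N. \<forall>l\<ge>N. hnorm complex_hspace (X k \<ominus>\<^bsub>complex_hspace\<^esub> X l) < e"
    then have "Cauchy X" by (simp add: Cauchy_def norm minus dist_norm)
    then obtain x where "X \<longlonglongrightarrow> x" using Cauchy_convergent convergentD by blast
    then have "(\<lambda>k. cmod (X k - x)) \<longlonglongrightarrow> 0"
      using LIM_zero tendsto_norm_zero by blast
    then show "\<exists>x\<in>carrier complex_hspace. (\<lambda>k. hnorm complex_hspace (X k \<ominus>\<^bsub>complex_hspace\<^esub> x)) \<longlonglongrightarrow> 0"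
      by (auto simp: norm minus)
  qed (auto simp: algebra_simps complex_eq_iff sum_power2_eq_zero_iff power2_eq_square[symmetric])
qed

text \<open>With finitely many coordinates a vector is the sum of its coordinate vectors, so the
  algebraic span is already everything and totality requires no approximation.\<close>

lemma (in hilbert_space) hspan_ell2:
  assumes S: "\<And>k y. k < n \<Longrightarrow> y \<in> carrier H
    \<Longrightarrow> (\<lambda>i. if i = k then y else \<zero>) \<in> hspan (ell2 {..<n} H) S"
    and x: "x \<in> carrier (ell2 {..<n} H)"
  shows "x \<in> hspan (ell2 {..<n} H) S"
proof -
  note xH = ell2_D(1)[OF x]
  have "m \<le> n \<Longrightarrow> (\<lambda>i. if i < m then x i else \<zero>) \<in> hspan (ell2 {..<n} H) S" for m
  proof (induction m)
    case 0
    then show ?case using hspan.zero[of "ell2 {..<n} H" S] by simp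
  next
    case (Suc m)
    then have "(\<lambda>i. if i < m then x i else \<zero>) \<oplus>\<^bsub>ell2 {..<n} H\<^esub> (\<lambda>i. if i = m then x m else \<zero>)
        \<in> hspan (ell2 {..<n} H) S"
      using xH by (intro hspan.add S) auto
    also have "(\<lambda>i. if i < m then x i else \<zero>) \<oplus>\<^bsub>ell2 {..<n} H\<^esub> (\<lambda>i. if i = m then x m else \<zero>)
        = (\<lambda>i. if i < Suc m then x i else \<zero>)"
      using xH by (auto simp: fun_eq_iff less_Suc_eq)
    finally show ?case .
  qed
  moreover have "(\<lambda>i. if i < n then x i else \<zero>) = x"
    using ell2_D(2)[OF x] by (auto simp: fun_eq_iff)
  ultimately show ?thesis by (metis order_refl)
qed

lemma (in hilbert_space) total_inI:
  assumes "S \<subseteq> carrier H" "carrier H \<subseteq> hspan H S"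
  shows "total_in H S"
proof -
  have "hnorm H (x \<ominus> x) < e" if "x \<in> carrier H" "0 < e" for x e
    using that by (simp add: minus_eq r_neg hnorm_eq_0_iff[THEN iffD2])
  then show ?thesis unfolding total_in_def using assms by blast
qed

lemma has_dim_ell2: "has_dim (ell2 {..<n} complex_hspace) n"
proof -
  interpret C: hilbert_space complex_hspace by (rule hilbert_space_complex)
  interpret L: hilbert_space "ell2 {..<n} complex_hspace" by (rule C.hilbert_space_ell2)
  define \<delta> :: "nat \<Rightarrow> nat \<Rightarrow> complex" where "\<delta> k = (\<lambda>i. if i = k then 1 else 0)" for k
  let ?S = "\<delta> ` {..<n}"
  have sub: "?S \<subseteq> carrier (ell2 {..<n} complex_hspace)"
    by (auto simp: \<delta>_def intro!: C.ell2_finite_support[of _ _ n] split: if_splits)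
  have "carrier (ell2 {..<n} complex_hspace) \<subseteq> hspan (ell2 {..<n} complex_hspace) ?S"
  proof (rule subsetI, rule C.hspan_ell2)
    fix k y assume "k < n"
    then have "y \<odot>\<^bsub>ell2 {..<n} complex_hspace\<^esub> \<delta> k \<in> hspan (ell2 {..<n} complex_hspace) ?S"
      by (intro hspan.smult hspan.base) auto
    also have "y \<odot>\<^bsub>ell2 {..<n} complex_hspace\<^esub> \<delta> k = (\<lambda>i. if i = k then y else \<zero>\<^bsub>complex_hspace\<^esub>)"
      by (auto simp: \<delta>_def)
    finally show "(\<lambda>i. if i = k then y else \<zero>\<^bsub>complex_hspace\<^esub>) \<in> hspan (ell2 {..<n} complex_hspace) ?S" .
  qed
  then have total: "total_in (ell2 {..<n} complex_hspace) ?S" by (rule L.total_inI[OF sub])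
  have inner: "hinner (ell2 {..<n} complex_hspace) (\<delta> k) (\<delta> l) = of_bool (k = l)" for k l
  proof -
    have "hinner (ell2 {..<n} complex_hspace) (\<delta> k) (\<delta> l) = (\<Sum>i\<in>{k}. cnj (\<delta> k i) * \<delta> l i)"
      unfolding ell2_simps complex_hspace_simps by (rule suminf_finite) (auto simp: \<delta>_def)
    then show ?thesis by (simp add: \<delta>_def)
  qed
  have inj: "\<delta> k = \<delta> l \<longleftrightarrow> k = l" for k l
    by (metis \<delta>_def one_neq_zero)
  have "card ?S = n" by (simp add: card_image inj_on_def inj)
  moreover have "\<forall>x\<in>?S. \<forall>y\<in>?S. hinner (ell2 {..<n} complex_hspace) x y = (if x = y then 1 else 0)"
    using inner inj by (auto simp del: ell2_simps)
  ultimately show ?thesis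
    unfolding has_dim_def orthonormal_basis_def using total by (intro exI[of _ ?S]) auto
qed

lemma (in hilbert_space) tensor_product_ell2:
  assumes de: "\<And>x. d (e x) = x"
  shows "tensor_product H (ell2 {..<n} complex_hspace) (ell2 {..<n} (transport e d H)) (\<lambda>x y i. e (y i \<odot> x))"
proof -
  let ?G = "transport e d H" and ?L = "ell2 {..<n} complex_hspace" and ?K = "ell2 {..<n} (transport e d H)"
  let ?t = "\<lambda>x y i. e (y i \<odot> x)"
  interpret C: hilbert_space complex_hspace by (rule hilbert_space_complex)
  interpret G: hilbert_space ?G by (rule hilbert_space_transport[of d e, OF de])
  interpret K: hilbert_space ?K by (rule G.hilbert_space_ell2)
  have t: "?t x y \<in> carrier ?K" if "x \<in> carrier H" "y \<in> carrier ?L" for x y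
    by (rule G.ell2_finite_support[of _ _ n]) (use that C.ell2_D(2)[OF that(2)] in auto)
  let ?S = "{?t x y | x y. x \<in> carrier H \<and> y \<in> carrier ?L}"
  have "carrier ?K \<subseteq> hspan ?K ?S"
  proof (rule subsetI, rule G.hspan_ell2)
    fix k z assume k: "k < n" and "z \<in> carrier ?G"
    then obtain x where x: "x \<in> carrier H" "z = e x" by auto
    define y :: "nat \<Rightarrow> complex" where "y = (\<lambda>i. if i = k then 1 else 0)"
    have "y \<in> carrier ?L" by (rule C.ell2_finite_support[of _ _ n]) (use k in \<open>auto simp: y_def\<close>)
    then have "?t x y \<in> hspan ?K ?S" using x by (intro hspan.base) blast
    also have "?t x y = (\<lambda>i. if i = k then z else \<zero>\<^bsub>?G\<^esub>)"
      using x by (auto simp: y_def)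
    finally show "(\<lambda>i. if i = k then z else \<zero>\<^bsub>?G\<^esub>) \<in> hspan ?K ?S" .
  qed
  then have total: "total_in ?K ?S" using t by (intro K.total_inI) auto
  have inner: "hinner ?K (?t x y) (?t x' y') = hinner H x x' * hinner ?L y y'"
    if x: "x \<in> carrier H" "x' \<in> carrier H" and y: "y \<in> carrier ?L" "y' \<in> carrier ?L" for x x' y y'
  proof -
    have "hinner ?K (?t x y) (?t x' y') = suminf (\<lambda>i. hinner H x x' * (cnj (y i) * y' i))"
      using x by (simp add: de inner_smult_left inner_smult_right mult_ac)
    also have "\<dots> = hinner H x x' * hinner ?L y y'"
      using C.ell2_inner_summable[OF y] by (simp add: suminf_mult)
    finally show ?thesis .
  qed
  show ?thesis
    unfolding tensor_product_def
    by (intro conjI ballI allI total inner; simp add: de smult_distrib)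
      (simp_all add: smult_distrib(3)[symmetric] mult.commute)
qed

section \<open>Noncommutative polynomials and C*-seminorms\<close>

text \<open>Additive maps need no disjointness of supports in the induction step. Multiplicative
  identities are thereby reduced to single words.\<close>

lemma poly_mapping_induct_add [case_names single add]:
  assumes single: "\<And>k a. P (Poly_Mapping.single k a)"
    and add: "\<And>f g. P f \<Longrightarrow> P g \<Longrightarrow> P (f + g)"
  shows "P (f :: 'k \<Rightarrow>\<^sub>0 'c::comm_monoid_add)"
proof (induction f rule: Poly_Mapping.update_induct)
  case const
  show ?case using single[of undefined 0] by simp
next
  case (update f a b)
  have "Poly_Mapping.update a b f = f + Poly_Mapping.single a b"
    using update by (intro poly_mapping_eqI)
      (auto simp: lookup_update lookup_add lookup_single in_keys_iff when_def)
  then show ?case using add[OF update(3) single] by simp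
qed

lemma poly_smult_eq_mult: "poly_smult a f = Poly_Mapping.single 0 a * f"
  by (simp add: poly_smult_def mult_map_scale_conv_mult)

lemma single_zero_commute: "Poly_Mapping.single 0 a * f = f * Poly_Mapping.single (0::star_word) (a::complex)"
  by (induction f rule: poly_mapping_induct_add) (simp_all add: mult_single mult.commute algebra_simps)

lemma poly_smult_simps:
  "poly_smult a (f + g) = poly_smult a f + poly_smult a g"
  "poly_smult a (f - g) = poly_smult a f - poly_smult a g"
  "poly_smult a f * g = poly_smult a (f * g)"
  "f * poly_smult a g = poly_smult a (f * g)"
  "poly_smult a (poly_smult b f) = poly_smult (a * b) f"
  "poly_smult (a + b) f = poly_smult a f + poly_smult b f"
  "poly_smult 1 f = f" "poly_smult 0 f = 0" "poly_smult (-1) f = - f" "poly_smult a 0 = 0"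
  "poly_smult a (Poly_Mapping.single w b) = Poly_Mapping.single w (a * b)"
proof -
  have "Poly_Mapping.single 0 a * (f * g) = f * (Poly_Mapping.single 0 a * g)"
    using single_zero_commute[of a f] by (simp add: mult.assoc[symmetric])
  then show "f * poly_smult a g = poly_smult a (f * g)" by (simp add: poly_smult_eq_mult)
  have "Poly_Mapping.single 0 (-1) = (- 1 :: star_poly)"
    by (simp add: single_uminus)
  then show "poly_smult (-1) f = - f" by (simp add: poly_smult_eq_mult)
  have "Poly_Mapping.single 0 a * (Poly_Mapping.single 0 b * f) = Poly_Mapping.single 0 (a * b) * f"
    by (simp add: mult.assoc[symmetric] mult_single)
  then show "poly_smult a (poly_smult b f) = poly_smult (a * b) f" by (simp add: poly_smult_eq_mult)
qed (simp_all add: poly_smult_eq_mult distrib_left distrib_right right_diff_distrib single_add mult_single mult.assoc)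

lemma word_star_word_star [simp]: "word_star (word_star w) = w"
proof -
  have "star_letter (star_letter l) = l" for l by (cases l) simp_all
  then show ?thesis by (cases w) (simp add: word_star_def rev_map comp_def)
qed

lemma word_star_add: "word_star (v + w) = word_star w + word_star v"
  by (simp add: word_star_def plus_star_word_def)

lemma inj_word_star: "inj word_star"
  by (metis injI word_star_word_star)

lemma lookup_poly_star: "Poly_Mapping.lookup (poly_star f) w = cnj (Poly_Mapping.lookup f (word_star w))"
  by (simp add: poly_star_def map_key.rep_eq[OF inj_word_star] Poly_Mapping.map.rep_eq when_def)

lemma poly_star_add: "poly_star (f + g) = poly_star f + poly_star g"
  by (rule poly_mapping_eqI) (simp add: lookup_poly_star lookup_add)

lemma poly_star_diff: "poly_star (f - g) = poly_star f - poly_star g"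
  by (rule poly_mapping_eqI) (simp add: lookup_poly_star lookup_minus)

lemma poly_star_poly_star [simp]: "poly_star (poly_star f) = f"
  by (rule poly_mapping_eqI) (simp add: lookup_poly_star)

lemma poly_star_single: "poly_star (Poly_Mapping.single w a) = Poly_Mapping.single (word_star w) (cnj a)"
  by (rule poly_mapping_eqI) (auto simp: lookup_poly_star lookup_single when_def)

lemma poly_star_mult: "poly_star (f * g) = poly_star g * poly_star f"
proof (induction f rule: poly_mapping_induct_add)
  case (single v a)
  show ?case
    by (induction g rule: poly_mapping_induct_add)
      (simp_all add: mult_single poly_star_single word_star_add poly_star_add distrib_left distrib_right mult.commute)
qed (simp_all add: poly_star_add distrib_left distrib_right)

lemma poly_star_gen: "poly_star (gen l) = gen (star_letter l)"
  by (simp add: gen_def poly_star_single word_star_def)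

lemma poly_star_one: "poly_star 1 = 1"
proof -
  have "word_star 0 = 0" by (simp add: word_star_def zero_star_word_def)
  then show ?thesis using poly_star_single[of 0 1] by simp
qed

lemma single_Cons: "Poly_Mapping.single (Word (l # ls)) 1 = gen l * Poly_Mapping.single (Word ls) 1"
  by (simp add: gen_def mult_single plus_star_word_def)

section \<open>C*-seminorms vanishing on the relations\<close>

locale relation_seminorm =
  fixes \<gamma> :: real and p :: "star_poly \<Rightarrow> real"
  assumes seminorm: "cstar_seminorm p" and relations: "vanishes_on_relations \<gamma> p"
begin

lemma p_nonneg [simp]: "0 \<le> p f"
  and p_add: "p (f + g) \<le> p f + p g"
  and p_smult: "p (poly_smult a f) = cmod a * p f"
  and p_mult: "p (f * g) \<le> p f * p g"
  and p_star_mult: "p (poly_star f * f) = (p f)\<^sup>2"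
  using seminorm unfolding cstar_seminorm_def by auto

lemma p_zero [simp]: "p 0 = 0"
  using p_smult[of 0 0] by (simp add: poly_smult_simps)

lemma p_uminus: "p (- f) = p f"
  using p_smult[of "-1" f] by (simp add: poly_smult_simps)

lemma p_minus_commute: "p (f - g) = p (g - f)"
  using p_uminus[of "f - g"] by simp

lemma p_star: "p (poly_star f) = p f"
proof -
  have le: "p f \<le> p (poly_star f)" for f
  proof (cases "p f = 0")
    case False
    have "p f * p f \<le> p (poly_star f) * p f"
      using p_star_mult[of f] p_mult[of "poly_star f" f] by (simp add: power2_eq_square)
    then show ?thesis using False p_nonneg[of f] by (simp add: mult_le_cancel_right)
  qed simp
  show ?thesis using le[of f] le[of "poly_star f"] by simp
qed

lemma p_one: "p 1 \<le> 1"
proof -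
  have "p 1 = p 1 * p 1"
    using p_star_mult[of 1] by (simp add: poly_star_one power2_eq_square)
  then show ?thesis by (metis mult_cancel_right2 order.refl zero_le_one)
qed

text \<open>Computing modulo the null ideal of \<open>p\<close> takes the place of passing to the
  quotient algebra.\<close>

definition equivalent :: "star_poly \<Rightarrow> star_poly \<Rightarrow> bool" (infix "\<asymp>" 50)
  where "f \<asymp> g \<longleftrightarrow> p (f - g) = 0"

lemma equivalentI: "p (f - g) \<le> 0 \<Longrightarrow> f \<asymp> g"
  by (simp add: equivalent_def antisym)

lemma equivalent_refl [simp]: "f \<asymp> f"
  by (simp add: equivalent_def)

lemma equivalent_sym: "f \<asymp> g \<Longrightarrow> g \<asymp> f"
  by (simp add: equivalent_def p_minus_commute)

lemma equivalent_trans [trans]: "f \<asymp> g \<Longrightarrow> g \<asymp> h \<Longrightarrow> f \<asymp> h"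
  using p_add[of "f - g" "g - h"] by (intro equivalentI) (simp add: equivalent_def)

lemma equivalent_add: "f \<asymp> f' \<Longrightarrow> g \<asymp> g' \<Longrightarrow> f + g \<asymp> f' + g'"
  using p_add[of "f - f'" "g - g'"] by (intro equivalentI) (simp add: equivalent_def add_diff_add)

lemma equivalent_smult: "f \<asymp> g \<Longrightarrow> poly_smult a f \<asymp> poly_smult a g"
  by (simp add: equivalent_def poly_smult_simps(2)[symmetric] p_smult)

lemma equivalent_mult_left: "f \<asymp> g \<Longrightarrow> h * f \<asymp> h * g"
  using p_mult[of h "f - g"] by (intro equivalentI) (simp add: equivalent_def right_diff_distrib)

lemma equivalent_mult_right: "f \<asymp> g \<Longrightarrow> f * h \<asymp> g * h"
  using p_mult[of "f - g" h] by (intro equivalentI) (simp add: equivalent_def left_diff_distrib)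

lemma equivalent_p: "f \<asymp> g \<Longrightarrow> p f = p g"
  using p_add[of "f - g" g] p_add[of "g - f" f] by (simp add: equivalent_def p_minus_commute)

lemma gen_unitary: "gen (star_letter l) * gen l \<asymp> 1"
  using relations by (cases l) (simp_all add: vanishes_on_relations_def equivalent_def)

lemma p_gen: "p (gen l) \<le> 1"
proof -
  have "(p (gen l))\<^sup>2 = p (gen (star_letter l) * gen l)"
    using p_star_mult[of "gen l"] by (simp add: poly_star_gen)
  also have "\<dots> = p 1" by (rule equivalent_p[OF gen_unitary])
  finally have "(p (gen l))\<^sup>2 \<le> 1\<^sup>2" using p_one by simp
  then show ?thesis by (rule power2_le_imp_le) simp
qed

lemma p_word: "p (Poly_Mapping.single w 1) \<le> 1"
proof -
  have "p (Poly_Mapping.single (Word ls) 1) \<le> 1" for ls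
  proof (induction ls)
    case Nil
    then show ?case using p_one by (simp add: zero_star_word_def[symmetric])
  next
    case (Cons l ls)
    have "p (gen l * Poly_Mapping.single (Word ls) 1) \<le> p (gen l) * p (Poly_Mapping.single (Word ls) 1)"
      by (rule p_mult)
    also have "\<dots> \<le> 1 * 1" using p_gen Cons by (intro mult_mono) auto
    finally show ?case by (simp add: single_Cons)
  qed
  then show ?thesis by (cases w) simp
qed

lemma p_single: "p (Poly_Mapping.single w a) \<le> cmod a"
  using p_smult[of a "Poly_Mapping.single w 1"] p_word[of w]
  by (simp add: poly_smult_simps mult_left_le)

end

section \<open>The universal seminorm and its completion\<close>

text \<open>Words are products of contractions for every such seminorm, so the absolute sum of the
  coefficients is a common bound. This makes the supremum in \<open>universal_seminorm\<close> a
  genuine least upper bound.\<close>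

lemma seminorms_bounded:
  "\<exists>C. \<forall>p. cstar_seminorm p \<and> vanishes_on_relations \<gamma> p \<longrightarrow> p f \<le> C"
proof (induction f rule: poly_mapping_induct_add)
  case (single w a)
  then show ?case using relation_seminorm.p_single relation_seminorm.intro by blast
next
  case (add f g)
  then obtain C D where "\<And>p. cstar_seminorm p \<and> vanishes_on_relations \<gamma> p \<Longrightarrow> p f \<le> C"
    "\<And>p. cstar_seminorm p \<and> vanishes_on_relations \<gamma> p \<Longrightarrow> p g \<le> D" by blast
  then have "p (f + g) \<le> C + D" if "cstar_seminorm p \<and> vanishes_on_relations \<gamma> p" for p
    using relation_seminorm.p_add[of \<gamma> p f g] that
    by (meson add_mono order_trans relation_seminorm.intro)
  then show ?case by blast
qed

lemma universal_seminorm_upper: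
  assumes "cstar_seminorm p" "vanishes_on_relations \<gamma> p"
  shows "p f \<le> universal_seminorm \<gamma> f"
  unfolding universal_seminorm_def
proof (rule cSUP_upper)
  show "bdd_above ((\<lambda>p. p f) ` {p. cstar_seminorm p \<and> vanishes_on_relations \<gamma> p})"
    using seminorms_bounded[of \<gamma> f] by (auto simp: bdd_above_def)
qed (use assms in simp)

lemma universal_seminorm_least:
  assumes "\<And>p. cstar_seminorm p \<Longrightarrow> vanishes_on_relations \<gamma> p \<Longrightarrow> p f \<le> C"
  shows "universal_seminorm \<gamma> f \<le> C"
  unfolding universal_seminorm_def
proof (rule cSUP_least)
  have "(\<lambda>f. 0) \<in> {p. cstar_seminorm p \<and> vanishes_on_relations \<gamma> p}"
    by (simp add: cstar_seminorm_def vanishes_on_relations_def)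
  then show "{p. cstar_seminorm p \<and> vanishes_on_relations \<gamma> p} \<noteq> {}" by blast
qed (use assms in auto)

context
  fixes \<gamma> :: real
begin

lemma universal_seminorm_nonneg: "0 \<le> universal_seminorm \<gamma> f"
  using universal_seminorm_upper[of "\<lambda>f. 0" \<gamma> f]
  by (simp add: cstar_seminorm_def vanishes_on_relations_def)

lemma universal_seminorm_add: "universal_seminorm \<gamma> (f + g) \<le> universal_seminorm \<gamma> f + universal_seminorm \<gamma> g"
proof (rule universal_seminorm_least)
  fix p assume p: "cstar_seminorm p" "vanishes_on_relations \<gamma> p"
  interpret relation_seminorm \<gamma> p using p by unfold_locales
  show "p (f + g) \<le> universal_seminorm \<gamma> f + universal_seminorm \<gamma> g"
    using p_add[of f g] universal_seminorm_upper[OF p, of f] universal_seminorm_upper[OF p, of g] by linarith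
qed

lemma universal_seminorm_zero: "universal_seminorm \<gamma> 0 = 0"
proof (rule antisym[OF universal_seminorm_least universal_seminorm_nonneg])
  fix p assume p: "cstar_seminorm p" "vanishes_on_relations \<gamma> p"
  interpret relation_seminorm \<gamma> p using p by unfold_locales
  show "p 0 \<le> 0" by simp
qed

lemma universal_seminorm_uminus: "universal_seminorm \<gamma> (- f) = universal_seminorm \<gamma> f"
proof -
  have "universal_seminorm \<gamma> (- f) \<le> universal_seminorm \<gamma> f" for f
  proof (rule universal_seminorm_least)
    fix p assume p: "cstar_seminorm p" "vanishes_on_relations \<gamma> p"
    interpret relation_seminorm \<gamma> p using p by unfold_locales
    show "p (- f) \<le> universal_seminorm \<gamma> f" using universal_seminorm_upper[OF p, of f] by (simp add: p_uminus)
  qed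
  from this[of f] this[of "- f"] show ?thesis by simp
qed

lemma universal_seminorm_star: "universal_seminorm \<gamma> (poly_star f) = universal_seminorm \<gamma> f"
proof -
  have "universal_seminorm \<gamma> (poly_star f) \<le> universal_seminorm \<gamma> f" for f
  proof (rule universal_seminorm_least)
    fix p assume p: "cstar_seminorm p" "vanishes_on_relations \<gamma> p"
    interpret relation_seminorm \<gamma> p using p by unfold_locales
    show "p (poly_star f) \<le> universal_seminorm \<gamma> f" using universal_seminorm_upper[OF p, of f] by (simp add: p_star)
  qed
  from this[of f] this[of "poly_star f"] show ?thesis by simp
qed

lemma universal_seminorm_minus_commute: "universal_seminorm \<gamma> (f - g) = universal_seminorm \<gamma> (g - f)"
  using universal_seminorm_uminus[of "f - g"] by simp

lemma universal_seminorm_triangle: "universal_seminorm \<gamma> (f - h) \<le> universal_seminorm \<gamma> (f - g) + universal_seminorm \<gamma> (g - h)"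
  using universal_seminorm_add[of "f - g" "g - h"] by simp

lemma equiv_null_rel: "equiv (cauchy_seqs \<gamma>) (null_rel \<gamma>)"
proof (rule equivI)
  show "null_rel \<gamma> \<subseteq> cauchy_seqs \<gamma> \<times> cauchy_seqs \<gamma>" by (auto simp: null_rel_def)
  show "refl_on (cauchy_seqs \<gamma>) (null_rel \<gamma>)"
    by (auto simp: refl_on_def null_rel_def universal_seminorm_zero)
  show "sym (null_rel \<gamma>)"
    by (auto simp: sym_def null_rel_def universal_seminorm_minus_commute)
  show "trans (null_rel \<gamma>)"
  proof (rule transI)
    fix X Y Z assume XY: "(X, Y) \<in> null_rel \<gamma>" and YZ: "(Y, Z) \<in> null_rel \<gamma>"
    then have "(\<lambda>k. universal_seminorm \<gamma> (X k - Y k) + universal_seminorm \<gamma> (Y k - Z k)) \<longlonglongrightarrow> 0"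
      by (intro tendsto_add_zero) (simp_all add: null_rel_def)
    then have "(\<lambda>k. universal_seminorm \<gamma> (X k - Z k)) \<longlonglongrightarrow> 0"
      by (rule tendsto_sandwich[OF _ _ tendsto_const, rotated 2])
        (simp_all add: universal_seminorm_nonneg universal_seminorm_triangle)
    then show "(X, Z) \<in> null_rel \<gamma>" using XY YZ by (simp add: null_rel_def)
  qed
qed

lemma cauchy_seqs_const: "(\<lambda>k. f) \<in> cauchy_seqs \<gamma>"
  by (simp add: cauchy_seqs_def universal_seminorm_zero)

lemma cauchy_seqs_add:
  assumes X: "X \<in> cauchy_seqs \<gamma>" and Y: "Y \<in> cauchy_seqs \<gamma>"
  shows "(\<lambda>k. X k + Y k) \<in> cauchy_seqs \<gamma>"
  unfolding cauchy_seqs_def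
proof (intro CollectI allI impI)
  fix e :: real assume "0 < e"
  then have e: "0 < e / 2" by simp
  obtain M where M: "\<And>k l. k \<ge> M \<Longrightarrow> l \<ge> M \<Longrightarrow> universal_seminorm \<gamma> (X k - X l) < e / 2"
    using X e unfolding cauchy_seqs_def by blast
  obtain L where L: "\<And>k l. k \<ge> L \<Longrightarrow> l \<ge> L \<Longrightarrow> universal_seminorm \<gamma> (Y k - Y l) < e / 2"
    using Y e unfolding cauchy_seqs_def by blast
  have "universal_seminorm \<gamma> (X k + Y k - (X l + Y l)) < e" if "k \<ge> max M L" "l \<ge> max M L" for k l
  proof -
    have "universal_seminorm \<gamma> ((X k - X l) + (Y k - Y l)) \<le> universal_seminorm \<gamma> (X k - X l) + universal_seminorm \<gamma> (Y k - Y l)"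
      by (rule universal_seminorm_add)
    then show ?thesis using M[of k l] L[of k l] that by (simp add: algebra_simps)
  qed
  then show "\<exists>M. \<forall>k\<ge>M. \<forall>l\<ge>M. universal_seminorm \<gamma> (X k + Y k - (X l + Y l)) < e" by blast
qed

lemma null_rel_add:
  assumes X: "(X, X') \<in> null_rel \<gamma>" and Y: "(Y, Y') \<in> null_rel \<gamma>"
  shows "(\<lambda>k. X k + Y k, \<lambda>k. X' k + Y' k) \<in> null_rel \<gamma>"
proof -
  have "(\<lambda>k. universal_seminorm \<gamma> (X k - X' k) + universal_seminorm \<gamma> (Y k - Y' k)) \<longlonglongrightarrow> 0"
    using X Y by (intro tendsto_add_zero) (simp_all add: null_rel_def)
  then have "(\<lambda>k. universal_seminorm \<gamma> ((X k - X' k) + (Y k - Y' k))) \<longlonglongrightarrow> 0"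
    by (rule tendsto_sandwich[OF _ _ tendsto_const, rotated 2])
      (simp_all add: universal_seminorm_nonneg universal_seminorm_add)
  then show ?thesis using X Y cauchy_seqs_add by (simp add: null_rel_def algebra_simps)
qed

lemma null_rel_star:
  assumes X: "(X, X') \<in> null_rel \<gamma>"
  shows "(\<lambda>k. poly_star (X k), \<lambda>k. poly_star (X' k)) \<in> null_rel \<gamma>"
  using X by (simp add: null_rel_def cauchy_seqs_def poly_star_diff[symmetric] universal_seminorm_star)

lemma rotation_algebra_add:
  "null_rel \<gamma> `` {\<lambda>k. f} \<oplus>\<^bsub>rotation_algebra \<gamma>\<^esub> null_rel \<gamma> `` {\<lambda>k. g} = null_rel \<gamma> `` {\<lambda>k. f + g}"
proof -
  have "congruent2 (null_rel \<gamma>) (null_rel \<gamma>) (\<lambda>X Y. null_rel \<gamma> `` {\<lambda>k. X k + Y k})"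
    by (rule congruent2I', rule equiv_class_eq[OF equiv_null_rel], rule null_rel_add)
  from UN_equiv_class2[OF equiv_null_rel equiv_null_rel this cauchy_seqs_const cauchy_seqs_const]
  show ?thesis by (simp add: rotation_algebra_def)
qed

lemma rotation_algebra_star:
  "star (rotation_algebra \<gamma>) (null_rel \<gamma> `` {\<lambda>k. f}) = null_rel \<gamma> `` {\<lambda>k. poly_star f}"
proof -
  have "congruent (null_rel \<gamma>) (\<lambda>X. null_rel \<gamma> `` {\<lambda>k. poly_star (X k)})"
    by (rule congruentI, rule equiv_class_eq[OF equiv_null_rel], rule null_rel_star)
  from UN_equiv_class[OF equiv_null_rel this cauchy_seqs_const]
  show ?thesis by (simp add: rotation_algebra_def)
qed

text \<open>The definite description is resolved by showing that every representative of the class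
  has the same limit, by the reverse triangle inequality.\<close>

lemma rotation_algebra_cnorm:
  "cnorm (rotation_algebra \<gamma>) (null_rel \<gamma> `` {\<lambda>k. f}) = universal_seminorm \<gamma> f"
proof -
  have lim: "(\<lambda>k. universal_seminorm \<gamma> (X k)) \<longlonglongrightarrow> universal_seminorm \<gamma> f" if "X \<in> null_rel \<gamma> `` {\<lambda>k. f}" for X
  proof (rule LIM_zero_cancel, rule Lim_null_comparison[OF always_eventually[OF allI]])
    show "(\<lambda>k. universal_seminorm \<gamma> (f - X k)) \<longlonglongrightarrow> 0" using that by (simp add: null_rel_def)
    fix k
    show "norm (universal_seminorm \<gamma> (X k) - universal_seminorm \<gamma> f) \<le> universal_seminorm \<gamma> (f - X k)"
      using universal_seminorm_add[of "f - X k" "X k"] universal_seminorm_add[of "X k - f" f]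
      by (simp add: universal_seminorm_minus_commute abs_le_iff)
  qed
  have "(\<lambda>k. f) \<in> null_rel \<gamma> `` {\<lambda>k. f}"
    using equiv_class_self[OF equiv_null_rel cauchy_seqs_const] .
  then have "(THE r. \<forall>X\<in>null_rel \<gamma> `` {\<lambda>k. f}. (\<lambda>k. universal_seminorm \<gamma> (X k)) \<longlonglongrightarrow> r) = universal_seminorm \<gamma> f"
    using lim by (intro the_equality) (blast intro: LIMSEQ_unique)+
  then show ?thesis by (simp add: rotation_algebra_def)
qed

end

text \<open>The Harper element. On the lattice it acts as the adjacency operator in a magnetic field
  of flux \<gamma>.\<close>

definition harper :: star_poly
  where "harper = gen letter.U + gen letter.U' + gen letter.V + gen letter.V'"

text \<open>Eliminates the completion: from here on only the seminorm of one polynomial is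
  studied.\<close>

lemma cnorm_harper:
  assumes "A = rotation_algebra \<gamma>" "u = rotation_u \<gamma>" "v = rotation_v \<gamma>"
  shows "cnorm A (u \<oplus>\<^bsub>A\<^esub> star A u \<oplus>\<^bsub>A\<^esub> v \<oplus>\<^bsub>A\<^esub> star A v) = universal_seminorm \<gamma> harper"
  by (simp add: assms rotation_u_def rotation_v_def rotation_algebra_star rotation_algebra_add
      rotation_algebra_cnorm poly_star_gen harper_def)

section \<open>Representations on semi-inner product spaces\<close>

text \<open>Neither definiteness nor completeness is assumed. This covers finitely supported
  functions, functions on the naturals of which n coordinates count, and a form whose null vectors
  are the object of interest in \<open>symmetric_maximizer\<close>.\<close>

locale semi_inner = vector_space scale
  for scale :: "complex \<Rightarrow> 'e::ab_group_add \<Rightarrow> 'e" (infixr "*s" 75) +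
  fixes ip :: "'e \<Rightarrow> 'e \<Rightarrow> complex"
  assumes ip_add_right: "ip x (y + z) = ip x y + ip x z"
    and ip_scale_right: "ip x (a *s y) = a * ip x y"
    and ip_cnj: "ip y x = cnj (ip x y)"
    and ip_nonneg: "0 \<le> Re (ip x x)"
begin

definition nrm :: "'e \<Rightarrow> real"
  where "nrm x = sqrt (Re (ip x x))"

lemma nrm_nonneg [simp]: "0 \<le> nrm x"
  by (simp add: nrm_def ip_nonneg)

lemma nrm_sq: "(nrm x)\<^sup>2 = Re (ip x x)"
  by (simp add: nrm_def ip_nonneg)

lemma ip_self: "ip x x = of_real ((nrm x)\<^sup>2)"
  using arg_cong[OF ip_cnj[of x x], of Im] by (simp add: nrm_sq complex_eq_iff)

lemma ip_add_left: "ip (x + y) z = ip x z + ip y z"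
  using ip_cnj[of "x + y" z] ip_cnj[of x z] ip_cnj[of y z] by (simp add: ip_add_right)

lemma ip_scale_left: "ip (a *s x) z = cnj a * ip x z"
  using ip_cnj[of "a *s x" z] ip_cnj[of x z] by (simp add: ip_scale_right)

lemma ip_zero_right [simp]: "ip x 0 = 0"
  using ip_scale_right[of x 0 0] by simp

lemma ip_zero_left [simp]: "ip 0 x = 0"
  using ip_scale_left[of 0 0 x] by simp

lemma ip_minus_right: "ip x (- y) = - ip x y"
  using ip_add_right[of x y "- y"] by (simp add: eq_neg_iff_add_eq_0 add.commute)

lemma ip_minus_left: "ip (- x) y = - ip x y"
  using ip_add_left[of x "- x" y] by (simp add: eq_neg_iff_add_eq_0 add.commute)

lemma ip_diff_right: "ip x (y - z) = ip x y - ip x z"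
  using ip_add_right[of x y "- z"] by (simp add: ip_minus_right)

lemma ip_diff_left: "ip (x - y) z = ip x z - ip y z"
  using ip_add_left[of x "- y" z] by (simp add: ip_minus_left)

lemma ip_sum_right: "ip x (\<Sum>i\<in>A. f i) = (\<Sum>i\<in>A. ip x (f i))"
  by (induction A rule: infinite_finite_induct) (simp_all add: ip_add_right)

lemma nrm_scale: "nrm (a *s x) = cmod a * nrm x"
proof -
  have "ip (a *s x) (a *s x) = a * cnj a * ip x x"
    by (simp add: ip_scale_left ip_scale_right)
  then have "Re (ip (a *s x) (a *s x)) = (cmod a)\<^sup>2 * (nrm x)\<^sup>2"
    by (simp only: ip_self complex_norm_square[symmetric] of_real_mult[symmetric] Re_complex_of_real)
  then show ?thesis unfolding nrm_def[of "a *s x"] by (simp add: real_sqrt_mult)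
qed

lemma ip_le_nrm: "cmod (ip x y) \<le> nrm x * nrm y"
proof -
  let ?b = "(cmod (ip x y))\<^sup>2"
  have quad: "0 \<le> (nrm x)\<^sup>2 - 2 * t * ?b + t\<^sup>2 * ?b * (nrm y)\<^sup>2" for t :: real
  proof -
    define s where "s = of_real t * ip y x"
    have yx: "ip y x = cnj (ip x y)" by (rule ip_cnj)
    have bb': "ip x y * cnj (ip x y) = of_real ?b" by (rule complex_norm_square[symmetric])
    then have bb: "cnj (ip x y) * ip x y = of_real ?b" by (simp only: mult.commute)
    have "ip (x - s *s y) (x - s *s y) = ip x x - s * ip x y - cnj s * ip y x + cnj s * s * ip y y"
      by (simp add: ip_diff_left ip_diff_right ip_scale_left ip_scale_right algebra_simps)
    then have "Re (ip (x - s *s y) (x - s *s y))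
        = (nrm x)\<^sup>2 - Re (s * ip x y) - Re (cnj s * ip y x) + Re (cnj s * s * of_real ((nrm y)\<^sup>2))"
      by (simp only: ip_self minus_complex.simps plus_complex.simps Re_complex_of_real)
    also have "s * ip x y = of_real (t * ?b)" by (simp only: s_def yx mult.assoc bb of_real_mult)
    also have "cnj s * ip y x = of_real (t * ?b)"
      by (simp only: s_def yx complex_cnj_mult complex_cnj_complex_of_real complex_cnj_cnj mult.assoc bb'
          of_real_mult)
    also have "cnj s * s = of_real (t\<^sup>2 * ?b)"
    proof -
      have "cnj s * s = of_real t * (of_real t * (ip x y * cnj (ip x y)))"
        by (simp add: s_def yx mult_ac)
      then show ?thesis by (simp only: bb' of_real_mult power2_eq_square[of t] mult.assoc)
    qed
    finally have "Re (ip (x - s *s y) (x - s *s y)) = (nrm x)\<^sup>2 - 2 * t * ?b + t\<^sup>2 * ?b * (nrm y)\<^sup>2"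
      by (simp only: of_real_mult[symmetric] Re_complex_of_real)
    then show ?thesis using ip_nonneg by metis
  qed
  have "?b \<le> (nrm x * nrm y)\<^sup>2"
  proof (cases "nrm y = 0")
    case True
    have "?b = 0"
    proof (rule ccontr)
      assume "?b \<noteq> 0"
      \<comment> \<open>If y is a null vector, the quadratic polynomial is affine in t, and this
        choice of t gives it the value -1.\<close>
      then have "2 * (((nrm x)\<^sup>2 + 1) / (2 * ?b)) * ?b = (nrm x)\<^sup>2 + 1" by simp
      then show False using quad[of "((nrm x)\<^sup>2 + 1) / (2 * ?b)"] True by simp
    qed
    then show ?thesis by simp
  next
    case False
    \<comment> \<open>The quadratic polynomial is evaluated at its minimum.\<close>
    then have "0 \<le> ((nrm x)\<^sup>2 - 2 * (1 / (nrm y)\<^sup>2) * ?b + (1 / (nrm y)\<^sup>2)\<^sup>2 * ?b * (nrm y)\<^sup>2) * (nrm y)\<^sup>2"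
      using quad[of "1 / (nrm y)\<^sup>2"] by simp
    also have "\<dots> = (nrm x * nrm y)\<^sup>2 - ?b"
      using False by (simp add: field_simps power2_eq_square)
    finally show ?thesis by simp
  qed
  then show ?thesis by (rule power2_le_imp_le) simp
qed

lemma nrm_triangle: "nrm (x + y) \<le> nrm x + nrm y"
proof -
  have "ip y x = cnj (ip x y)" by (rule ip_cnj)
  then have "(nrm (x + y))\<^sup>2 = (nrm x)\<^sup>2 + (nrm y)\<^sup>2 + 2 * Re (ip x y)"
    by (simp add: nrm_sq ip_add_left ip_add_right)
  also have "\<dots> \<le> (nrm x + nrm y)\<^sup>2"
    using ip_le_nrm[of x y] complex_Re_le_cmod[of "ip x y"] by (simp add: power2_sum)
  finally show ?thesis by (rule power2_le_imp_le) simp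
qed

end

text \<open>The letters \<open>u, v, u\<^sup>*, v\<^sup>*\<close> are numbered cyclically: taking adjoints is a shift by 2, and all
  commutation relations take the same form. The shift by 1 is an automorphism.\<close>

fun letter_index :: "letter \<Rightarrow> nat"
  where
    "letter_index letter.U = 0"
  | "letter_index letter.V = 1"
  | "letter_index letter.U' = 2"
  | "letter_index letter.V' = 3"

text \<open>The relations are required only inside the inner product because the form may be
  degenerate: for the clock and shift representations below, the inverse relation fails at the
  coordinates that do not count. In the cyclic numbering, \<open>act_commute\<close> for all
  \<open>r\<close> is the single relation v u = \<omega> u v rewritten for each pair of neighbouring
  letters.\<close>

locale phase_rep = semi_inner scale ip
  for scale :: "complex \<Rightarrow> 'e::ab_group_add \<Rightarrow> 'e" (infixr "*s" 75) and ip +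
  fixes act :: "nat \<Rightarrow> 'e \<Rightarrow> 'e" and \<omega> :: complex
  assumes act_add: "act r (x + y) = act r x + act r y"
    and act_scale: "act r (a *s x) = a *s act r x"
    and act_adj: "ip (act r x) y = ip x (act (r + 2) y)"
    and act_inv: "ip y (act (r + 2) (act r x)) = ip y x"
    and act_commute: "ip y (act (Suc r) (act r x)) = \<omega> * ip y (act r (act (Suc r) x))"
    and act_period: "act (r + 4) = act r"
begin

lemma act_star_letter: "act (letter_index (star_letter l)) = act (letter_index l + 2)"
  using act_period[of 0] act_period[of 1] by (cases l) (simp_all add: numeral_eq_Suc)

lemma nrm_act: "nrm (act r x) = nrm x"
  by (simp only: nrm_def act_adj act_inv)

fun word_act :: "letter list \<Rightarrow> 'e \<Rightarrow> 'e"
  where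
    "word_act [] x = x"
  | "word_act (l # ls) x = act (letter_index l) (word_act ls x)"

lemma word_act_append: "word_act (ls @ ls') x = word_act ls (word_act ls' x)"
  by (induction ls) simp_all

lemma word_act_add: "word_act ls (x + y) = word_act ls x + word_act ls y"
  by (induction ls) (simp_all add: act_add)

lemma word_act_scale: "word_act ls (a *s x) = a *s word_act ls x"
  by (induction ls) (simp_all add: act_scale)

lemma nrm_word_act: "nrm (word_act ls x) = nrm x"
  by (induction ls) (simp_all add: nrm_act)

lemma word_act_adj: "ip (word_act ls x) y = ip x (word_act (rev (map star_letter ls)) y)"
  by (induction ls arbitrary: y) (simp_all add: word_act_append act_adj act_star_letter)

definition rep :: "star_poly \<Rightarrow> 'e \<Rightarrow> 'e"
  where "rep f x = (\<Sum>w\<in>Poly_Mapping.keys f. Poly_Mapping.lookup f w *s word_act (letters w) x)"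

lemma rep_single: "rep (Poly_Mapping.single w a) x = a *s word_act (letters w) x"
  by (simp add: rep_def)

lemma rep_add: "rep (f + g) x = rep f x + rep g x"
  unfolding rep_def
  by (rule setsum_keys_plus_distrib) (simp_all add: scale_left_distrib)

lemma rep_uminus: "rep (- f) x = - rep f x"
  using rep_add[of f "- f" x] by (simp add: rep_def eq_neg_iff_add_eq_0 add.commute)

lemma rep_diff: "rep (f - g) x = rep f x - rep g x"
  using rep_add[of f "- g" x] by (simp add: rep_uminus)

lemma rep_mult: "rep (f * g) x = rep f (rep g x)"
proof (induction f rule: poly_mapping_induct_add)
  case (single v a)
  show ?case
    by (induction g rule: poly_mapping_induct_add)
      (simp_all add: mult_single rep_single plus_star_word_def word_act_append word_act_scale
        word_act_add scale_right_distrib distrib_left rep_add)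
qed (simp_all add: rep_add distrib_right)

lemma rep_one: "rep 1 x = x"
proof -
  have "letters 0 = []" by (simp add: zero_star_word_def)
  then show ?thesis using rep_single[of 0 1 x] by simp
qed

lemma rep_smult: "rep (poly_smult a f) x = a *s rep f x"
  unfolding poly_smult_eq_mult rep_mult by (simp add: rep_single zero_star_word_def)

lemma rep_gen: "rep (gen l) x = act (letter_index l) x"
  by (simp add: gen_def rep_single)

lemma rep_star: "ip (rep f x) y = ip x (rep (poly_star f) y)"
  by (induction f rule: poly_mapping_induct_add)
    (simp_all add: rep_single poly_star_single word_star_def word_act_adj rep_add poly_star_add
      ip_add_left ip_add_right ip_scale_left ip_scale_right)

definition hop :: "'e \<Rightarrow> 'e"
  where "hop x = (\<Sum>r<4. act r x)"

lemma rep_harper: "rep harper x = hop x"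
  by (simp add: harper_def rep_add rep_gen hop_def eval_nat_numeral ac_simps)

definition rep_norm :: "star_poly \<Rightarrow> real"
  where "rep_norm f = Inf {C. 0 \<le> C \<and> (\<forall>x. nrm (rep f x) \<le> C * nrm x)}"

lemma rep_bounded: "\<exists>C\<ge>0. \<forall>x. nrm (rep f x) \<le> C * nrm x"
proof (induction f rule: poly_mapping_induct_add)
  case (single w a)
  show ?case
    by (rule exI[of _ "cmod a"]) (simp add: rep_single nrm_scale nrm_word_act)
next
  case (add f g)
  then obtain C D where "0 \<le> C" "0 \<le> D" "\<And>x. nrm (rep f x) \<le> C * nrm x" "\<And>x. nrm (rep g x) \<le> D * nrm x"
    by blast
  then have "nrm (rep (f + g) x) \<le> (C + D) * nrm x" for x
    using nrm_triangle[of "rep f x" "rep g x"] by (simp add: rep_add distrib_right) (meson add_mono order_trans)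
  then show ?case using \<open>0 \<le> C\<close> \<open>0 \<le> D\<close> by (intro exI[of _ "C + D"]) simp
qed

lemma rep_norm_nonneg: "0 \<le> rep_norm f"
  unfolding rep_norm_def using rep_bounded[of f] by (intro cInf_greatest) auto

lemma rep_norm_least:
  assumes "0 \<le> C" "\<And>x. nrm (rep f x) \<le> C * nrm x"
  shows "rep_norm f \<le> C"
  unfolding rep_norm_def by (rule cInf_lower) (use assms in \<open>auto intro: bdd_belowI[of _ 0]\<close>)

lemma nrm_rep_le: "nrm (rep f x) \<le> rep_norm f * nrm x"
proof (cases "nrm x = 0")
  case True
  then show ?thesis using rep_bounded[of f] by (metis mult_zero_right)
next
  case False
  then have "nrm (rep f x) / nrm x \<le> rep_norm f"
    unfolding rep_norm_def using rep_bounded[of f] nrm_nonneg[of x]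
    by (intro cInf_greatest) (auto simp: pos_divide_le_eq less_le)
  then show ?thesis using False nrm_nonneg[of x] by (simp add: pos_divide_le_eq less_le)
qed

lemma cstar_seminorm_rep_norm: "cstar_seminorm rep_norm"
  unfolding cstar_seminorm_def
proof (intro conjI allI)
  fix f g :: star_poly and a :: complex
  show "0 \<le> rep_norm f" by (rule rep_norm_nonneg)
  show "rep_norm (f + g) \<le> rep_norm f + rep_norm g"
  proof (rule rep_norm_least)
    fix x
    have "nrm (rep (f + g) x) \<le> nrm (rep f x) + nrm (rep g x)" by (simp add: rep_add nrm_triangle)
    also have "\<dots> \<le> rep_norm f * nrm x + rep_norm g * nrm x" by (intro add_mono nrm_rep_le)
    finally show "nrm (rep (f + g) x) \<le> (rep_norm f + rep_norm g) * nrm x" by (simp add: distrib_right)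
  qed (simp add: rep_norm_nonneg)
  have smult: "rep_norm (poly_smult a f) \<le> cmod a * rep_norm f" for a f
    using nrm_rep_le[of f] by (intro rep_norm_least)
      (simp_all add: rep_norm_nonneg rep_smult nrm_scale mult.assoc mult_left_mono)
  show "rep_norm (poly_smult a f) = cmod a * rep_norm f"
  proof (cases "a = 0")
    case True
    then show ?thesis using smult[of a f] rep_norm_nonneg[of "poly_smult a f"] by simp
  next
    case False
    then have "cmod a * rep_norm f \<le> rep_norm (poly_smult a f)"
      using smult[of "inverse a" "poly_smult a f"] by (simp add: poly_smult_simps norm_divide field_simps)
    then show ?thesis using smult[of a f] by simp
  qed
  have mult: "rep_norm (f * g) \<le> rep_norm f * rep_norm g" for f g
  proof (rule rep_norm_least)
    fix x
    have "nrm (rep (f * g) x) \<le> rep_norm f * nrm (rep g x)" by (simp add: rep_mult nrm_rep_le)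
    also have "\<dots> \<le> rep_norm f * (rep_norm g * nrm x)"
      by (intro mult_left_mono nrm_rep_le rep_norm_nonneg)
    finally show "nrm (rep (f * g) x) \<le> rep_norm f * rep_norm g * nrm x" by (simp add: mult.assoc)
  qed (simp add: rep_norm_nonneg)
  then show "rep_norm (f * g) \<le> rep_norm f * rep_norm g" .
  \<comment> \<open>One half of the C*-identity, from the square of the norm of
    \<open>rep f x\<close> being the expectation of \<open>poly_star f * f\<close>. Together with
    submultiplicativity it shows that the star does not change the norm, which gives the other
    half.\<close>
  have sq: "(rep_norm f)\<^sup>2 \<le> rep_norm (poly_star f * f)" for f
  proof -
    have "rep_norm f \<le> sqrt (rep_norm (poly_star f * f))"
    proof (rule rep_norm_least)
      fix x
      have "(nrm (rep f x))\<^sup>2 = Re (ip x (rep (poly_star f * f) x))"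
        by (simp add: nrm_sq rep_star rep_mult)
      also have "\<dots> \<le> nrm x * nrm (rep (poly_star f * f) x)"
        using ip_le_nrm complex_Re_le_cmod order_trans by blast
      also have "\<dots> \<le> nrm x * (rep_norm (poly_star f * f) * nrm x)"
        by (intro mult_left_mono nrm_rep_le) simp
      also have "\<dots> = (sqrt (rep_norm (poly_star f * f)) * nrm x)\<^sup>2"
        by (simp add: power_mult_distrib rep_norm_nonneg power2_eq_square)
      finally show "nrm (rep f x) \<le> sqrt (rep_norm (poly_star f * f)) * nrm x"
        by (rule power2_le_imp_le) (simp add: rep_norm_nonneg)
    qed (simp add: rep_norm_nonneg)
    then have "(rep_norm f)\<^sup>2 \<le> (sqrt (rep_norm (poly_star f * f)))\<^sup>2"
      using rep_norm_nonneg by (intro power_mono)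
    then show ?thesis by (simp add: rep_norm_nonneg)
  qed
  have star: "rep_norm f \<le> rep_norm (poly_star f)" for f
    using sq[of f] mult[of "poly_star f" f] rep_norm_nonneg[of f] rep_norm_nonneg[of "poly_star f"]
    by (cases "rep_norm f = 0") (auto simp: power2_eq_square dest: order_trans)
  have "rep_norm (poly_star f * f) \<le> (rep_norm f)\<^sup>2"
    using mult[of "poly_star f" f] star[of "poly_star f"] rep_norm_nonneg[of f]
    by (simp add: power2_eq_square) (meson mult_right_mono order_trans)
  then show "rep_norm (poly_star f * f) = (rep_norm f)\<^sup>2" using sq[of f] by simp
qed

lemma vanishes_on_relations_rep_norm:
  assumes "\<omega> = exp (\<i> * of_real \<gamma>)"
  shows "vanishes_on_relations \<gamma> rep_norm"
proof -
  have null: "rep_norm f = 0" if "\<And>x y. ip y (rep f x) = 0" for f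
  proof (rule antisym[OF rep_norm_least rep_norm_nonneg])
    show "nrm (rep f x) \<le> 0 * nrm x" for x using that by (simp add: nrm_def)
  qed simp
  have inv: "ip y (act s (act r x)) = ip y x" if rs: "s = (r + 2) mod 4" "r < 4" for r s x y
  proof -
    consider "r = 0" | "r = 1" | "r = 2" | "r = 3" using rs(2) by linarith
    then show ?thesis
    proof cases
      case 1
      then have "s = 0 + 2" using rs(1) by simp
      then show ?thesis using act_inv[of y 0 x] 1 by metis
    next
      case 2
      then have "s = 1 + 2" using rs(1) by simp
      then show ?thesis using act_inv[of y 1 x] 2 by metis
    next
      case 3
      then have "s = 0" using rs(1) by simp
      then show ?thesis using act_inv[of y 2 x] act_period[of 0] 3 by simp
    next
      case 4
      then have "s = 1" using rs(1) by simp
      then show ?thesis using act_inv[of y 3 x] act_period[of 1] 4 by simp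
    qed
  qed
  show ?thesis
    unfolding vanishes_on_relations_def
    by (intro conjI null)
      (simp_all add: rep_diff rep_mult rep_gen rep_one rep_smult ip_diff_right ip_scale_right inv
        act_commute[of _ 0, simplified] assms)
qed

text \<open>Each representation provides one of the seminorms in the supremum, so its expectations
  bound the universal norm from below.\<close>

lemma hop_le_universal_seminorm:
  assumes "\<omega> = exp (\<i> * of_real \<gamma>)"
  shows "Re (ip x (hop x)) \<le> universal_seminorm \<gamma> harper * (nrm x)\<^sup>2"
proof -
  have "Re (ip x (hop x)) \<le> nrm x * nrm (rep harper x)"
    using ip_le_nrm[of x "hop x"] complex_Re_le_cmod[of "ip x (hop x)"] by (simp add: rep_harper)
  also have "\<dots> \<le> nrm x * (universal_seminorm \<gamma> harper * nrm x)"
  proof (rule mult_left_mono)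
    have "rep_norm harper \<le> universal_seminorm \<gamma> harper"
      by (rule universal_seminorm_upper[OF cstar_seminorm_rep_norm vanishes_on_relations_rep_norm[OF assms]])
    then show "nrm (rep harper x) \<le> universal_seminorm \<gamma> harper * nrm x"
      using nrm_rep_le[of harper x] by (meson mult_right_mono nrm_nonneg order_trans)
  qed simp
  finally show ?thesis by (simp add: power2_eq_square mult_ac)
qed

end

section \<open>The regular representation on the lattice\<close>

definition pm_scale :: "complex \<Rightarrow> ('i \<Rightarrow>\<^sub>0 complex) \<Rightarrow> 'i \<Rightarrow>\<^sub>0 complex"
  where "pm_scale a x = Poly_Mapping.map ((*) a) x"

text \<open>The completion to l^2 is never formed; all suprema are taken over finitely supported
  vectors.\<close>

definition pm_inner :: "('i \<Rightarrow>\<^sub>0 complex) \<Rightarrow> ('i \<Rightarrow>\<^sub>0 complex) \<Rightarrow> complex"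
  where "pm_inner x y = (\<Sum>i\<in>Poly_Mapping.keys x. cnj (Poly_Mapping.lookup x i) * Poly_Mapping.lookup y i)"

lemma lookup_pm_scale [simp]: "Poly_Mapping.lookup (pm_scale a x) i = a * Poly_Mapping.lookup x i"
  by (simp add: pm_scale_def Poly_Mapping.map.rep_eq when_def)

lemma pm_scale_single [simp]: "pm_scale a (Poly_Mapping.single i b) = Poly_Mapping.single i (a * b)"
  by (rule poly_mapping_eqI) (simp add: lookup_single when_def)

lemma pm_inner_superset:
  assumes "finite S" "Poly_Mapping.keys x \<subseteq> S \<or> Poly_Mapping.keys y \<subseteq> S"
  shows "pm_inner x y = (\<Sum>i\<in>S. cnj (Poly_Mapping.lookup x i) * Poly_Mapping.lookup y i)"
proof -
  let ?f = "\<lambda>i. cnj (Poly_Mapping.lookup x i) * Poly_Mapping.lookup y i"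
  have "sum ?f (Poly_Mapping.keys x) = sum ?f (Poly_Mapping.keys x \<inter> Poly_Mapping.keys y)"
    by (rule sum.mono_neutral_right) (auto simp: in_keys_iff)
  also have "\<dots> = sum ?f S"
    by (rule sum.mono_neutral_left) (use assms in \<open>auto simp: in_keys_iff\<close>)
  finally show ?thesis by (simp add: pm_inner_def)
qed

lemma pm_semi_inner: "semi_inner pm_scale (pm_inner :: ('i \<Rightarrow>\<^sub>0 complex) \<Rightarrow> _)"
proof
  fix a b :: complex and x y z :: "'i \<Rightarrow>\<^sub>0 complex"
  show "pm_scale a (x + y) = pm_scale a x + pm_scale a y" "pm_scale (a + b) x = pm_scale a x + pm_scale b x"
    "pm_scale a (pm_scale b x) = pm_scale (a * b) x" "pm_scale 1 x = x"
    by (auto intro!: poly_mapping_eqI simp: lookup_add algebra_simps)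
  show "pm_inner x (y + z) = pm_inner x y + pm_inner x z"
    by (simp add: pm_inner_def lookup_add distrib_left sum.distrib)
  show "pm_inner x (pm_scale a y) = a * pm_inner x y"
    by (simp add: pm_inner_def sum_distrib_left mult.left_commute)
  show "pm_inner y x = cnj (pm_inner x y)"
    by (subst pm_inner_superset[of "Poly_Mapping.keys x"]) (auto simp: pm_inner_def mult.commute)
  show "0 \<le> Re (pm_inner x x)"
    by (simp add: pm_inner_def sum_nonneg)
qed

definition weighted_shift :: "('i \<Rightarrow> complex) \<Rightarrow> ('i \<Rightarrow> 'i) \<Rightarrow> ('i \<Rightarrow>\<^sub>0 complex) \<Rightarrow> 'i \<Rightarrow>\<^sub>0 complex"
  where "weighted_shift c \<sigma> x = Abs_poly_mapping (\<lambda>i. c i * Poly_Mapping.lookup x (\<sigma> i))"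

lemma lookup_weighted_shift:
  assumes "inj \<sigma>"
  shows "Poly_Mapping.lookup (weighted_shift c \<sigma> x) i = c i * Poly_Mapping.lookup x (\<sigma> i)"
proof -
  have "{i. c i * Poly_Mapping.lookup x (\<sigma> i) \<noteq> 0} \<subseteq> \<sigma> -` Poly_Mapping.keys x"
    by (auto simp: in_keys_iff)
  then have "finite {i. c i * Poly_Mapping.lookup x (\<sigma> i) \<noteq> 0}"
    by (rule finite_subset) (simp add: finite_vimageI assms)
  then show ?thesis by (simp add: weighted_shift_def)
qed

text \<open>Operators that permute the standard basis up to phases. Since they compose a function
  with \<open>\<sigma> r\<close>, the basis vector at \<open>i\<close> moves to
  \<open>\<sigma> (r + 2) i\<close>. Besides the lattice, the sum of its copies twisted by the
  automorphism is of this kind.\<close>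

locale phase_perm =
  fixes \<sigma> :: "nat \<Rightarrow> 'i \<Rightarrow> 'i" and c :: "nat \<Rightarrow> 'i \<Rightarrow> complex" and \<omega> :: complex
  assumes \<sigma>_inv: "\<sigma> (r + 2) (\<sigma> r i) = i"
    and c_inv: "c (r + 2) i * c r (\<sigma> (r + 2) i) = 1"
    and c_unit: "cmod (c r i) = 1"
    and \<sigma>_commute: "\<sigma> r (\<sigma> (Suc r) i) = \<sigma> (Suc r) (\<sigma> r i)"
    and c_commute: "c (Suc r) i * c r (\<sigma> (Suc r) i) = \<omega> * (c r i * c (Suc r) (\<sigma> r i))"
    and period: "\<sigma> (r + 4) = \<sigma> r" "c (r + 4) = c r"
begin

lemma period': "\<sigma> (r + 2 + 2) = \<sigma> r" "c (r + 2 + 2) = c r"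
proof -
  have "r + 2 + 2 = r + 4" by simp
  then show "\<sigma> (r + 2 + 2) = \<sigma> r" "c (r + 2 + 2) = c r" using period[of r] by metis+
qed

lemma \<sigma>_inv': "\<sigma> r (\<sigma> (r + 2) i) = i"
  using \<sigma>_inv[of "r + 2" i] by (simp only: period')

lemma inj_\<sigma>: "inj (\<sigma> r)"
  by (metis \<sigma>_inv injI)

definition shift_act :: "nat \<Rightarrow> ('i \<Rightarrow>\<^sub>0 complex) \<Rightarrow> 'i \<Rightarrow>\<^sub>0 complex"
  where "shift_act r = weighted_shift (c r) (\<sigma> r)"

lemma lookup_shift_act: "Poly_Mapping.lookup (shift_act r x) i = c r i * Poly_Mapping.lookup x (\<sigma> r i)"
  by (simp add: shift_act_def lookup_weighted_shift[OF inj_\<sigma>])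

lemma keys_shift_act: "Poly_Mapping.keys (shift_act r x) = \<sigma> (r + 2) ` Poly_Mapping.keys x"
proof (intro equalityI subsetI)
  fix i assume "i \<in> Poly_Mapping.keys (shift_act r x)"
  then have "\<sigma> r i \<in> Poly_Mapping.keys x" by (auto simp: in_keys_iff lookup_shift_act)
  then show "i \<in> \<sigma> (r + 2) ` Poly_Mapping.keys x"
    by (intro image_eqI[of _ _ "\<sigma> r i"]) (simp_all only: \<sigma>_inv)
next
  fix i assume "i \<in> \<sigma> (r + 2) ` Poly_Mapping.keys x"
  then have "\<sigma> r i \<in> Poly_Mapping.keys x" by (auto simp only: \<sigma>_inv')
  moreover have "c r i \<noteq> 0" using c_unit[of r i] by auto
  ultimately show "i \<in> Poly_Mapping.keys (shift_act r x)"
    by (simp add: in_keys_iff lookup_shift_act)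
qed

lemma c_adj: "c (r + 2) (\<sigma> r i) = cnj (c r i)"
proof -
  have "c r i * c (r + 2) (\<sigma> r i) = 1"
    using c_inv[of "r + 2" i] by (simp only: period')
  moreover have "c r i * cnj (c r i) = 1"
    using complex_norm_square[of "c r i"] c_unit[of r i] by simp
  moreover have "c r i \<noteq> 0" using c_unit[of r i] by auto
  ultimately show ?thesis by (metis mult_cancel_left)
qed

lemma shift_act_single: "shift_act r (Poly_Mapping.single i a)
    = Poly_Mapping.single (\<sigma> (r + 2) i) (c r (\<sigma> (r + 2) i) * a)"
proof (rule poly_mapping_eqI)
  fix j
  have "\<sigma> r j = i \<longleftrightarrow> \<sigma> (r + 2) i = j" using \<sigma>_inv \<sigma>_inv' by metis
  then show "Poly_Mapping.lookup (shift_act r (Poly_Mapping.single i a)) j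
      = Poly_Mapping.lookup (Poly_Mapping.single (\<sigma> (r + 2) i) (c r (\<sigma> (r + 2) i) * a)) j"
    by (auto simp: lookup_shift_act lookup_single when_def simp del: add_2_eq_Suc')
qed

sublocale phase_rep pm_scale pm_inner shift_act \<omega>
proof (intro phase_rep.intro pm_semi_inner phase_rep_axioms.intro)
  fix r a and x y :: "'i \<Rightarrow>\<^sub>0 complex"
  show "shift_act r (x + y) = shift_act r x + shift_act r y" "shift_act r (pm_scale a x) = pm_scale a (shift_act r x)"
    by (auto intro!: poly_mapping_eqI simp: lookup_shift_act lookup_add algebra_simps)
  have "shift_act (r + 2) (shift_act r x) = x"
  proof (rule poly_mapping_eqI)
    fix i
    have "Poly_Mapping.lookup (shift_act (r + 2) (shift_act r x)) i
        = (c (r + 2) i * c r (\<sigma> (r + 2) i)) * Poly_Mapping.lookup x (\<sigma> r (\<sigma> (r + 2) i))"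
      by (simp only: lookup_shift_act mult.assoc)
    then show "Poly_Mapping.lookup (shift_act (r + 2) (shift_act r x)) i = Poly_Mapping.lookup x i"
      by (simp only: c_inv \<sigma>_inv' mult_1_left)
  qed
  then show "pm_inner y (shift_act (r + 2) (shift_act r x)) = pm_inner y x" by simp
  have "shift_act (Suc r) (shift_act r x) = pm_scale \<omega> (shift_act r (shift_act (Suc r) x))"
  proof (rule poly_mapping_eqI)
    fix i
    have "Poly_Mapping.lookup (shift_act (Suc r) (shift_act r x)) i
        = (c (Suc r) i * c r (\<sigma> (Suc r) i)) * Poly_Mapping.lookup x (\<sigma> r (\<sigma> (Suc r) i))"
      by (simp only: lookup_shift_act mult.assoc)
    then show "Poly_Mapping.lookup (shift_act (Suc r) (shift_act r x)) i
        = Poly_Mapping.lookup (pm_scale \<omega> (shift_act r (shift_act (Suc r) x))) i"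
      by (simp only: c_commute \<sigma>_commute lookup_pm_scale lookup_shift_act mult.assoc)
  qed
  then show "pm_inner y (shift_act (Suc r) (shift_act r x)) = \<omega> * pm_inner y (shift_act r (shift_act (Suc r) x))"
    by (simp add: semi_inner.ip_scale_right[OF pm_semi_inner])
  show "pm_inner (shift_act r x) y = pm_inner x (shift_act (r + 2) y)"
    unfolding pm_inner_def keys_shift_act
  proof (rule sum.reindex_bij_witness[where i = "\<sigma> (r + 2)" and j = "\<sigma> r"])
    fix i
    have "c (r + 2) (\<sigma> r i) * Poly_Mapping.lookup y (\<sigma> (r + 2) (\<sigma> r i)) = cnj (c r i) * Poly_Mapping.lookup y i"
      by (simp only: c_adj \<sigma>_inv)
    then show "cnj (Poly_Mapping.lookup x (\<sigma> r i)) * Poly_Mapping.lookup (shift_act (r + 2) y) (\<sigma> r i)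
        = cnj (Poly_Mapping.lookup (shift_act r x) i) * Poly_Mapping.lookup y i"
      by (simp only: lookup_shift_act complex_cnj_mult mult_ac)
  qed (use \<sigma>_inv \<sigma>_inv' in auto)
  show "shift_act (r + 4) = shift_act r" by (simp add: shift_act_def period)
qed

end

definition lattice_shift :: "nat \<Rightarrow> int \<times> int \<Rightarrow> int \<times> int"
  where "lattice_shift r g =
    (if r mod 4 = 0 then (fst g - 1, snd g) else if r mod 4 = 1 then (fst g, snd g - 1)
     else if r mod 4 = 2 then (fst g + 1, snd g) else (fst g, snd g + 1))"

text \<open>Left multiplication in the basis u^a v^b: moving v past u^a gives v u^a v^b = e^(\<i>
  \<gamma> a) u^a v^(b+1). As v fixes the first coordinate, the phase may be read at the source or
  at the target.\<close>

definition lattice_phase :: "real \<Rightarrow> nat \<Rightarrow> int \<times> int \<Rightarrow> complex"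
  where "lattice_phase \<gamma> r g =
    (if r mod 4 = 1 then cis (\<gamma> * of_int (fst g)) else if r mod 4 = 3 then cis (- (\<gamma> * of_int (fst g))) else 1)"

lemma phase_perm_lattice: "phase_perm lattice_shift (lattice_phase \<gamma>) (cis \<gamma>)"
proof
  fix r :: nat and g :: "int \<times> int"
  have s: "Suc r mod 4 = (r mod 4 + 1) mod 4" "(r + 2) mod 4 = (r mod 4 + 2) mod 4"
    by (simp_all add: mod_simps)
  have r4: "r mod 4 = 0 \<or> r mod 4 = 1 \<or> r mod 4 = 2 \<or> r mod 4 = 3" by linarith
  show "lattice_shift (r + 2) (lattice_shift r g) = g"
    using r4 by (auto simp: lattice_shift_def s simp del: add_2_eq_Suc')
  show "lattice_phase \<gamma> (r + 2) g * lattice_phase \<gamma> r (lattice_shift (r + 2) g) = 1"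
    using r4 by (auto simp: lattice_shift_def lattice_phase_def s cis_mult simp del: add_2_eq_Suc')
  show "cmod (lattice_phase \<gamma> r g) = 1"
    by (simp add: lattice_phase_def)
  show "lattice_shift r (lattice_shift (Suc r) g) = lattice_shift (Suc r) (lattice_shift r g)"
    using r4 by (auto simp: lattice_shift_def s)
  show "lattice_phase \<gamma> (Suc r) g * lattice_phase \<gamma> r (lattice_shift (Suc r) g)
      = cis \<gamma> * (lattice_phase \<gamma> r g * lattice_phase \<gamma> (Suc r) (lattice_shift r g))"
    using r4 by (auto simp: lattice_shift_def lattice_phase_def s cis_mult algebra_simps)
qed (simp_all add: lattice_shift_def lattice_phase_def fun_eq_iff)

section \<open>Norm and quadratic form of a selfadjoint element\<close>

context phase_rep
begin

lemma hop_add: "hop (x + y) = hop x + hop y"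
  by (simp add: hop_def act_add sum.distrib)

lemma hop_scale: "hop (a *s x) = a *s hop x"
  by (simp add: hop_def act_scale scale_sum_right)

lemma hop_uminus: "hop (- x) = - hop x"
  using hop_scale[of "-1" x] by simp

lemma poly_star_harper: "poly_star harper = harper"
  by (simp add: harper_def poly_star_add poly_star_gen ac_simps)

lemma ip_hop: "ip (hop x) y = ip x (hop y)"
  using rep_star[of harper x y] by (simp add: poly_star_harper rep_harper)

text \<open>For a selfadjoint operator the numerical radius bounds the norm: polarize \<langle>y, h
  x\<rangle> and apply the parallelogram law.\<close>

lemma nrm_hop_le:
  assumes "\<And>x. \<bar>Re (ip x (hop x))\<bar> \<le> \<mu> * (nrm x)\<^sup>2"
  shows "nrm (hop x) \<le> \<mu> * nrm x"
proof (cases "nrm x = 0 \<or> nrm (hop x) = 0")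
  case True
  have "nrm (hop x) = 0"
    using True nrm_rep_le[of harper x] by (auto simp: rep_harper intro: antisym)
  moreover have "0 \<le> \<mu> * nrm x"
  proof (cases "nrm x = 0")
    case False
    have "0 \<le> \<mu> * nrm x * nrm x" using assms[of x] by (simp add: power2_eq_square)
    then show ?thesis using False nrm_nonneg[of x] by (simp add: zero_le_mult_iff)
  qed simp
  ultimately show ?thesis by simp
next
  case False
  then have pos: "0 < nrm x" "0 < nrm (hop x)" using nrm_nonneg[of x] nrm_nonneg[of "hop x"] by linarith+
  \<comment> \<open>The multiple y of h x has the norm of x, for which the polarization estimate is
    sharp.\<close>
  define t where "t = nrm x / nrm (hop x)"
  define y where "y = of_real t *s hop x"
  have ny: "nrm y = nrm x" using pos by (simp add: y_def t_def nrm_scale norm_divide)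
  have xy: "Re (ip x (hop y)) = Re (ip y (hop x))"
    using ip_cnj[of x "hop y"] by (simp add: ip_hop)
  have "4 * Re (ip y (hop x)) = Re (ip (x + y) (hop (x + y))) - Re (ip (x + - y) (hop (x + - y)))"
    by (simp only: hop_add hop_uminus ip_add_left ip_add_right ip_minus_left ip_minus_right) (simp add: xy)
  also have "\<dots> \<le> \<mu> * (nrm (x + y))\<^sup>2 + \<mu> * (nrm (x + - y))\<^sup>2"
    using assms[of "x + y"] assms[of "x + - y"] by (simp add: abs_le_iff)
  also have "\<dots> = \<mu> * (2 * (nrm x)\<^sup>2 + 2 * (nrm y)\<^sup>2)"
    by (simp only: nrm_sq ip_add_left ip_add_right ip_minus_left ip_minus_right) (simp add: algebra_simps)
  finally have "Re (ip y (hop x)) \<le> \<mu> * (nrm x)\<^sup>2" by (simp add: ny)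
  moreover have "Re (ip y (hop x)) = nrm x * nrm (hop x)"
    using pos by (simp add: y_def ip_scale_left ip_self t_def power2_eq_square flip: of_real_mult)
  ultimately show ?thesis using pos by (simp add: power2_eq_square)
qed

end

abbreviation "origin \<equiv> Poly_Mapping.single (0, 0) (1 :: complex) :: int \<times> int \<Rightarrow>\<^sub>0 complex"

section \<open>Normal forms and comparison with the lattice\<close>

context relation_seminorm
begin

lemma commute_inverse:
  assumes zx: "z * x \<asymp> poly_smult \<alpha> (x * z)" and xy: "x * y \<asymp> 1" and yx: "y * x \<asymp> 1" and \<alpha>: "\<alpha> \<noteq> 0"
  shows "z * y \<asymp> poly_smult (1 / \<alpha>) (y * z)"
proof -
  have "y * z \<asymp> y * z * (x * y)"
    using equivalent_mult_left[OF equivalent_sym[OF xy], of "y * z"] by simp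
  also have "y * z * (x * y) = y * (z * x) * y" by (simp add: mult.assoc)
  also have "\<dots> \<asymp> y * poly_smult \<alpha> (x * z) * y"
    by (intro equivalent_mult_left equivalent_mult_right zx)
  also have "y * poly_smult \<alpha> (x * z) * y = poly_smult \<alpha> ((y * x) * (z * y))"
    by (simp add: poly_smult_simps mult.assoc)
  also have "\<dots> \<asymp> poly_smult \<alpha> (1 * (z * y))"
    by (intro equivalent_smult equivalent_mult_right yx)
  finally have "poly_smult (1 / \<alpha>) (y * z) \<asymp> poly_smult (1 / \<alpha>) (poly_smult \<alpha> (z * y))"
    by (intro equivalent_smult) simp
  then show ?thesis using \<alpha> by (simp add: poly_smult_simps equivalent_sym)
qed

lemma commute_swap:
  assumes zx: "z * x \<asymp> poly_smult \<alpha> (x * z)" and \<alpha>: "\<alpha> \<noteq> 0"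
  shows "x * z \<asymp> poly_smult (1 / \<alpha>) (z * x)"
  using equivalent_smult[OF equivalent_sym[OF zx], of "1 / \<alpha>"] \<alpha> by (simp add: poly_smult_simps)

lemma commute_power:
  assumes "z * x \<asymp> poly_smult \<alpha> (x * z)"
  shows "z * x ^ n \<asymp> poly_smult (\<alpha> ^ n) (x ^ n * z)"
proof (induction n)
  case 0
  then show ?case by (simp add: poly_smult_simps)
next
  case (Suc n)
  have "z * x ^ Suc n = (z * x) * x ^ n" by (simp add: mult.assoc)
  also have "\<dots> \<asymp> poly_smult \<alpha> (x * z) * x ^ n" by (rule equivalent_mult_right[OF assms])
  also have "poly_smult \<alpha> (x * z) * x ^ n = poly_smult \<alpha> (x * (z * x ^ n))"
    by (simp add: poly_smult_simps mult.assoc)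
  also have "\<dots> \<asymp> poly_smult \<alpha> (x * poly_smult (\<alpha> ^ n) (x ^ n * z))"
    by (intro equivalent_smult equivalent_mult_left Suc.IH)
  also have "\<dots> = poly_smult (\<alpha> ^ Suc n) (x ^ Suc n * z)"
    by (simp add: poly_smult_simps mult.assoc)
  finally show ?case .
qed

text \<open>\<open>y\<close> stands for the inverse of \<open>x\<close> modulo the null
  ideal.\<close>

definition int_power :: "star_poly \<Rightarrow> star_poly \<Rightarrow> int \<Rightarrow> star_poly"
  where "int_power x y a = (if 0 \<le> a then x ^ nat a else y ^ nat (- a))"

lemma int_power_succ:
  assumes "x * y \<asymp> 1"
  shows "x * int_power x y a \<asymp> int_power x y (a + 1)"
proof (cases "0 \<le> a")
  case True
  then have "nat (a + 1) = Suc (nat a)" by linarith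
  then show ?thesis using True by (simp add: int_power_def)
next
  case False
  then obtain k where k: "nat (- a) = Suc k" by (cases "nat (- a)") auto
  then have k': "nat (- (a + 1)) = k" "a + 1 = 0 \<Longrightarrow> k = 0" by linarith+
  have "x * y ^ Suc k = (x * y) * y ^ k" by (simp add: mult.assoc)
  also have "\<dots> \<asymp> 1 * y ^ k" by (rule equivalent_mult_right[OF assms])
  also have "1 * y ^ k = int_power x y (a + 1)"
    using False k' by (auto simp: int_power_def)
  finally show ?thesis using False k by (simp add: int_power_def)
qed

lemma int_power_pred:
  assumes "y * x \<asymp> 1"
  shows "y * int_power x y a \<asymp> int_power x y (a - 1)"
proof -
  have "int_power x y b = int_power y x (- b)" for b by (cases "b = 0") (auto simp: int_power_def)
  then show ?thesis using int_power_succ[OF assms, of "- a"] by (simp add: algebra_simps)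
qed

lemma int_power_commute:
  assumes "z * x \<asymp> poly_smult (cis t) (x * z)" "x * y \<asymp> 1" "y * x \<asymp> 1"
  shows "z * int_power x y a \<asymp> poly_smult (cis (t * of_int a)) (int_power x y a * z)"
proof (cases "0 \<le> a")
  case True
  have "cis t ^ nat a = cis (t * of_int a)" using True by (simp add: Complex.DeMoivre mult.commute)
  then show ?thesis using commute_power[OF assms(1), of "nat a"] True by (simp add: int_power_def)
next
  case False
  have "1 / cis t = cis (- t)" by (simp add: divide_inverse)
  then have "z * y \<asymp> poly_smult (cis (- t)) (y * z)"
    using commute_inverse[OF assms] by (metis cis_neq_zero)
  moreover have "cis (- t) ^ nat (- a) = cis (t * of_int a)"
    using False by (simp add: Complex.DeMoivre mult.commute)
  ultimately show ?thesis
    using commute_power[of z y "cis (- t)" "nat (- a)"] False by (simp add: int_power_def)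
qed

lemma p_power_gen: "p (gen l ^ n) \<le> 1"
proof (induction n)
  case (Suc n)
  have "p (gen l * gen l ^ n) \<le> p (gen l) * p (gen l ^ n)" by (rule p_mult)
  also have "\<dots> \<le> 1 * 1" using p_gen Suc by (intro mult_mono) auto
  finally show ?case by simp
qed (simp add: p_one)

abbreviation "upow \<equiv> int_power (gen letter.U) (gen letter.U')"
abbreviation "vpow \<equiv> int_power (gen letter.V) (gen letter.V')"

lemma gen_inverses:
  "gen letter.U * gen letter.U' \<asymp> 1" "gen letter.U' * gen letter.U \<asymp> 1"
  "gen letter.V * gen letter.V' \<asymp> 1" "gen letter.V' * gen letter.V \<asymp> 1"
  using gen_unitary[of letter.U'] gen_unitary[of letter.U] gen_unitary[of letter.V'] gen_unitary[of letter.V]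
  by simp_all

lemma gen_commute:
  "gen letter.V * gen letter.U \<asymp> poly_smult (cis \<gamma>) (gen letter.U * gen letter.V)"
  "gen letter.V' * gen letter.U \<asymp> poly_smult (cis (- \<gamma>)) (gen letter.U * gen letter.V')"
proof -
  show VU: "gen letter.V * gen letter.U \<asymp> poly_smult (cis \<gamma>) (gen letter.U * gen letter.V)"
    using relations by (simp add: vanishes_on_relations_def equivalent_def cis_conv_exp)
  have "gen letter.U * gen letter.V \<asymp> poly_smult (1 / cis \<gamma>) (gen letter.V * gen letter.U)"
    by (rule commute_swap[OF VU]) simp
  from commute_inverse[OF this gen_inverses(3,4)]
  have "gen letter.U * gen letter.V' \<asymp> poly_smult (cis \<gamma>) (gen letter.V' * gen letter.U)" by simp
  from commute_swap[OF this]
  show "gen letter.V' * gen letter.U \<asymp> poly_smult (cis (- \<gamma>)) (gen letter.U * gen letter.V')"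
    by (simp add: divide_inverse)
qed

definition monomial :: "int \<times> int \<Rightarrow> star_poly"
  where "monomial g = upow (fst g) * vpow (snd g)"

lemma p_monomial: "p (monomial g) \<le> 1"
proof -
  have "p (monomial g) \<le> p (upow (fst g)) * p (vpow (snd g))"
    unfolding monomial_def by (rule p_mult)
  also have "\<dots> \<le> 1 * 1"
    by (intro mult_mono) (auto simp: int_power_def p_power_gen)
  finally show ?thesis by simp
qed

interpretation lat: phase_perm lattice_shift "lattice_phase \<gamma>" "cis \<gamma>"
  by (rule phase_perm_lattice)

text \<open>For every admissible seminorm, left multiplication of the monomials follows the rule of
  the lattice representation. This is what makes that representation decisive for the universal
  norm.\<close>

lemma gen_monomial:
  "gen l * monomial g \<asymp> poly_smult (lattice_phase \<gamma> (letter_index l) (lattice_shift (letter_index l + 2) g))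
    (monomial (lattice_shift (letter_index l + 2) g))"
proof (cases l)
  case U
  have "(gen letter.U * upow (fst g)) * vpow (snd g) \<asymp> upow (fst g + 1) * vpow (snd g)"
    by (intro equivalent_mult_right int_power_succ gen_inverses)
  then show ?thesis using U
    by (simp add: monomial_def lattice_phase_def lattice_shift_def poly_smult_simps mult.assoc)
next
  case U'
  have "(gen letter.U' * upow (fst g)) * vpow (snd g) \<asymp> upow (fst g - 1) * vpow (snd g)"
    by (intro equivalent_mult_right int_power_pred gen_inverses)
  then show ?thesis using U'
    by (simp add: monomial_def lattice_phase_def lattice_shift_def poly_smult_simps mult.assoc)
next
  case V
  have "(gen letter.V * upow (fst g)) * vpow (snd g)
      \<asymp> poly_smult (cis (\<gamma> * of_int (fst g))) (upow (fst g) * gen letter.V) * vpow (snd g)"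
    by (intro equivalent_mult_right int_power_commute gen_inverses gen_commute)
  also have "\<dots> = poly_smult (cis (\<gamma> * of_int (fst g))) (upow (fst g) * (gen letter.V * vpow (snd g)))"
    by (simp add: poly_smult_simps mult.assoc)
  also have "\<dots> \<asymp> poly_smult (cis (\<gamma> * of_int (fst g))) (upow (fst g) * vpow (snd g + 1))"
    by (intro equivalent_smult equivalent_mult_left int_power_succ gen_inverses)
  finally show ?thesis using V
    by (simp add: monomial_def lattice_phase_def lattice_shift_def mult.assoc)
next
  case V'
  have "(gen letter.V' * upow (fst g)) * vpow (snd g)
      \<asymp> poly_smult (cis (- \<gamma> * of_int (fst g))) (upow (fst g) * gen letter.V') * vpow (snd g)"
    by (intro equivalent_mult_right int_power_commute gen_inverses gen_commute)
  also have "\<dots> = poly_smult (cis (- \<gamma> * of_int (fst g))) (upow (fst g) * (gen letter.V' * vpow (snd g)))"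
    by (simp add: poly_smult_simps mult.assoc)
  also have "\<dots> \<asymp> poly_smult (cis (- \<gamma> * of_int (fst g))) (upow (fst g) * vpow (snd g - 1))"
    by (intro equivalent_smult equivalent_mult_left int_power_pred gen_inverses)
  finally show ?thesis using V'
    by (simp add: monomial_def lattice_phase_def lattice_shift_def mult.assoc)
qed

definition normal_form :: "(int \<times> int \<Rightarrow>\<^sub>0 complex) \<Rightarrow> star_poly"
  where "normal_form x = (\<Sum>g\<in>Poly_Mapping.keys x. poly_smult (Poly_Mapping.lookup x g) (monomial g))"

lemma normal_form_add: "normal_form (x + y) = normal_form x + normal_form y"
  unfolding normal_form_def by (rule setsum_keys_plus_distrib) (simp_all add: poly_smult_simps)

lemma normal_form_single: "normal_form (Poly_Mapping.single g a) = poly_smult a (monomial g)"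
  by (simp add: normal_form_def poly_smult_simps)

lemma normal_form_scale: "normal_form (pm_scale a x) = poly_smult a (normal_form x)"
  by (induction x rule: poly_mapping_induct_add)
    (simp_all add: normal_form_single normal_form_add poly_smult_simps
      vector_space.vector_space_assms(1)[OF semi_inner.axioms(1)[OF pm_semi_inner]])

lemma gen_normal_form: "gen l * normal_form x \<asymp> normal_form (lat.shift_act (letter_index l) x)"
proof (induction x rule: poly_mapping_induct_add)
  case (single g a)
  have "gen l * poly_smult a (monomial g) = poly_smult a (gen l * monomial g)"
    by (simp add: poly_smult_simps)
  also note equivalent_smult[OF gen_monomial[of l g], of a]
  finally show ?case
    by (simp add: normal_form_single lat.shift_act_single poly_smult_simps mult.commute del: add_2_eq_Suc')
next
  case (add x y)
  then show ?case by (simp add: normal_form_add lat.act_add distrib_left equivalent_add)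
qed

text \<open>\<open>normal_form\<close> intertwines the lattice representation with left
  multiplication and sends the origin to 1. Hence the action on the origin determines a polynomial
  modulo the relations.\<close>

lemma equivalent_normal_form: "f \<asymp> normal_form (lat.rep f origin)"
proof (induction f rule: poly_mapping_induct_add)
  case (single w a)
  have "Poly_Mapping.single (Word ls) 1 \<asymp> normal_form (lat.word_act ls origin)" for ls
  proof (induction ls)
    case Nil
    have "Poly_Mapping.single (Word []) 1 = (1 :: star_poly)"
      by (simp add: zero_star_word_def[symmetric])
    then show ?case by (simp add: normal_form_single monomial_def int_power_def poly_smult_simps)
  next
    case (Cons l ls)
    have "gen l * Poly_Mapping.single (Word ls) 1 \<asymp> gen l * normal_form (lat.word_act ls origin)"
      by (rule equivalent_mult_left[OF Cons])
    also note gen_normal_form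
    finally show ?case by (simp add: single_Cons)
  qed
  from equivalent_smult[OF this, of a "letters w"] show ?case
    by (simp add: poly_smult_simps lat.rep_single normal_form_scale)
next
  case (add f g)
  then show ?case by (simp add: normal_form_add lat.rep_add equivalent_add)
qed

lemma p_sum_le: "p (\<Sum>i\<in>F. f i) \<le> (\<Sum>i\<in>F. p (f i))"
  by (induction F rule: infinite_finite_induct) (auto intro: order_trans[OF p_add])

lemma p_le_l1:
  "p f \<le> (\<Sum>g\<in>Poly_Mapping.keys (lat.rep f origin). cmod (Poly_Mapping.lookup (lat.rep f origin) g))"
proof -
  let ?x = "lat.rep f origin"
  have "p f = p (normal_form ?x)" by (rule equivalent_p[OF equivalent_normal_form])
  also have "\<dots> \<le> (\<Sum>g\<in>Poly_Mapping.keys ?x. p (poly_smult (Poly_Mapping.lookup ?x g) (monomial g)))"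
    unfolding normal_form_def by (rule p_sum_le)
  also have "\<dots> \<le> (\<Sum>g\<in>Poly_Mapping.keys ?x. cmod (Poly_Mapping.lookup ?x g))"
    by (intro sum_mono) (simp add: p_smult p_monomial mult_left_le)
  finally show ?thesis .
qed

lemma p_power_selfadjoint:
  assumes "poly_star f = f"
  shows "p (f ^ (2 ^ k)) = p f ^ (2 ^ k)"
proof (induction k)
  case (Suc k)
  have "poly_star (f ^ n) = f ^ n" for n
    by (induction n) (simp_all add: poly_star_one poly_star_mult assms power_commutes)
  then have "p (f ^ (2 ^ k) * f ^ (2 ^ k)) = (p (f ^ (2 ^ k)))\<^sup>2"
    using p_star_mult[of "f ^ (2 ^ k)"] by simp
  then show ?case using Suc by (simp add: power_add[symmetric] mult_2 power2_eq_square)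
qed simp

end

section \<open>Growth of the powers of the Harper element\<close>

context phase_rep
begin

lemma rep_harper_power: "rep (harper ^ m) x = (hop ^^ m) x"
  by (induction m) (simp_all add: rep_one rep_mult rep_harper)

end

context
  fixes \<gamma> :: real
begin

interpretation lat: phase_perm lattice_shift "lattice_phase \<gamma>" "cis \<gamma>"
  by (rule phase_perm_lattice)

lemma lookup_lattice_hop:
  "Poly_Mapping.lookup (lat.hop x) g = (\<Sum>r<4. lattice_phase \<gamma> r g * Poly_Mapping.lookup x (lattice_shift r g))"
  by (simp add: lat.hop_def lookup_sum lat.lookup_shift_act)

text \<open>The support of the m-th power lies in a box of (2 m + 1)^2 points; by Cauchy-Schwarz
  this costs only a factor 2 m + 1 between the l^1 and l^2 norms.\<close>

lemma keys_lattice_hop_power: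
  "Poly_Mapping.keys ((lat.hop ^^ m) origin) \<subseteq> {- int m..int m} \<times> {- int m..int m}"
proof (induction m)
  case (Suc m)
  show ?case
  proof
    fix g assume "g \<in> Poly_Mapping.keys ((lat.hop ^^ Suc m) origin)"
    then have "(\<Sum>r<4. lattice_phase \<gamma> r g * Poly_Mapping.lookup ((lat.hop ^^ m) origin) (lattice_shift r g)) \<noteq> 0"
      by (simp add: in_keys_iff lookup_lattice_hop)
    then obtain r where "Poly_Mapping.lookup ((lat.hop ^^ m) origin) (lattice_shift r g) \<noteq> 0"
      by (metis (no_types, lifting) mult_zero_right sum.neutral)
    then have "lattice_shift r g \<in> {- int m..int m} \<times> {- int m..int m}"
      using Suc by (auto simp: in_keys_iff)
    then show "g \<in> {- int (Suc m)..int (Suc m)} \<times> {- int (Suc m)..int (Suc m)}"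
      by (cases g) (auto simp: lattice_shift_def split: if_splits)
  qed
qed simp

text \<open>Implements the automorphism that changes the sign of u and v. It maps h to -h, so an
  upper bound of the quadratic form is automatically a bound of its absolute value.\<close>

definition flip_sign :: "int \<times> int \<Rightarrow> complex"
  where "flip_sign g = (if even (fst g + snd g) then 1 else - 1)"

definition flip :: "(int \<times> int \<Rightarrow>\<^sub>0 complex) \<Rightarrow> int \<times> int \<Rightarrow>\<^sub>0 complex"
  where "flip = weighted_shift flip_sign (\<lambda>g. g)"

lemma lookup_flip: "Poly_Mapping.lookup (flip x) g = flip_sign g * Poly_Mapping.lookup x g"
  unfolding flip_def by (subst lookup_weighted_shift) auto

lemma hop_flip: "lat.hop (flip x) = - flip (lat.hop x)"
proof (rule poly_mapping_eqI)
  fix g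
  have odd: "flip_sign (lattice_shift r g) = - flip_sign g" for r
    by (auto simp: lattice_shift_def flip_sign_def)
  show "Poly_Mapping.lookup (lat.hop (flip x)) g = Poly_Mapping.lookup (- flip (lat.hop x)) g"
    by (simp add: lookup_lattice_hop lookup_flip odd sum_negf sum_distrib_left mult.left_commute)
qed

lemma inner_flip: "pm_inner (flip x) (flip y) = pm_inner x y"
proof -
  have sign: "cnj (flip_sign g) * flip_sign g = 1" "flip_sign g \<noteq> 0" for g
    by (simp_all add: flip_sign_def)
  have "Poly_Mapping.keys (flip x) = Poly_Mapping.keys x"
    using sign(2) by (auto simp: in_keys_iff lookup_flip)
  moreover have "cnj (flip_sign g * a) * (flip_sign g * b) = cnj a * b" for g a b
  proof -
    have "cnj (flip_sign g * a) * (flip_sign g * b) = (cnj (flip_sign g) * flip_sign g) * (cnj a * b)"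
      by simp
    then show ?thesis by (simp only: sign(1) mult_1_left)
  qed
  ultimately show ?thesis by (simp only: pm_inner_def lookup_flip)
qed

text \<open>A bound \<open>\<mu>\<close> of the form gives (2 m + 1) \<mu>^m as a bound for the m-th
  power. Taking m-th roots along powers of two, where the C*-identity applies, removes the linear
  factor.\<close>

lemma universal_seminorm_harper_le:
  assumes bound: "\<And>x. Re (pm_inner x (lat.hop x)) \<le> \<mu> * Re (pm_inner x x)"
  shows "universal_seminorm \<gamma> harper \<le> \<mu>"
proof (rule universal_seminorm_least)
  fix p assume "cstar_seminorm p" "vanishes_on_relations \<gamma> p"
  then interpret relation_seminorm \<gamma> p by unfold_locales
  have "- Re (pm_inner x (lat.hop x)) \<le> \<mu> * Re (pm_inner x x)" for x
    using bound[of "flip x"] by (simp add: hop_flip lat.ip_minus_right inner_flip)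
  then have abs: "\<bar>Re (pm_inner x (lat.hop x))\<bar> \<le> \<mu> * (lat.nrm x)\<^sup>2" for x
    using bound[of x] by (simp add: abs_le_iff lat.nrm_sq minus_le_iff)
  have nrm_origin: "lat.nrm origin = 1"
    by (simp add: lat.nrm_def pm_inner_def)
  have \<mu>: "0 \<le> \<mu>"
    using abs[of origin] by (simp add: nrm_origin)
  have nrm_power: "lat.nrm ((lat.hop ^^ m) origin) \<le> \<mu> ^ m" for m
  proof (induction m)
    case (Suc m)
    have "lat.nrm (lat.hop ((lat.hop ^^ m) origin)) \<le> \<mu> * lat.nrm ((lat.hop ^^ m) origin)"
      by (rule lat.nrm_hop_le[OF abs])
    also have "\<dots> \<le> \<mu> * \<mu> ^ m" using Suc \<mu> by (intro mult_left_mono)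
    finally show ?case by simp
  qed (simp add: nrm_origin)
  have growth: "p (harper ^ m) \<le> (2 * real m + 1) * \<mu> ^ m" for m
  proof -
    define x where "x = (lat.hop ^^ m) origin"
    let ?K = "Poly_Mapping.keys x" and ?B = "{- int m..int m} \<times> {- int m..int m}"
    have sub: "?K \<subseteq> ?B" unfolding x_def by (rule keys_lattice_hop_power)
    have "card ?K \<le> card ?B" by (rule card_mono[OF _ sub]) simp
    also have "card ?B = (2 * m + 1)\<^sup>2"
      by (simp add: card_cartesian_product power2_eq_square nat_add_distrib nat_mult_distrib algebra_simps)
    finally have card: "real (card ?K) \<le> (2 * real m + 1)\<^sup>2"
      by (metis (mono_tags, lifting) of_nat_1 of_nat_add of_nat_le_iff of_nat_mult of_nat_numeral of_nat_power)
    have "Re (pm_inner x x) = (\<Sum>g\<in>?K. (cmod (Poly_Mapping.lookup x g))\<^sup>2)"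
      unfolding pm_inner_def by (simp add: cmod_power2 flip: power2_eq_square)
    then have nrm: "(\<Sum>g\<in>?K. (cmod (Poly_Mapping.lookup x g))\<^sup>2) = (lat.nrm x)\<^sup>2"
      by (simp add: lat.nrm_sq)
    have "p (harper ^ m) \<le> (\<Sum>g\<in>?K. cmod (Poly_Mapping.lookup x g))"
      using p_le_l1[of "harper ^ m"] by (simp add: x_def lat.rep_harper_power)
    moreover have "(\<Sum>g\<in>?K. cmod (Poly_Mapping.lookup x g))\<^sup>2 \<le> ((2 * real m + 1) * \<mu> ^ m)\<^sup>2"
    proof -
      have "(\<Sum>g\<in>?K. cmod (Poly_Mapping.lookup x g))\<^sup>2 \<le> (lat.nrm x)\<^sup>2 * real (card ?K)"
        using sum_squared_le_sum_of_squares[of "\<lambda>g. cmod (Poly_Mapping.lookup x g)" ?K] nrm by simp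
      also have "\<dots> \<le> (\<mu> ^ m)\<^sup>2 * (2 * real m + 1)\<^sup>2"
        using nrm_power[of m] card by (intro mult_mono power_mono) (simp_all add: x_def)
      finally show ?thesis by (simp add: power_mult_distrib mult.commute)
    qed
    then have "(\<Sum>g\<in>?K. cmod (Poly_Mapping.lookup x g)) \<le> (2 * real m + 1) * \<mu> ^ m"
      by (rule power2_le_imp_le) (simp add: \<mu>)
    ultimately show ?thesis by linarith
  qed
  have pow: "p harper ^ (2 ^ k) \<le> (2 * real (2 ^ k) + 1) * \<mu> ^ (2 ^ k)" for k
    using growth[of "2 ^ k"] p_power_selfadjoint[OF lat.poly_star_harper, of k] by simp
  show "p harper \<le> \<mu>"
  proof (rule ccontr)
    assume "\<not> p harper \<le> \<mu>"
    then have lt: "\<mu> < p harper" by simp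
    have "\<mu> \<noteq> 0" using pow[of 0] lt by auto
    with \<mu> have \<mu>0: "0 < \<mu>" by simp
    define \<rho> where "\<rho> = p harper / \<mu>"
    have \<rho>: "1 < \<rho>" using lt \<mu>0 by (simp add: \<rho>_def)
    have le: "\<rho> ^ (2 ^ k) \<le> 2 * real (2 ^ k) + 1" for k
      using pow[of k] \<mu>0 by (simp add: \<rho>_def power_divide divide_le_eq)
    have "(\<lambda>n. real n / \<rho> ^ n) \<longlonglongrightarrow> 0"
      using lim_n_over_pown[of \<rho>] \<rho> by simp
    \<comment> \<open>The threshold 1/3 works because 2 m + 1 \<le> 3 m for m \<ge> 1. Only powers
      of two are admissible as m, which is why \<open>2 ^ n0\<close> is used below.\<close>
    then have "eventually (\<lambda>n. real n / \<rho> ^ n < 1 / 3) sequentially"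
      by (rule order_tendstoD) simp
    then obtain n0 where n0: "\<And>n. n \<ge> n0 \<Longrightarrow> real n / \<rho> ^ n < 1 / 3"
      by (auto simp: eventually_sequentially)
    have "n0 \<le> 2 ^ n0" by (simp add: less_imp_le)
    from n0[OF this] have "3 * real (2 ^ n0) < \<rho> ^ (2 ^ n0)"
      using \<rho> by (simp add: divide_less_eq)
    moreover have "(1 :: real) \<le> real (2 ^ n0)" by simp
    ultimately show False using le[of n0] by linarith
  qed
qed

end

section \<open>Extremal commuting matrices\<close>

lemma phase_perm_copies:
  assumes "phase_perm \<sigma> c \<omega>"
  shows "phase_perm (\<lambda>r g. (\<sigma> (r + snd g) (fst g), snd g)) (\<lambda>r g. c (r + snd g) (fst g)) \<omega>"
proof -
  interpret phase_perm \<sigma> c \<omega> by (rule assms)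
  show ?thesis
  proof
    fix r :: nat and g :: "'a \<times> nat"
    have e: "r + 2 + snd g = r + snd g + 2" "r + 4 + s = r + s + 4" for s by simp_all
    show "(\<sigma> (r + 2 + snd (\<sigma> (r + snd g) (fst g), snd g)) (fst (\<sigma> (r + snd g) (fst g), snd g)),
        snd (\<sigma> (r + snd g) (fst g), snd g)) = g"
      by (simp only: fst_conv snd_conv e \<sigma>_inv prod.collapse)
    show "c (r + 2 + snd g) (fst g) * c (r + snd (\<sigma> (r + 2 + snd g) (fst g), snd g))
        (fst (\<sigma> (r + 2 + snd g) (fst g), snd g)) = 1"
      by (simp only: fst_conv snd_conv e c_inv)
    show "(\<lambda>g. (\<sigma> (r + 4 + snd g) (fst g), snd g)) = (\<lambda>g. (\<sigma> (r + snd g) (fst g), snd g))"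
      "(\<lambda>g. c (r + 4 + snd g) (fst g)) = (\<lambda>g. c (r + snd g) (fst g))"
      by (simp_all only: e period)
  qed (simp_all add: c_unit \<sigma>_commute c_commute)
qed

lemma sum_shift_period:
  fixes f :: "nat \<Rightarrow> 'a::ab_group_add"
  assumes "\<And>s. f (s + 4) = f s"
  shows "(\<Sum>s<4. f (r + s)) = (\<Sum>s<4. f s)"
proof (induction r)
  case (Suc r)
  have "(\<Sum>s<4. f (Suc r + s)) = (\<Sum>s<4. f (r + s)) + f (r + 4) - f r"
    by (simp add: eval_nat_numeral)
  then show ?case using Suc assms[of r] by simp
qed simp

text \<open>Four copies form one period of the cyclic numbering, and the factor 1/2 preserves the
  norm.\<close>

definition copies :: "('i \<Rightarrow>\<^sub>0 complex) \<Rightarrow> 'i \<times> nat \<Rightarrow>\<^sub>0 complex"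
  where "copies x = Abs_poly_mapping (\<lambda>g. if snd g < 4 then Poly_Mapping.lookup x (fst g) / 2 else 0)"

lemma lookup_copies:
  fixes x :: "'i \<Rightarrow>\<^sub>0 complex"
  shows
  "Poly_Mapping.lookup (copies x) g = (if snd g < 4 then Poly_Mapping.lookup x (fst g) / 2 else 0)"
proof -
  have "{g :: 'i \<times> nat. (if snd g < 4 then Poly_Mapping.lookup x (fst g) / 2 else 0) \<noteq> 0}
      \<subseteq> Poly_Mapping.keys x \<times> {..<4 :: nat}"
    by (auto simp: in_keys_iff split: if_splits)
  then have "finite {g :: 'i \<times> nat. (if snd g < 4 then Poly_Mapping.lookup x (fst g) / 2 else 0) \<noteq> 0}"
    by (rule finite_subset) simp
  then show ?thesis by (simp add: copies_def)
qed

lemma keys_copies: "Poly_Mapping.keys (copies x) \<subseteq> Poly_Mapping.keys x \<times> {..<4}"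
  by (auto simp: in_keys_iff lookup_copies split: if_splits)

text \<open>On the copy number \<open>s\<close> the generators act through the automorphism that shifts the letters by
  \<open>s\<close>, so that all letters have the same expectation in the vector \<open>copies x\<close>.\<close>

lemma copies_expectation:
  fixes \<sigma> :: "nat \<Rightarrow> 'i \<Rightarrow> 'i"
  assumes "phase_perm \<sigma> c \<omega>"
  defines "act \<equiv> phase_perm.shift_act \<sigma> c"
    and "act' \<equiv> phase_perm.shift_act (\<lambda>r g. (\<sigma> (r + snd g) (fst g), snd g)) (\<lambda>r g. c (r + snd g) (fst g))"
  shows "pm_inner (copies x) (act' r (copies x)) = pm_inner x (phase_rep.hop act x) / 4"
    and "pm_inner (copies x) (copies x) = pm_inner x x"
proof -
  interpret phase_perm \<sigma> c \<omega> by (rule assms)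
  interpret c: phase_perm "\<lambda>r g. (\<sigma> (r + snd g) (fst g), snd g)" "\<lambda>r g. c (r + snd g) (fst g)" \<omega>
    by (rule phase_perm_copies[OF assms(1)])
  let ?l = "Poly_Mapping.lookup x" and ?K = "Poly_Mapping.keys x"
  have inner: "pm_inner (copies x) y = (\<Sum>s<4. \<Sum>g\<in>?K. cnj (?l g / 2) * Poly_Mapping.lookup y (g, s))" for y
  proof -
    have "pm_inner (copies x) y
        = (\<Sum>g\<in>?K \<times> {..<4}. cnj (Poly_Mapping.lookup (copies x) g) * Poly_Mapping.lookup y g)"
      using keys_copies by (intro pm_inner_superset) auto
    also have "\<dots> = (\<Sum>g\<in>?K. \<Sum>s<4. cnj (Poly_Mapping.lookup (copies x) (g, s)) * Poly_Mapping.lookup y (g, s))"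
      by (simp add: sum.cartesian_product)
    also have "\<dots> = (\<Sum>s<4. \<Sum>g\<in>?K. cnj (Poly_Mapping.lookup (copies x) (g, s)) * Poly_Mapping.lookup y (g, s))"
      by (rule sum.swap)
    also have "\<dots> = (\<Sum>s<4. \<Sum>g\<in>?K. cnj (?l g / 2) * Poly_Mapping.lookup y (g, s))"
      by (intro sum.cong refl) (simp add: lookup_copies)
    finally show ?thesis .
  qed
  have "pm_inner (copies x) (act' r (copies x))
      = (\<Sum>s<4. \<Sum>g\<in>?K. cnj (?l g / 2) * (c (r + s) g * (?l (\<sigma> (r + s) g) / 2)))"
    unfolding inner act'_def
    by (intro sum.cong refl) (simp add: c.lookup_shift_act lookup_copies)
  also have "\<dots> = (\<Sum>s<4. pm_inner x (act (r + s) x) / 4)"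
    unfolding pm_inner_def act_def lookup_shift_act sum_divide_distrib
    by (intro sum.cong refl) (simp add: field_simps)
  also have "\<dots> = (\<Sum>s<4. pm_inner x (act s x) / 4)"
    by (rule sum_shift_period) (simp add: act_def act_period)
  also have "\<dots> = pm_inner x (hop x) / 4"
    by (simp add: hop_def act_def ip_sum_right sum_divide_distrib)
  finally show "pm_inner (copies x) (act' r (copies x)) = pm_inner x (phase_rep.hop act x) / 4"
    by (simp add: act_def)
  have "pm_inner (copies x) (copies x) = (\<Sum>s<(4::nat). \<Sum>g\<in>?K. cnj (?l g / 2) * (?l g / 2))"
    unfolding inner by (intro sum.cong refl) (simp add: lookup_copies)
  also have "\<dots> = pm_inner x x"
    by (simp add: pm_inner_def sum_distrib_left)
  finally show "pm_inner (copies x) (copies x) = pm_inner x x" .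
qed

section \<open>Bases in which the generators are banded\<close>

context phase_rep
begin

lemma ip_null: "nrm x = 0 \<Longrightarrow> ip w x = 0"
  using ip_le_nrm[of w x] by simp

text \<open>A Gram-Schmidt step for \<open>y\<close>. If \<open>y\<close> lies in the span up to a
  null vector, an arbitrary new unit vector orthogonal to the span is adjoined, so the construction
  never stops and all naturals serve as indices. The expansion of \<open>y\<close> is stated through
  inner products because the form need not be definite.\<close>

lemma orthonormal_extension:
  fixes e :: "nat \<Rightarrow> 'e" and k :: nat
  assumes infinite_dim: "\<And>F. finite F \<Longrightarrow> \<exists>z. ip z z = 1 \<and> (\<forall>x\<in>F. ip x z = 0)"
    and e: "\<And>i j. i < k \<Longrightarrow> j < k \<Longrightarrow> ip (e i) (e j) = of_bool (i = j)"
  shows "\<exists>z. ip z z = 1 \<and> (\<forall>i<k. ip (e i) z = 0) \<and>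
    (\<forall>w. ip w y = (\<Sum>i<k. ip (e i) y * ip w (e i)) + ip z y * ip w z)"
proof -
  define \<rho> where "\<rho> = y - (\<Sum>i<k. ip (e i) y *s e i)"
  have ortho: "ip (e j) \<rho> = 0" if "j < k" for j
  proof -
    have "(\<Sum>i<k. ip (e i) y * ip (e j) (e i)) = (\<Sum>i<k. if i = j then ip (e j) y else 0)"
      using e that by (intro sum.cong refl) auto
    then show ?thesis using that by (simp add: \<rho>_def ip_diff_right ip_sum_right ip_scale_right)
  qed
  have y: "ip w y = (\<Sum>i<k. ip (e i) y * ip w (e i)) + ip w \<rho>" for w
    by (simp add: \<rho>_def ip_diff_right ip_sum_right ip_scale_right)
  show ?thesis
  proof (cases "nrm \<rho> = 0")
    case True
    obtain z where z: "ip z z = 1" "\<And>i. i < k \<Longrightarrow> ip (e i) z = 0"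
      using infinite_dim[of "e ` {..<k}"] by auto
    have "ip z (e i) = 0" if "i < k" for i using ip_cnj[of "e i" z] z(2)[OF that] by simp
    then have "ip z y = 0" using y[of z] ip_null[OF True] by simp
    then have "ip w y = (\<Sum>i<k. ip (e i) y * ip w (e i)) + ip z y * ip w z" for w
      using y[of w] ip_null[OF True, of w] by simp
    then show ?thesis using z by blast
  next
    case False
    define z where "z = of_real (1 / nrm \<rho>) *s \<rho>"
    have "ip z z = 1"
      using False by (simp add: z_def ip_self nrm_scale norm_divide)
    moreover have z0: "\<forall>i<k. ip (e i) z = 0" using ortho by (simp add: z_def ip_scale_right)
    moreover have "ip w y = (\<Sum>i<k. ip (e i) y * ip w (e i)) + ip z y * ip w z" for w
    proof -
      have "ip z (e i) = 0" if "i < k" for i using ip_cnj[of "e i" z] z0 that by simp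
      then have "ip z y = ip z \<rho>" using y[of z] by simp
      also have "\<dots> = of_real (nrm \<rho>)"
        using False by (simp add: z_def ip_scale_left ip_self power2_eq_square)
      finally have "ip z y * ip w z = ip w \<rho>" using False by (simp add: z_def ip_scale_right)
      then show ?thesis using y[of w] by simp
    qed
    ultimately show ?thesis by blast
  qed
qed

text \<open>A schedule: the vector number 4 j + r + 1 absorbs the image of \<open>e j\<close> under
  the letter \<open>r\<close>, and \<open>e j\<close> is available by then since j < 4 j + r + 1.
  Hence the four images of \<open>e j\<close> lie in the span of the first 4 j + 5 vectors, a bound
  independent of the representation and of \<open>x0\<close>.\<close>

lemma adapted_basis:
  assumes infinite_dim: "\<And>F. finite F \<Longrightarrow> \<exists>z. ip z z = 1 \<and> (\<forall>x\<in>F. ip x z = 0)"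
    and x0: "ip x0 x0 = 1"
  shows "\<exists>e. e 0 = x0 \<and> (\<forall>i j. ip (e i) (e j) = of_bool (i = j)) \<and>
    (\<forall>j r w. r < 4 \<longrightarrow>
      ip w (act r (e j)) = (\<Sum>i<4 * j + r + 2. ip (e i) (act r (e j)) * ip w (e i)))"
proof -
  define P where "P e k z \<longleftrightarrow> (k = 0 \<longrightarrow> z = x0) \<and> ip z z = 1 \<and> (\<forall>i<k. ip (e i) z = 0) \<and>
    (\<forall>j r w. r < 4 \<and> k = 4 * j + r + 1 \<longrightarrow>
      ip w (act r (e j)) = (\<Sum>i<k. ip (e i) (act r (e j)) * ip w (e i)) + ip z (act r (e j)) * ip w z)"
    for e :: "nat \<Rightarrow> 'e" and k z
  have "\<exists>e. \<forall>k. P e k (e k)"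
  proof (rule dependent_wellorder_choice)
    fix z and e e' :: "nat \<Rightarrow> 'e" and k :: nat assume "\<And>i. i < k \<Longrightarrow> e i = e' i"
    then show "P e k z = P e' k z" unfolding P_def by (intro conj_cong all_cong imp_cong) auto
  next
    fix k :: nat and e :: "nat \<Rightarrow> 'e" assume IH: "\<And>i. i < k \<Longrightarrow> P e i (e i)"
    have ortho: "ip (e i) (e j) = of_bool (i = j)" if "i < k" "j < k" for i j
    proof -
      have "ip (e i) (e j) = 0" if "i < j" "j < k" for i j using IH[of j] that by (simp add: P_def)
      then have "i \<noteq> j \<Longrightarrow> ip (e i) (e j) = 0"
        using that ip_cnj[of "e j" "e i"] by (cases i j rule: linorder_cases) auto
      then show ?thesis using IH[of i] that by (auto simp: P_def)
    qed
    show "\<exists>z. P e k z"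
    proof (cases k)
      case 0
      then show ?thesis using x0 by (intro exI[of _ x0]) (simp add: P_def)
    next
      case (Suc m)
      obtain z where z: "ip z z = 1" "\<forall>i<k. ip (e i) z = 0"
        "\<And>w. ip w (act (m mod 4) (e (m div 4))) = (\<Sum>i<k. ip (e i) (act (m mod 4) (e (m div 4))) * ip w (e i))
          + ip z (act (m mod 4) (e (m div 4))) * ip w z"
        using orthonormal_extension[where k = k and e = e and y = "act (m mod 4) (e (m div 4))", OF infinite_dim ortho] by blast
      have "j = m div 4 \<and> r = m mod 4" if "r < 4" "k = 4 * j + r + 1" for j r
        using that Suc by auto
      then have "P e k z" unfolding P_def using z Suc by blast
      then show ?thesis ..
    qed
  qed
  then obtain e where e: "\<And>k. P e k (e k)" by blast
  show ?thesis
  proof (intro exI[of _ e] conjI allI impI)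
    show "e 0 = x0" using e[of 0] by (simp add: P_def)
    have lt: "ip (e i) (e j) = 0" if "i < j" for i j using e[of j] that by (simp add: P_def)
    show "ip (e i) (e j) = of_bool (i = j)" for i j
      using lt[of i j] lt[of j i] ip_cnj[of "e j" "e i"] e[of i]
      by (cases i j rule: linorder_cases) (auto simp: P_def)
    fix j r :: nat and w assume "r < 4"
    then have "ip w (act r (e j)) = (\<Sum>i<Suc (4 * j + r + 1). ip (e i) (act r (e j)) * ip w (e i))"
      using e[of "4 * j + r + 1"] unfolding P_def sum.lessThan_Suc by blast
    then show "ip w (act r (e j)) = (\<Sum>i<4 * j + r + 2. ip (e i) (act r (e j)) * ip w (e i))" by simp
  qed
qed

text \<open>Up to null vectors the span of the adapted basis is invariant under all letters, so
  matrix products represent compositions and the relations carry over. The distinguished vector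
  comes first, which turns its expectations into the entries at 0 0.\<close>

lemma banded_matrices:
  assumes infinite_dim: "\<And>F. finite F \<Longrightarrow> \<exists>z. ip z z = 1 \<and> (\<forall>x\<in>F. ip x z = 0)"
    and x0: "ip x0 x0 = 1"
  defines "\<beta> \<equiv> \<lambda>i. 4 * i + 5"
  obtains a b where "unitary_matrix UNIV \<beta> a" "unitary_matrix UNIV \<beta> b"
    "\<And>i k. (\<Sum>j<\<beta> i. b i j * a j k) = \<omega> * (\<Sum>j<\<beta> i. a i j * b j k)"
    "a 0 0 = ip x0 (act 0 x0)" "b 0 0 = ip x0 (act 1 x0)"
proof -
  have "\<exists>e. e 0 = x0 \<and> (\<forall>i j. ip (e i) (e j) = of_bool (i = j)) \<and>
    (\<forall>j r w. r < 4 \<longrightarrow>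
      ip w (act r (e j)) = (\<Sum>i<4 * j + r + 2. ip (e i) (act r (e j)) * ip w (e i)))"
    by (rule adapted_basis[OF _ x0]) (rule infinite_dim)
  then obtain e where e0: "e 0 = x0" and ortho: "\<And>i j. ip (e i) (e j) = of_bool (i = j)"
    and exp: "\<And>j r w. r < 4 \<Longrightarrow> ip w (act r (e j)) = (\<Sum>i<4 * j + r + 2. ip (e i) (act r (e j)) * ip w (e i))"
    by blast
  define m where "m r i j = ip (e i) (act r (e j))" for r i j
  have period: "m (r + 4) = m r" for r by (simp add: m_def fun_eq_iff act_period)
  have adj: "cnj (m r i j) = m (r + 2) j i" for r i j
    unfolding m_def act_adj[symmetric] by (rule ip_cnj[symmetric])
  have adj': "cnj (m (r + 2) i j) = m r j i" for r i j
    using adj[of r j i] by (metis complex_cnj_cnj)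
  have low: "m r i j = 0" if "\<beta> j \<le> i" "r < 4" for r i j
  proof -
    have "m r i j = (\<Sum>k<4 * j + r + 2. m r k j * of_bool (i = k))"
      unfolding m_def by (subst exp[OF that(2), of "e i" j]) (simp only: ortho)
    also have "\<dots> = 0" using that by (intro sum.neutral) (auto simp: \<beta>_def)
    finally show ?thesis .
  qed
  \<comment> \<open>The rows of a letter are the conjugated columns of its adjoint, which is the
    letter \<open>r + 2\<close> or \<open>r - 2\<close>. This is why the basis takes all four
    letters into account.\<close>
  have high: "m r i j = 0" if "\<beta> i \<le> j" "r < 4" for r i j
  proof (cases "r < 2")
    case True
    then have "m (r + 2) j i = 0" using that by (intro low) auto
    then show ?thesis using adj[of r i j] by simp
  next
    case False
    then have "m (r - 2) j i = 0" "r - 2 + 2 = r" using that by (auto intro: low)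
    then show ?thesis using adj'[of "r - 2" i j] by simp
  qed
  have expand: "ip w (act r (e j)) = (\<Sum>i<N. m r i j * ip w (e i))" if "r < 4" "\<beta> j \<le> N" for w r j N
  proof -
    have "ip w (act r (e j)) = (\<Sum>i<\<beta> j. m r i j * ip w (e i))"
    proof -
      have "ip (e i) (act r (e j)) = 0" if "4 * j + r + 2 \<le> i" for i
        by (subst exp[OF \<open>r < 4\<close>, of "e i" j], rule sum.neutral) (use that in \<open>auto simp: ortho\<close>)
      then have "(\<Sum>i<4 * j + r + 2. m r i j * ip w (e i)) = (\<Sum>i<\<beta> j. m r i j * ip w (e i))"
        using that(1) by (intro sum.mono_neutral_left) (auto simp: \<beta>_def m_def)
      then show ?thesis by (subst exp[OF that(1), of w j]) (simp add: m_def)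
    qed
    also have "\<dots> = (\<Sum>i<N. m r i j * ip w (e i))"
      using low that by (intro sum.mono_neutral_left) auto
    finally show ?thesis .
  qed
  have prod: "(\<Sum>l<N. m s i l * m r l j) = ip (e i) (act s (act r (e j)))"
    if "r < 4" "\<beta> j \<le> N" for s r i j N
  proof -
    have act_s: "act (s + 2 + 2) = act s" using act_period[of s] by (simp add: numeral_eq_Suc)
    have shift: "ip (act (s + 2) (e i)) w = ip (e i) (act s w)" for w
      unfolding act_adj act_s ..
    show ?thesis
      using expand[OF that, of "act (s + 2) (e i)"] unfolding shift by (simp add: m_def mult.commute)
  qed
  have prod_row: "(\<Sum>l<\<beta> i. m s i l * m r l j) = ip (e i) (act s (act r (e j)))" if "r < 4" "s < 4" for s r i j
  proof -
    have "(\<Sum>l<\<beta> i. m s i l * m r l j) = (\<Sum>l<\<beta> i + \<beta> j. m s i l * m r l j)"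
      using high[OF _ that(2)] by (intro sum.mono_neutral_left) auto
    then show ?thesis using prod[OF that(1), of j "\<beta> i + \<beta> j"] by simp
  qed
  have inv: "ip (e i) (act (r + 2) (act r (e j))) = of_bool (i = j)" for r i j
    by (simp only: act_inv ortho)
  have inv': "ip (e i) (act r (act (r + 2) (e j))) = of_bool (i = j)" for r i j
  proof -
    have "act r = act (r + 2 + 2)" using act_period[of r] by (simp add: numeral_eq_Suc)
    then show ?thesis using inv[of i "r + 2" j] by metis
  qed
  have unitary: "unitary_matrix UNIV \<beta> (m r)" if r: "r < 2" for r
    unfolding unitary_matrix_def
  proof (intro conjI allI impI)
    fix i j
    show "(\<Sum>l<\<beta> j. cnj (m r l i) * m r l j) = of_bool (i = j \<and> i \<in> UNIV)"
      using r prod[of r j "\<beta> j" "r + 2" i] by (simp only: adj inv) simp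
    show "(\<Sum>l<\<beta> i. m r i l * cnj (m r j l)) = of_bool (i = j \<and> i \<in> UNIV)"
      using r prod_row[of "r + 2" r i j] by (simp only: adj inv') simp
  next
    fix i j assume "m r i j \<noteq> 0"
    then show "i \<in> UNIV" "j \<in> UNIV" "j < \<beta> i" "i < \<beta> j"
      using low[of j i r] high[of i j r] r by (auto simp: not_le[symmetric])
  qed
  have commute: "(\<Sum>j<\<beta> i. m 1 i j * m 0 j k) = \<omega> * (\<Sum>j<\<beta> i. m 0 i j * m 1 j k)" for i k
    using prod_row[of 0 1 i k] prod_row[of 1 0 i k] act_commute[of "e i" 0 "e k"] by simp
  show thesis
    by (rule that[of "m 0" "m 1"]) (use unitary commute in \<open>auto simp: m_def e0\<close>)
qed

end

section \<open>Limits of banded matrices\<close>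

text \<open>A product of discs is compact, and countability of the index type makes it sequentially
  compact.\<close>

lemma pointwise_convergent_subsequence:
  fixes F :: "nat \<Rightarrow> 'i::countable \<Rightarrow> complex"
  assumes "\<And>n i. cmod (F n i) \<le> 1"
  obtains G r where "strict_mono r" "\<And>i. (\<lambda>n. F (r n) i) \<longlonglongrightarrow> G i"
proof -
  let ?K = "PiE UNIV (\<lambda>i::'i. cball (0::complex) 1)"
  have "compactin (product_topology (\<lambda>i. euclidean) UNIV) ?K"
    by (simp add: compactin_PiE compactin_euclidean_iff)
  then have "compact ?K" by (simp add: euclidean_product_topology compactin_euclidean_iff)
  then have "seq_compact ?K" by (rule compact_imp_seq_compact)
  moreover have "\<forall>n. F n \<in> ?K" using assms by auto
  ultimately obtain G r where r: "strict_mono r" and G: "(F \<circ> r) \<longlonglongrightarrow> G"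
    unfolding seq_compact_def by blast
  have "(\<lambda>n. F (r n) i) \<longlonglongrightarrow> G i" for i
    using continuous_on_tendsto_compose[OF continuous_on_product_coordinates[of i] G] by simp
  then show thesis using that r by blast
qed

lemma unitary_matrix_entry_le:
  assumes a: "unitary_matrix I \<beta> a"
  shows "cmod (a i j) \<le> 1"
proof (cases "i < \<beta> j")
  case True
  have "of_real (\<Sum>l<\<beta> j. (cmod (a l j))\<^sup>2) = (\<Sum>l<\<beta> j. cnj (a l j) * a l j)"
    unfolding of_real_sum complex_norm_square by (simp add: mult.commute)
  also have "\<dots> = of_real (of_bool (j \<in> I))"
    unfolding unitary_matrixD(5)[OF a] by simp
  finally have "(\<Sum>l<\<beta> j. (cmod (a l j))\<^sup>2) = of_bool (j \<in> I)"
    by (simp only: of_real_eq_iff)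
  then have "(\<Sum>l<\<beta> j. (cmod (a l j))\<^sup>2) \<le> 1" by simp
  moreover have "(cmod (a i j))\<^sup>2 \<le> (\<Sum>l<\<beta> j. (cmod (a l j))\<^sup>2)"
    by (rule member_le_sum) (use True in auto)
  ultimately have "(cmod (a i j))\<^sup>2 \<le> 1\<^sup>2" by simp
  then show ?thesis by (rule power2_le_imp_le) simp
qed (use unitary_matrixD(4)[OF a] in simp)

text \<open>The common profile fixes the range of every sum, so the limit commutes with it. Without
  it, mass could escape to infinity and leave only a contraction.\<close>

lemma unitary_matrix_limit:
  assumes a: "\<And>n. unitary_matrix I \<beta> (a n)" and lim: "\<And>i j. (\<lambda>n. a n i j) \<longlonglongrightarrow> a' i j"
  shows "unitary_matrix I \<beta> a'"
proof -
  have zero: "a' i j = 0" if "\<And>n. a n i j = 0" for i j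
    using lim[of i j] that by (simp add: LIMSEQ_const_iff)
  show ?thesis
    unfolding unitary_matrix_def
  proof (intro conjI allI impI)
    fix i j
    have "(\<lambda>n. \<Sum>l<\<beta> j. cnj (a n l i) * a n l j) \<longlonglongrightarrow> (\<Sum>l<\<beta> j. cnj (a' l i) * a' l j)"
      by (intro tendsto_intros lim)
    then show "(\<Sum>l<\<beta> j. cnj (a' l i) * a' l j) = of_bool (i = j \<and> i \<in> I)"
      unfolding unitary_matrixD(5)[OF a] by (simp only: LIMSEQ_const_iff)
    have "(\<lambda>n. \<Sum>l<\<beta> i. a n i l * cnj (a n j l)) \<longlonglongrightarrow> (\<Sum>l<\<beta> i. a' i l * cnj (a' j l))"
      by (intro tendsto_intros lim)
    then show "(\<Sum>l<\<beta> i. a' i l * cnj (a' j l)) = of_bool (i = j \<and> i \<in> I)"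
      unfolding unitary_matrixD(6)[OF a] by (simp only: LIMSEQ_const_iff)
  next
    fix i j assume nz: "a' i j \<noteq> 0"
    show "i \<in> I" "j \<in> I" "j < \<beta> i" "i < \<beta> j"
      using nz zero[of i j] unitary_matrixD(1-4)[OF a, of i] unitary_matrixD(2)[OF a, of j]
        unitary_matrixD(4)[OF a, of j] by (force simp: not_less[symmetric])+
  qed
qed

lemma pm_inner_infinite_dim:
  assumes "infinite (UNIV :: 'i set)" "finite F"
  shows "\<exists>z :: 'i \<Rightarrow>\<^sub>0 complex. pm_inner z z = 1 \<and> (\<forall>x\<in>F. pm_inner x z = 0)"
proof -
  have "finite (\<Union>x\<in>F. Poly_Mapping.keys x)" using assms(2) by simp
  then obtain i where i: "i \<notin> (\<Union>x\<in>F. Poly_Mapping.keys x)"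
    using assms(1) ex_new_if_finite by blast
  let ?z = "Poly_Mapping.single i (1 :: complex)"
  have "pm_inner ?z ?z = 1" by (simp add: pm_inner_def)
  moreover have "pm_inner x ?z = 0" if "x \<in> F" for x
    unfolding pm_inner_def using i that by (intro sum.neutral) (auto simp: lookup_single when_def)
  ultimately show ?thesis by blast
qed

context
  fixes \<gamma> :: real
begin

interpretation lat: phase_perm lattice_shift "lattice_phase \<gamma>" "cis \<gamma>"
  by (rule phase_perm_lattice)

text \<open>The contrapositive of \<open>universal_seminorm_harper_le\<close> at a bound below the
  norm, followed by normalization. The expectation is real because h is selfadjoint.\<close>

lemma almost_maximal_vector:
  assumes "0 < \<epsilon>"
  obtains x t where "pm_inner x x = 1" "pm_inner x (lat.hop x) = of_real t"
    "universal_seminorm \<gamma> harper - \<epsilon> < t" "t \<le> universal_seminorm \<gamma> harper"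
proof -
  let ?S = "universal_seminorm \<gamma> harper"
  have "\<not> (\<forall>x. Re (pm_inner x (lat.hop x)) \<le> (?S - \<epsilon>) * Re (pm_inner x x))"
    using universal_seminorm_harper_le[of \<gamma> "?S - \<epsilon>"] assms by force
  then obtain y where y: "(?S - \<epsilon>) * (lat.nrm y)\<^sup>2 < Re (pm_inner y (lat.hop y))"
    by (auto simp: not_le lat.nrm_sq)
  have ny: "lat.nrm y \<noteq> 0"
  proof
    assume 0: "lat.nrm y = 0"
    then have "cmod (pm_inner y (lat.hop y)) \<le> 0" using lat.ip_le_nrm[of y "lat.hop y"] by simp
    then show False using y 0 by simp
  qed
  define x where "x = pm_scale (of_real (1 / lat.nrm y)) y"
  have nx: "lat.nrm x = 1" using ny by (simp add: x_def lat.nrm_scale norm_divide)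
  define t where "t = Re (pm_inner x (lat.hop x))"
  have "pm_inner x (lat.hop x) = cnj (pm_inner x (lat.hop x))"
    using lat.ip_cnj[of "lat.hop x" x] by (simp add: lat.ip_hop)
  then have "pm_inner x (lat.hop x) = of_real t" by (simp add: t_def complex_eq_iff)
  moreover have "pm_inner x x = 1" by (simp add: lat.ip_self nx)
  moreover have "t = Re (pm_inner y (lat.hop y)) / (lat.nrm y)\<^sup>2"
    by (simp add: t_def x_def lat.hop_scale lat.ip_scale_left lat.ip_scale_right power2_eq_square
        flip: of_real_divide of_real_mult)
  then have "?S - \<epsilon> < t" using y ny by (simp add: less_divide_eq)
  moreover have "t \<le> ?S"
    using lat.hop_le_universal_seminorm[of \<gamma> x] nx by (simp add: t_def cis_conv_exp)
  ultimately show thesis using that by blast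
qed

text \<open>Along a sequence of ever better vectors the profile and the position of the
  distinguished vector stay the same. The entries at 0 0 are real and equal for both matrices before
  the limit already, thanks to \<open>copies\<close>.\<close>

lemma extremal_commuting_matrices:
  defines "\<beta> \<equiv> \<lambda>i. 4 * i + 5" and "\<kappa> \<equiv> of_real (universal_seminorm \<gamma> harper / 4)"
  obtains a b where "unitary_matrix UNIV \<beta> a" "unitary_matrix UNIV \<beta> b"
    "\<And>i k. (\<Sum>j<\<beta> i. b i j * a j k) = cis \<gamma> * (\<Sum>j<\<beta> i. a i j * b j k)"
    "a 0 0 = \<kappa>" "b 0 0 = \<kappa>"
proof -
  let ?S = "universal_seminorm \<gamma> harper"
  interpret c: phase_perm "\<lambda>r g. (lattice_shift (r + snd g) (fst g), snd g)"
    "\<lambda>r g. lattice_phase \<gamma> (r + snd g) (fst g)" "cis \<gamma>"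
    by (rule phase_perm_copies[OF phase_perm_lattice])
  have inf: "infinite (UNIV :: ((int \<times> int) \<times> nat) set)"
    by (simp add: finite_prod)
  define P where "P n a b t \<longleftrightarrow> unitary_matrix UNIV \<beta> a \<and> unitary_matrix UNIV \<beta> b \<and>
      (\<forall>i k. (\<Sum>j<\<beta> i. b i j * a j k) = cis \<gamma> * (\<Sum>j<\<beta> i. a i j * b j k)) \<and>
      a 0 0 = of_real (t / 4) \<and> b 0 0 = of_real (t / 4) \<and> ?S - 1 / real (Suc n) < t \<and> t \<le> ?S"
    for n a b t
  have "\<exists>a b t. P n a b t" for n
  proof -
    obtain x t where x: "pm_inner x x = 1" "pm_inner x (lat.hop x) = of_real t"
      and t: "?S - 1 / real (Suc n) < t" "t \<le> ?S"
      by (rule almost_maximal_vector[of "1 / real (Suc n)"]) auto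
    have e: "pm_inner (copies x) (c.shift_act r (copies x)) = of_real (t / 4)" for r
      using copies_expectation(1)[OF phase_perm_lattice[of \<gamma>], where x = x and r = r] x(2) by simp
    have 1: "pm_inner (copies x) (copies x) = 1"
      using copies_expectation(2)[OF phase_perm_lattice[of \<gamma>], where x = x] x(1) by simp
    show ?thesis
      by (rule c.banded_matrices[OF _ 1])
        (use pm_inner_infinite_dim[OF inf] e t in \<open>auto simp: \<beta>_def P_def\<close>)
  qed
  then obtain a b t where P: "\<And>n. P n (a n) (b n) (t n)" by metis
  then have a: "\<And>n. unitary_matrix UNIV \<beta> (a n)" and b: "\<And>n. unitary_matrix UNIV \<beta> (b n)"
    and ba: "\<And>n i k. (\<Sum>j<\<beta> i. b n i j * a n j k) = cis \<gamma> * (\<Sum>j<\<beta> i. a n i j * b n j k)"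
    and a0: "\<And>n. a n 0 0 = of_real (t n / 4)" and b0: "\<And>n. b n 0 0 = of_real (t n / 4)"
    and t: "\<And>n. ?S - 1 / real (Suc n) < t n" "\<And>n. t n \<le> ?S"
    unfolding P_def by blast+
  have "(\<lambda>n. ?S - 1 / real (Suc n)) \<longlonglongrightarrow> ?S - 0"
    by (intro tendsto_diff tendsto_const LIMSEQ_Suc[OF lim_1_over_n])
  then have "t \<longlonglongrightarrow> ?S"
    by (intro tendsto_sandwich[OF _ _ _ tendsto_const, of "\<lambda>n. ?S - 1 / real (Suc n)" t])
      (use t in \<open>auto intro: always_eventually less_imp_le\<close>)
  then have t_lim: "(\<lambda>n. of_real (t n / 4) :: complex) \<longlonglongrightarrow> \<kappa>"
    unfolding \<kappa>_def by (intro tendsto_intros) auto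
  \<comment> \<open>Both matrix sequences are packed into one family, so that a single extraction of
    a subsequence serves both.\<close>
  define F where "F n x = (case x of (s, i, j) \<Rightarrow> if s then a n i j else b n i j)" for n and x :: "bool \<times> nat \<times> nat"
  have "cmod (F n x) \<le> 1" for n x
    using unitary_matrix_entry_le[OF a] unitary_matrix_entry_le[OF b] by (auto simp: F_def split: prod.split)
  then obtain G r where r: "strict_mono r" and G: "\<And>x. (\<lambda>n. F (r n) x) \<longlonglongrightarrow> G x"
    using pointwise_convergent_subsequence by blast
  define a' where "a' i j = G (True, i, j)" for i j
  define b' where "b' i j = G (False, i, j)" for i j
  have la: "(\<lambda>n. a (r n) i j) \<longlonglongrightarrow> a' i j" for i j using G[of "(True, i, j)"] by (simp add: F_def a'_def)
  have lb: "(\<lambda>n. b (r n) i j) \<longlonglongrightarrow> b' i j" for i j using G[of "(False, i, j)"] by (simp add: F_def b'_def)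
  have tr: "(\<lambda>n. of_real (t (r n) / 4) :: complex) \<longlonglongrightarrow> \<kappa>"
    using LIMSEQ_subseq_LIMSEQ[OF t_lim r] by (simp add: o_def)
  show thesis
  proof (rule that)
    show "unitary_matrix UNIV \<beta> a'" by (rule unitary_matrix_limit[OF a la])
    show "unitary_matrix UNIV \<beta> b'" by (rule unitary_matrix_limit[OF b lb])
    show "a' 0 0 = \<kappa>" using la[of 0 0] tr by (simp only: a0) (rule LIMSEQ_unique)
    show "b' 0 0 = \<kappa>" using lb[of 0 0] tr by (simp only: b0) (rule LIMSEQ_unique)
    fix i k
    have "(\<lambda>n. \<Sum>j<\<beta> i. b (r n) i j * a (r n) j k) \<longlonglongrightarrow> (\<Sum>j<\<beta> i. b' i j * a' j k)"
      by (intro tendsto_intros la lb)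
    moreover have "(\<lambda>n. \<Sum>j<\<beta> i. b (r n) i j * a (r n) j k) \<longlonglongrightarrow> cis \<gamma> * (\<Sum>j<\<beta> i. a' i j * b' j k)"
      unfolding ba by (intro tendsto_intros la lb)
    ultimately show "(\<Sum>j<\<beta> i. b' i j * a' j k) = cis \<gamma> * (\<Sum>j<\<beta> i. a' i j * b' j k)"
      by (rule LIMSEQ_unique)
  qed
qed

end

section \<open>Roots of unity\<close>

locale root_of_unity =
  fixes n :: nat and \<gamma> :: real
  assumes n_pos: "0 < n" and root: "cis \<gamma> ^ n = 1" and primitive: "\<And>k. 0 < k \<Longrightarrow> k < n \<Longrightarrow> cis \<gamma> ^ k \<noteq> 1"
begin

definition ph :: "int \<Rightarrow> complex"
  where "ph m = cis (\<gamma> * of_int m)"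

lemma ph_add: "ph (m + m') = ph m * ph m'"
  by (simp add: ph_def cis_mult algebra_simps)

lemma ph_0 [simp]: "ph 0 = 1"
  by (simp add: ph_def)

lemma ph_uminus: "ph (- m) = cnj (ph m)"
  by (simp add: ph_def cis_cnj)

lemma ph_cnj_mult [simp]: "cnj (ph m) * ph m = 1" "ph m * cnj (ph m) = 1"
  using ph_add[of "- m" m] by (simp_all add: ph_uminus mult.commute)

lemma ph_nat: "ph (int k) = cis \<gamma> ^ k"
  by (simp add: ph_def Complex.DeMoivre mult.commute)

lemma ph_power: "ph m ^ k = ph (int k * m)"
  by (simp add: ph_def Complex.DeMoivre mult_ac)

lemma ph_dvd: "int n dvd m \<Longrightarrow> ph m = 1"
proof (elim dvdE)
  fix k assume k: "m = int n * k"
  have "ph (int n * k) = (ph (int n)) powi k"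
    by (simp add: ph_def cis_power_int mult_ac)
  then show "ph m = 1" using root by (simp add: k ph_nat)
qed

lemma ph_eq_1_iff: "ph m = 1 \<longleftrightarrow> int n dvd m"
proof
  assume 1: "ph m = 1"
  have "ph m = ph (int n * (m div int n)) * ph (m mod int n)"
    by (simp add: ph_add[symmetric])
  then have "ph (int (nat (m mod int n))) = 1"
    using 1 ph_dvd[of "int n * (m div int n)"] n_pos by simp
  then have "cis \<gamma> ^ nat (m mod int n) = 1" by (simp only: ph_nat)
  moreover have "nat (m mod int n) < n"
    using n_pos by (simp add: nat_less_iff)
  ultimately have "nat (m mod int n) = 0" using primitive by blast
  then have "m mod int n = 0" using n_pos by (simp add: order_antisym)
  then show "int n dvd m" by (simp add: dvd_eq_mod_eq_0)
qed (rule ph_dvd)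

lemma ph_cong: "int n dvd (m - m') \<Longrightarrow> ph m = ph m'"
  using ph_add[of m' "m - m'"] ph_dvd[of "m - m'"] by simp

lemma ph_orthogonal: "(\<Sum>j<n. ph (int j * m)) = (if int n dvd m then of_nat n else 0)"
proof (cases "int n dvd m")
  case True
  then have "ph (int j * m) = 1" for j by (intro ph_dvd) simp
  then show ?thesis using True by simp
next
  case False
  then have "ph m \<noteq> 1" by (simp add: ph_eq_1_iff)
  moreover have "ph m ^ n = 1" by (simp add: ph_power ph_dvd)
  moreover have "(\<Sum>j<n. ph (int j * m)) = (\<Sum>j<n. ph m ^ j)" by (simp add: ph_power)
  ultimately show ?thesis using False by (simp add: geometric_sum)
qed

definition nxt :: "nat \<Rightarrow> nat" where "nxt k = (k + 1) mod n"
definition prv :: "nat \<Rightarrow> nat" where "prv k = (k + n - 1) mod n"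

lemma nxt_less [simp]: "nxt k < n" and prv_less [simp]: "prv k < n"
  using n_pos by (simp_all add: nxt_def prv_def)

lemma nxt_prv: "k < n \<Longrightarrow> nxt (prv k) = k" and prv_nxt: "k < n \<Longrightarrow> prv (nxt k) = k"
proof -
  assume k: "k < n"
  have "nxt (prv k) = (k + n - 1 + 1) mod n" unfolding nxt_def prv_def by (rule mod_add_left_eq)
  also have "\<dots> = (k + n) mod n" using n_pos by simp
  finally show "nxt (prv k) = k" using k by simp
  have "k + 1 + (n - 1) = k + n" using n_pos by simp
  moreover have "prv (nxt k) = ((k + 1) mod n + (n - 1)) mod n"
    unfolding nxt_def prv_def using n_pos by simp
  ultimately have "prv (nxt k) = (k + n) mod n" by (metis mod_add_left_eq)
  then show "prv (nxt k) = k" using k by simp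
qed

lemma nxt_dvd: "int n dvd (int (nxt k) - (int k + 1))" and prv_dvd: "int n dvd (int (prv k) - (int k - 1))"
proof -
  have *: "int n dvd (int (a mod n) - int a)" for a
    by (simp add: zmod_int mod_eq_dvd_iff[symmetric])
  show "int n dvd (int (nxt k) - (int k + 1))" using *[of "k + 1"] by (simp add: nxt_def add.commute)
  have "int (k + n - 1) = int k - 1 + int n" using n_pos by linarith
  then have "int (prv k) - (int k - 1) = (int ((k + n - 1) mod n) - int (k + n - 1)) + int n"
    by (simp add: prv_def)
  then show "int n dvd (int (prv k) - (int k - 1))" using *[of "k + n - 1"] by (metis dvd_add dvd_refl)
qed

lemma ph_nxt: "ph (int (nxt k) * m) = ph (int k * m) * ph m"
proof -
  have "int n dvd (int (nxt k) * m - (int k + 1) * m)"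
    using nxt_dvd[of k] by (simp only: left_diff_distrib[symmetric] dvd_mult2)
  from ph_cong[OF this] show ?thesis by (simp add: ph_add distrib_right)
qed

lemma ph_prv: "ph (int (prv k) * m) = ph (int k * m) * cnj (ph m)"
proof -
  have "int n dvd (int (prv k) * m - (int k - 1) * m)"
    using prv_dvd[of k] by (simp only: left_diff_distrib[symmetric] dvd_mult2)
  from ph_cong[OF this] have "ph (int (prv k) * m) = ph (int k * m + - m)"
    by (simp add: left_diff_distrib)
  then show ?thesis by (simp only: ph_add ph_uminus)
qed

lemma sum_nxt: "(\<Sum>k<n. f (nxt k)) = (\<Sum>k<n. f k)"
  by (rule sum.reindex_bij_witness[where i = prv and j = nxt]) (simp_all add: nxt_prv prv_nxt)

lemma sum_prv: "(\<Sum>k<n. f (prv k)) = (\<Sum>k<n. f k)"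
  by (rule sum.reindex_bij_witness[where i = nxt and j = prv]) (simp_all add: nxt_prv prv_nxt)

section \<open>Clock and shift representations\<close>

definition fscale :: "complex \<Rightarrow> (nat \<Rightarrow> complex) \<Rightarrow> nat \<Rightarrow> complex"
  where "fscale a x = (\<lambda>k. a * x k)"

text \<open>Degenerate on purpose: vectors of length n are functions on all naturals, of which only
  the coordinates below n count.\<close>

definition fip :: "(nat \<Rightarrow> complex) \<Rightarrow> (nat \<Rightarrow> complex) \<Rightarrow> complex"
  where "fip x y = (\<Sum>k<n. cnj (x k) * y k)"

definition clock_shift :: "complex \<Rightarrow> complex \<Rightarrow> nat \<Rightarrow> (nat \<Rightarrow> complex) \<Rightarrow> nat \<Rightarrow> complex"
  where "clock_shift z w r x k =
    (if r mod 4 = 0 then z * ph (int k) * x k else if r mod 4 = 1 then w * x (nxt k)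
     else if r mod 4 = 2 then cnj z * cnj (ph (int k)) * x k else cnj w * x (prv k))"

lemma fip_cong: "(\<And>k. k < n \<Longrightarrow> x k = x' k) \<Longrightarrow> (\<And>k. k < n \<Longrightarrow> y k = y' k) \<Longrightarrow> fip x y = fip x' y'"
  by (simp add: fip_def)

lemma clock_shift_cong: "(\<And>k. k < n \<Longrightarrow> x k = x' k) \<Longrightarrow> k < n \<Longrightarrow> clock_shift z w r x k = clock_shift z w r x' k"
  by (simp add: clock_shift_def)

lemma clock_shift_period: "clock_shift z w (r + 4) = clock_shift z w r"
  by (simp add: clock_shift_def fun_eq_iff)

lemma fip_semi_inner: "semi_inner fscale fip"
proof
  fix a b :: complex and x y z :: "nat \<Rightarrow> complex"
  show "fscale a (x + y) = fscale a x + fscale a y" "fscale (a + b) x = fscale a x + fscale b x"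
    "fscale a (fscale b x) = fscale (a * b) x" "fscale 1 x = x"
    by (auto simp: fscale_def fun_eq_iff algebra_simps)
  show "fip x (y + z) = fip x y + fip x z"
    by (simp add: fip_def distrib_left sum.distrib)
  show "fip x (fscale a y) = a * fip x y"
    by (simp add: fip_def fscale_def sum_distrib_left mult.left_commute)
  show "fip y x = cnj (fip x y)"
    by (simp add: fip_def mult.commute)
  show "0 \<le> Re (fip x x)"
    by (simp add: fip_def sum_nonneg)
qed

lemma clock_shift_phase_rep:
  assumes z: "z * cnj z = 1" and w: "w * cnj w = 1"
  shows "phase_rep fscale fip (clock_shift z w) (cis \<gamma>)"
proof (intro phase_rep.intro fip_semi_inner phase_rep_axioms.intro)
  fix r :: nat and a and x y :: "nat \<Rightarrow> complex"
  have zw: "cnj z * z = 1" "cnj w * w = 1" using z w by (simp_all add: mult.commute)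
  have s: "Suc r mod 4 = (r mod 4 + 1) mod 4" "(r + 2) mod 4 = (r mod 4 + 2) mod 4"
    by (simp_all add: mod_simps)
  have r4: "r mod 4 = 0 \<or> r mod 4 = 1 \<or> r mod 4 = 2 \<or> r mod 4 = 3" by linarith
  note s' = s[unfolded add_2_eq_Suc']
  have \<omega>: "cis \<gamma> = ph 1" by (simp add: ph_def)
  have nxt1: "ph (int (nxt k)) = ph (int k) * ph 1" and prv1: "ph (int (prv k)) = ph (int k) * cnj (ph 1)" for k
    using ph_nxt[of k 1] ph_prv[of k 1] by simp_all
  show "clock_shift z w r (x + y) = clock_shift z w r x + clock_shift z w r y" "clock_shift z w r (fscale a x) = fscale a (clock_shift z w r x)"
    by (auto simp: clock_shift_def fscale_def fun_eq_iff algebra_simps)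
  show "fip (clock_shift z w r x) y = fip x (clock_shift z w (r + 2) y)"
  proof -
    have 1: "(\<Sum>k<n. cnj (x (nxt k)) * y k) = (\<Sum>k<n. cnj (x k) * y (prv k))"
      by (subst sum_nxt[of "\<lambda>k. cnj (x k) * y (prv k)", symmetric]) (simp add: prv_nxt)
    have 3: "(\<Sum>k<n. cnj (x (prv k)) * y k) = (\<Sum>k<n. cnj (x k) * y (nxt k))"
      by (subst sum_prv[of "\<lambda>k. cnj (x k) * y (nxt k)", symmetric]) (simp add: nxt_prv)
    show ?thesis
      using r4 1 3 by (elim disjE) (simp_all add: fip_def clock_shift_def s' mult_ac sum_distrib_left[symmetric])
  qed
  show "fip y (clock_shift z w (r + 2) (clock_shift z w r x)) = fip y x"
  proof (rule fip_cong)
    fix k assume k: "k < n"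
    have "cnj a * (a * b) = b" "a * (cnj a * b) = b" if "cnj a * a = 1" for a b :: complex
      using that by (simp_all add: mult.assoc[symmetric] mult.commute[of a])
    note cancel = this[OF zw(1)] this[OF zw(2)] this[OF ph_cnj_mult(1)]
    show "clock_shift z w (r + 2) (clock_shift z w r x) k = x k"
      using r4 by (elim disjE) (simp_all add: clock_shift_def s' nxt_prv prv_nxt k cancel mult_ac)
  qed simp
  have "clock_shift z w (Suc r) (clock_shift z w r x) k = (ph 1 * clock_shift z w r (clock_shift z w (Suc r) x) k)" for k
  proof -
    have "ph 1 * (cnj (ph 1) * b) = b" for b by (simp add: mult.assoc[symmetric])
    then show ?thesis
      using r4 by (elim disjE) (simp_all add: clock_shift_def s' nxt1 prv1 mult_ac)
  qed
  then have "clock_shift z w (Suc r) (clock_shift z w r x) = fscale (ph 1) (clock_shift z w r (clock_shift z w (Suc r) x))"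
    by (simp add: fscale_def fun_eq_iff)
  then show "fip y (clock_shift z w (Suc r) (clock_shift z w r x)) = cis \<gamma> * fip y (clock_shift z w r (clock_shift z w (Suc r) x))"
    by (simp add: semi_inner.ip_scale_right[OF fip_semi_inner] \<omega>)
  show "clock_shift z w (r + 4) = clock_shift z w r"
    by (simp add: clock_shift_def fun_eq_iff)
qed

definition form :: "complex \<Rightarrow> complex \<Rightarrow> (nat \<Rightarrow> complex) \<Rightarrow> real"
  where "form z w x = (\<Sum>r<4. Re (fip x (clock_shift z w r x)))"

abbreviation "sq_norm x \<equiv> Re (fip x x)"

definition modulus :: "(nat \<Rightarrow> complex) \<Rightarrow> nat \<Rightarrow> complex"
  where "modulus x k = of_real (cmod (x k))"

lemma sq_norm_modulus: "sq_norm (modulus x) = sq_norm x"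
  by (simp add: fip_def modulus_def flip: cmod_power2 power2_eq_square)

text \<open>The diagonal letters see only the absolute values of the coordinates. A term of a shift
  letter is at most the product of the absolute values of two neighbours, which is its value at the
  modulus for w = 1.\<close>

lemma form_le_modulus:
  assumes w: "cmod w = 1"
  shows "form z w x \<le> form z 1 (modulus x)"
  unfolding form_def
proof (rule sum_mono)
  fix r :: nat
  have r4: "r mod 4 = 0 \<or> r mod 4 = 1 \<or> r mod 4 = 2 \<or> r mod 4 = 3" by linarith
  have le: "Re (cnj a * (w' * b)) \<le> cmod a * cmod b" if "cmod w' = 1" for a b w'
    using complex_Re_le_cmod[of "cnj a * (w' * b)"] that by (simp add: norm_mult)
  have eq: "cnj a * (c * a) = of_real (cmod a) * (c * of_real (cmod a))" for a c :: complex
    using complex_norm_square[of a] by (simp add: power2_eq_square mult_ac)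
  have w': "cmod (cnj w) = 1" using w by simp
  show "Re (fip x (clock_shift z w r x)) \<le> Re (fip (modulus x) (clock_shift z 1 r (modulus x)))"
    using r4
  proof (elim disjE)
    assume "r mod 4 = 1"
    then show ?thesis using le[OF w] by (simp add: fip_def clock_shift_def modulus_def Re_sum sum_mono del: times_complex.simps flip: of_real_mult)
  next
    assume "r mod 4 = 3"
    then show ?thesis using le[OF w'] by (simp add: fip_def clock_shift_def modulus_def Re_sum sum_mono del: times_complex.simps flip: of_real_mult)
  next
    assume r: "r mod 4 = 0"
    have "fip x (clock_shift z w r x) = fip (modulus x) (clock_shift z 1 r (modulus x))"
      unfolding fip_def by (intro sum.cong refl) (simp add: clock_shift_def modulus_def r eq)
    then show ?thesis by simp
  next
    assume r: "r mod 4 = 2"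
    have "fip x (clock_shift z w r x) = fip (modulus x) (clock_shift z 1 r (modulus x))"
      unfolding fip_def by (intro sum.cong refl) (simp add: clock_shift_def modulus_def r eq)
    then show ?thesis by simp
  qed
qed

section \<open>The Fourier transform of the cyclic group\<close>

text \<open>Formed with the given primitive root e^(\<i> \<gamma>) rather than e^(2 \<pi> \<i> / n),
  to match the clock matrix, and scaled to be unitary.\<close>

definition dft :: "(nat \<Rightarrow> complex) \<Rightarrow> nat \<Rightarrow> complex"
  where "dft x j = (\<Sum>k<n. ph (int j * int k) * x k) / of_real (sqrt (real n))"

lemma sqrt_n: "complex_of_real (sqrt (real n)) * complex_of_real (sqrt (real n)) = of_nat n" "sqrt (real n) \<noteq> 0"
  using n_pos by (simp_all flip: of_real_mult)

lemma dft_nxt: "dft x (nxt j) = (\<Sum>k<n. ph (int j * int k) * (ph (int k) * x k)) / of_real (sqrt (real n))"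
  by (simp add: dft_def ph_nxt mult.assoc)

lemma dft_prv: "dft x (prv j) = (\<Sum>k<n. ph (int j * int k) * (cnj (ph (int k)) * x k)) / of_real (sqrt (real n))"
  by (simp add: dft_def ph_prv mult.assoc)

text \<open>Conjugation by the Fourier transform realizes the automorphism that advances the cyclic
  numbering by one. It moves the parameter of the clock to the shift; as the shift had the parameter
  1, the new clock has none.\<close>

lemma dft_clock_shift:
  "dft (clock_shift z 1 r x) = clock_shift 1 z (Suc r) (dft x)"
proof
  fix j
  have s: "Suc r mod 4 = (r mod 4 + 1) mod 4" by (simp add: mod_simps)
  have r4: "r mod 4 = 0 \<or> r mod 4 = 1 \<or> r mod 4 = 2 \<or> r mod 4 = 3" by linarith
  have 1: "(\<Sum>k<n. ph (int j * int k) * x (nxt k)) = cnj (ph (int j)) * (\<Sum>k<n. ph (int j * int k) * x k)"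
  proof -
    have "cnj (ph (int j)) * ph (int (nxt k) * int j) = ph (int j * int k)" for k
      unfolding ph_nxt mult.left_commute[of "cnj (ph (int j))"] mult.commute[of "int j" "int k"] by simp
    then have "(\<Sum>k<n. ph (int j * int k) * x (nxt k)) = cnj (ph (int j)) * (\<Sum>k<n. ph (int (nxt k) * int j) * x (nxt k))"
      by (simp add: sum_distrib_left mult.assoc[symmetric])
    also have "(\<Sum>k<n. ph (int (nxt k) * int j) * x (nxt k)) = (\<Sum>k<n. ph (int k * int j) * x k)"
      by (rule sum_nxt)
    finally show ?thesis by (simp add: mult.commute)
  qed
  have 3: "(\<Sum>k<n. ph (int j * int k) * x (prv k)) = ph (int j) * (\<Sum>k<n. ph (int j * int k) * x k)"
  proof -
    have "ph (int j) * ph (int (prv k) * int j) = ph (int j * int k)" for k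
      unfolding ph_prv mult.left_commute[of "ph (int j)"] mult.commute[of "int j" "int k"] by simp
    then have "(\<Sum>k<n. ph (int j * int k) * x (prv k)) = ph (int j) * (\<Sum>k<n. ph (int (prv k) * int j) * x (prv k))"
      by (simp add: sum_distrib_left mult.assoc[symmetric])
    also have "(\<Sum>k<n. ph (int (prv k) * int j) * x (prv k)) = (\<Sum>k<n. ph (int k * int j) * x k)"
      by (rule sum_prv)
    finally show ?thesis by (simp add: mult.commute)
  qed
  have scal: "(\<Sum>k<n. ph (int j * int k) * (z' * (f k * x k))) = z' * (\<Sum>k<n. ph (int j * int k) * (f k * x k))" for z' f
    by (simp add: sum_distrib_left mult_ac)
  show "dft (clock_shift z 1 r x) j = clock_shift 1 z (Suc r) (dft x) j"
    using r4
  proof (elim disjE)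
    assume r: "r mod 4 = 0"
    show ?thesis by (simp add: clock_shift_def s r dft_nxt) (simp add: dft_def clock_shift_def r scal mult.assoc)
  next
    assume r: "r mod 4 = 1"
    show ?thesis by (simp add: clock_shift_def s r dft_def 1)
  next
    assume r: "r mod 4 = 2"
    show ?thesis by (simp add: clock_shift_def s r dft_prv) (simp add: dft_def clock_shift_def r scal mult.assoc)
  next
    assume r: "r mod 4 = 3"
    show ?thesis by (simp add: clock_shift_def s r dft_def 3)
  qed
qed

lemma fip_dft: "fip (dft x) (dft y) = fip x y"
proof -
  let ?s = "complex_of_real (sqrt (real n))"
  have "fip (dft x) (dft y) = (\<Sum>j<n. \<Sum>k<n. \<Sum>l<n. cnj (x k) * y l * ph (int j * (int l - int k))) / of_nat n"
  proof -
    have "cnj (dft x j) * dft y j = (\<Sum>k<n. \<Sum>l<n. cnj (x k) * y l * ph (int j * (int l - int k))) / of_nat n" for j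
    proof -
      have d: "cnj (ph (int j * int k)) * ph (int j * int l) = ph (int j * (int l - int k))" for k l
        using ph_add[of "- (int j * int k)" "int j * int l"] by (simp add: ph_uminus right_diff_distrib)
      then have e: "cnj (ph (int j * int k) * x k) * (ph (int j * int l) * y l) = cnj (x k) * y l * ph (int j * (int l - int k))" for k l
      proof -
        have "cnj (ph (int j * int k) * x k) * (ph (int j * int l) * y l)
            = cnj (x k) * y l * (cnj (ph (int j * int k)) * ph (int j * int l))"
          by (simp add: mult_ac)
        then show ?thesis by (simp only: d)
      qed
      have "cnj (dft x j) * dft y j
          = (\<Sum>k<n. cnj (ph (int j * int k) * x k)) * (\<Sum>l<n. ph (int j * int l) * y l) / (?s * ?s)"
        by (simp add: dft_def)
      then show ?thesis by (simp only: sum_product e sqrt_n(1))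
    qed
    then show ?thesis by (simp add: fip_def sum_divide_distrib)
  qed
  also have "(\<Sum>j<n. \<Sum>k<n. \<Sum>l<n. cnj (x k) * y l * ph (int j * (int l - int k)))
      = (\<Sum>k<n. \<Sum>l<n. \<Sum>j<n. cnj (x k) * y l * ph (int j * (int l - int k)))"
    by (subst sum.swap) (intro sum.cong refl sum.swap)
  also have "\<dots> = (\<Sum>k<n. \<Sum>l<n. cnj (x k) * y l * (if l = k then of_nat n else 0))"
  proof (intro sum.cong refl)
    fix k l assume kl: "k \<in> {..<n}" "l \<in> {..<n}"
    have "int n dvd (int l - int k) \<longleftrightarrow> l = k"
      using kl by (auto simp: mod_eq_dvd_iff[symmetric] simp flip: zmod_int)
    then show "(\<Sum>j<n. cnj (x k) * y l * ph (int j * (int l - int k))) = cnj (x k) * y l * (if l = k then of_nat n else 0)"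
      unfolding sum_distrib_left[symmetric] ph_orthogonal by simp
  qed
  also have "\<dots> = fip x y * of_nat n"
    by (simp add: fip_def sum_distrib_right if_distrib[of "\<lambda>a. _ * a"] cong: if_cong)
  finally show ?thesis using n_pos by simp
qed

text \<open>The square of the Fourier transform is the reflection k \<mapsto> -k; the outer
  \<open>mod\<close> treats j = 0.\<close>

lemma dft_dft: "j < n \<Longrightarrow> dft (dft x) j = x ((n - j) mod n)"
proof -
  assume j: "j < n"
  let ?s = "complex_of_real (sqrt (real n))"
  have "dft (dft x) j = (\<Sum>k<n. \<Sum>l<n. x l * ph (int k * (int j + int l))) / (?s * ?s)"
  proof -
    have e: "ph (int j * int k) * (ph (int k * int l) * x l) = x l * ph (int k * (int j + int l))" for k l
      by (simp add: ph_add distrib_left mult_ac)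
    have "dft (dft x) j = (\<Sum>k<n. \<Sum>l<n. ph (int j * int k) * (ph (int k * int l) * x l)) / (?s * ?s)"
      by (simp add: dft_def sum_distrib_left sum_divide_distrib)
    then show ?thesis by (simp only: e)
  qed
  also have "\<dots> = (\<Sum>k<n. \<Sum>l<n. x l * ph (int k * (int j + int l))) / of_nat n"
    by (simp only: sqrt_n(1))
  also have "(\<Sum>k<n. \<Sum>l<n. x l * ph (int k * (int j + int l))) = (\<Sum>l<n. \<Sum>k<n. x l * ph (int k * (int j + int l)))"
    by (rule sum.swap)
  also have "\<dots> = (\<Sum>l<n. if l = (n - j) mod n then of_nat n * x l else 0)"
  proof (intro sum.cong refl)
    fix l assume l: "l \<in> {..<n}"
    have "int n dvd (int j + int l) \<longleftrightarrow> n dvd (j + l)" by (metis int_dvd_int_iff of_nat_add)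
    also have "\<dots> \<longleftrightarrow> l = (n - j) mod n"
    proof (cases "j = 0")
      case True
      then show ?thesis using l by (auto dest: nat_dvd_not_less)
    next
      case False
      have "n dvd (j + l) \<longleftrightarrow> j + l = n"
      proof
        assume "n dvd (j + l)"
        then obtain c where c: "j + l = n * c" by (elim dvdE)
        have "0 < n * c" "n * c < n * 2" using c False j l by (auto simp del: mult_less_cancel1 nat_0_less_mult_iff simp flip: c)
        then have "c = 1" by simp
        then show "j + l = n" using c by simp
      qed simp
      then show ?thesis using False j l by auto
    qed
    finally show "(\<Sum>k<n. x l * ph (int k * (int j + int l))) = (if l = (n - j) mod n then of_nat n * x l else 0)"
      unfolding sum_distrib_left[symmetric] ph_orthogonal by simp
  qed
  also have "\<dots> / of_nat n = x ((n - j) mod n)"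
    using n_pos by simp
  finally show ?thesis .
qed

lemma form_dft: "form z 1 x = form 1 z (dft x)"
proof -
  have "form z 1 x = (\<Sum>r<4. Re (fip (dft x) (clock_shift 1 z (1 + r) (dft x))))"
    unfolding form_def by (intro sum.cong refl, subst fip_dft[symmetric]) (simp add: dft_clock_shift)
  also have "\<dots> = form 1 z (dft x)"
    unfolding form_def by (rule sum_shift_period) (simp only: clock_shift_period)
  finally show ?thesis .
qed

end

section \<open>Auxiliary roots of unity\<close>

lemma root_of_unity_cis:
  assumes "0 < N"
  shows "root_of_unity N (2 * pi / real N)"
proof
  show "cis (2 * pi / real N) ^ N = 1"
    using assms by (simp add: Complex.DeMoivre)
  fix k assume k: "0 < k" "k < N"
  show "cis (2 * pi / real N) ^ k \<noteq> 1"
  proof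
    assume "cis (2 * pi / real N) ^ k = 1"
    then have "cos (real k * (2 * pi / real N)) = 1"
      by (simp add: Complex.DeMoivre complex_eq_iff)
    then obtain m :: int where "real k * (2 * pi / real N) = of_int m * 2 * pi"
      by (auto simp: cos_one_2pi_int)
    then have "real k = of_int m * real N" using assms by (simp add: field_simps)
    then have "int k = m * int N" by (metis of_int_eq_iff of_int_mult of_int_of_nat_eq)
    then have "int N dvd int k" by simp
    then show False using k by (simp add: nat_dvd_not_less)
  qed
qed fact

text \<open>The order \<open>N\<close> is independent of n: these roots are sample values for the
  parameters z and w.\<close>

definition rt :: "nat \<Rightarrow> int \<Rightarrow> complex"
  where "rt N m = cis (2 * pi / real N * of_int m)"

lemma rt_add: "rt N (m + m') = rt N m * rt N m'"
  by (simp add: rt_def cis_mult distrib_left)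

lemma rt_uminus: "rt N (- m) = cnj (rt N m)"
  by (simp add: rt_def cis_cnj)

lemma cmod_rt [simp]: "cmod (rt N m) = 1"
  by (simp add: rt_def)

lemma rt_orthogonal: "0 < N \<Longrightarrow> (\<Sum>j<N. rt N (int j * m)) = (if int N dvd m then of_nat N else 0)"
  using root_of_unity.ph_orthogonal[OF root_of_unity_cis, of N m]
  by (simp add: rt_def root_of_unity.ph_def[OF root_of_unity_cis])

lemma sum_swap3:
  "(\<Sum>p\<in>A. \<Sum>s\<in>B. \<Sum>k\<in>C. f p s k) = (\<Sum>k\<in>C. \<Sum>p\<in>A. \<Sum>s\<in>B. f p s k)"
proof -
  have "(\<Sum>p\<in>A. \<Sum>s\<in>B. \<Sum>k\<in>C. f p s k) = (\<Sum>p\<in>A. \<Sum>k\<in>C. \<Sum>s\<in>B. f p s k)"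
    by (rule sum.cong[OF refl], rule sum.swap)
  also have "\<dots> = (\<Sum>k\<in>C. \<Sum>p\<in>A. \<Sum>s\<in>B. f p s k)" by (rule sum.swap)
  finally show ?thesis .
qed

section \<open>The maximum of the form and the universal norm\<close>

context root_of_unity
begin

interpretation one: phase_rep fscale fip "clock_shift 1 1" "cis \<gamma>"
  by (rule clock_shift_phase_rep) simp_all

lemma form_eq_hop: "form 1 1 x = Re (fip x (one.hop x))"
  by (simp add: form_def one.hop_def one.ip_sum_right)

lemma form_le_universal: "form 1 1 x \<le> universal_seminorm \<gamma> harper * sq_norm x"
  using one.hop_le_universal_seminorm[of \<gamma> x] by (simp add: form_eq_hop one.nrm_sq cis_conv_exp)

lemma tendsto_form:
  assumes "\<And>k. (\<lambda>j. F j k) \<longlonglongrightarrow> G k"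
  shows "(\<lambda>j. form z w (F j)) \<longlonglongrightarrow> form z w G" "(\<lambda>j. fip (F j) (F j)) \<longlonglongrightarrow> fip G G"
proof -
  have "(\<lambda>j. clock_shift z w r (F j) k) \<longlonglongrightarrow> clock_shift z w r G k" for r k
    unfolding clock_shift_def by (simp add: assms tendsto_mult_left)
  then show "(\<lambda>j. form z w (F j)) \<longlonglongrightarrow> form z w G" "(\<lambda>j. fip (F j) (F j)) \<longlonglongrightarrow> fip G G"
    unfolding form_def fip_def by (intro tendsto_intros assms; simp add: assms)+
qed

text \<open>Compactness of the unit sphere in finite dimension, by means of pointwise
  convergence.\<close>

lemma form_maximizer:
  obtains y M where "fip y y = 1" "form 1 1 y = M" "\<And>x. form 1 1 x \<le> M * sq_norm x"
proof -
  define B where "B = {form 1 1 x | x. fip x x = 1}"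
  define M where "M = Sup B"
  have "fip (\<lambda>k. if k = 0 then 1 else 0) (\<lambda>k. if k = 0 then 1 else 0) = 1"
    using n_pos by (simp add: fip_def if_distrib[of "\<lambda>a. _ * a"] cong: if_cong)
  then have ne: "B \<noteq> {}" unfolding B_def by blast
  have bdd: "bdd_above B"
  proof (rule bdd_aboveI)
    fix t assume "t \<in> B"
    then obtain x where "t = form 1 1 x" "fip x x = 1" by (auto simp: B_def)
    then show "t \<le> universal_seminorm \<gamma> harper" using form_le_universal[of x] by simp
  qed
  have "\<exists>x. fip x x = 1 \<and> M - 1 / real (Suc j) < form 1 1 x" for j
  proof -
    have "M - 1 / real (Suc j) < Sup B" by (simp add: M_def)
    then obtain t where "t \<in> B" "M - 1 / real (Suc j) < t"
      using less_cSup_iff[OF ne bdd] by blast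
    then show ?thesis by (auto simp: B_def)
  qed
  then obtain x where x: "\<And>j. fip (x j) (x j) = 1" and xM: "\<And>j. M - 1 / real (Suc j) < form 1 1 (x j)"
    by metis
  \<comment> \<open>Coordinates that do not count are arbitrary and possibly unbounded; they are
    cleared before a convergent subsequence is extracted.\<close>
  define F where "F j k = (if k < n then x j k else 0)" for j k
  have F1: "fip (F j) (F j) = 1" for j
    using x[of j] by (subst fip_cong[of _ "x j" _ "x j"]) (simp_all add: F_def)
  have FM: "form 1 1 (F j) = form 1 1 (x j)" for j
    unfolding form_def
    by (intro sum.cong refl arg_cong[of _ _ Re] fip_cong clock_shift_cong) (simp_all add: F_def)
  have "cmod (F j k) \<le> 1" for j k
  proof (cases "k < n")
    case True
    have "(\<Sum>k<n. (cmod (F j k))\<^sup>2) = Re (fip (F j) (F j))"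
      by (simp add: fip_def cmod_power2 flip: power2_eq_square)
    then have "(\<Sum>k<n. (cmod (F j k))\<^sup>2) = 1" by (simp add: F1)
    moreover have "(cmod (F j k))\<^sup>2 \<le> (\<Sum>k<n. (cmod (F j k))\<^sup>2)"
      by (rule member_le_sum) (use True in auto)
    ultimately have "(cmod (F j k))\<^sup>2 \<le> 1\<^sup>2" by simp
    then show ?thesis by (rule power2_le_imp_le) simp
  qed (simp add: F_def)
  then obtain G r where r: "strict_mono r" and G: "\<And>k. (\<lambda>j. F (r j) k) \<longlonglongrightarrow> G k"
    using pointwise_convergent_subsequence by blast
  have G1: "fip G G = 1"
    using tendsto_form(2)[where F = "\<lambda>j. F (r j)" and G = G, OF G] by (simp add: F1 LIMSEQ_const_iff)
  have upper: "form 1 1 x \<le> M" if "fip x x = 1" for x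
    unfolding M_def by (rule cSup_upper[OF _ bdd]) (use that in \<open>auto simp: B_def\<close>)
  have "(\<lambda>j. M - 1 / real (Suc j)) \<longlonglongrightarrow> M - 0"
    by (intro tendsto_diff tendsto_const LIMSEQ_Suc[OF lim_1_over_n])
  from LIMSEQ_subseq_LIMSEQ[OF this r] have "(\<lambda>j. M - 1 / real (Suc (r j))) \<longlonglongrightarrow> M" by (simp add: o_def)
  from LIMSEQ_le[OF this tendsto_form(1)[where F = "\<lambda>j. F (r j)" and G = G, OF G]] have "M \<le> form 1 1 G"
    using xM FM by (metis less_imp_le)
  then have GM: "form 1 1 G = M" using upper[OF G1] by simp
  have "form 1 1 x \<le> M * sq_norm x" for x
  proof (cases "one.nrm x = 0")
    case True
    then have "cmod (fip x (one.hop x)) \<le> 0" using one.ip_le_nrm[of x "one.hop x"] by simp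
    then show ?thesis using True by (simp add: form_eq_hop one.nrm_sq[symmetric])
  next
    case False
    let ?a = "complex_of_real (1 / one.nrm x)"
    have "fip (fscale ?a x) (fscale ?a x) = 1"
      using False by (simp add: one.ip_self one.nrm_scale norm_divide)
    from upper[OF this] have "form 1 1 x / (one.nrm x)\<^sup>2 \<le> M"
      by (simp add: form_eq_hop one.hop_scale one.ip_scale_left one.ip_scale_right power2_eq_square
          flip: of_real_divide of_real_mult)
    then show ?thesis using False by (simp add: divide_le_eq one.nrm_sq[symmetric])
  qed
  then show thesis using that[OF G1 GM] by blast
qed

lemma form_le_maximum:
  assumes M: "\<And>x. form 1 1 x \<le> M * sq_norm x" and z: "cmod z = 1" and w: "cmod w = 1"
  shows "form z w x \<le> M * sq_norm x"
proof -
  have "form z w x \<le> form z 1 (modulus x)" by (rule form_le_modulus[OF w])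
  also have "\<dots> = form 1 z (dft (modulus x))" by (rule form_dft)
  also have "\<dots> \<le> form 1 1 (modulus (dft (modulus x)))" by (rule form_le_modulus[OF z])
  also have "\<dots> \<le> M * sq_norm (modulus (dft (modulus x)))" by (rule M)
  finally show ?thesis by (simp add: sq_norm_modulus fip_dft)
qed

interpretation lat: phase_perm lattice_shift "lattice_phase \<gamma>" "cis \<gamma>"
  by (rule phase_perm_lattice)

text \<open>The image of \<open>x\<close> in the representation \<open>clock_shift z w\<close> with \<open>z\<close>, \<open>w\<close> roots of unity of order \<open>N\<close>
  under the equivariant map sending \<open>origin\<close> to the first basis vector. Averaging over all \<open>z\<close> and \<open>w\<close>
  recovers the inner product.\<close>

definition wrap :: "nat \<Rightarrow> nat \<Rightarrow> nat \<Rightarrow> (int \<times> int \<Rightarrow>\<^sub>0 complex) \<Rightarrow> nat \<Rightarrow> complex"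
  where "wrap N p s x k = (\<Sum>g\<in>Poly_Mapping.keys x. Poly_Mapping.lookup x g *
    (rt N (int p * fst g) * rt N (int s * snd g) *
     ph (int k * fst g) * of_bool (int n dvd snd g + int k)))"

context
  fixes N :: nat
  assumes N_pos: "0 < N"
begin

lemma wrap_add: "wrap N p s (x + y) k = wrap N p s x k + wrap N p s y k"
  unfolding wrap_def by (rule setsum_keys_plus_distrib) (simp_all add: distrib_right)

lemma wrap_single: "wrap N p s (Poly_Mapping.single g c) k =
    c * (rt N (int p * fst g) * rt N (int s * snd g) * ph (int k * fst g) * of_bool (int n dvd snd g + int k))"
  by (simp add: wrap_def)

text \<open>The shift evaluates at \<open>nxt k\<close>, so it moves the basis vector number k to k
  - 1. This explains the condition that n divide \<open>snd g + int k\<close> in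
  \<open>wrap\<close>.\<close>

lemma wrap_shift_act: 
  assumes "k < n"
  shows "wrap N p s (lat.shift_act r x) k = clock_shift (rt N (int p)) (rt N (int s)) r (wrap N p s x) k"
proof (induction x rule: poly_mapping_induct_add)
  case (single g c)
  have r2: "(r + 2) mod 4 = (r mod 4 + 2) mod 4" by (simp add: mod_simps)
  have r4: "r mod 4 = 0 \<or> r mod 4 = 1 \<or> r mod 4 = 2 \<or> r mod 4 = 3" by linarith
  have dvd: "int n dvd (m + a) \<longleftrightarrow> int n dvd (m + b)" if "int n dvd (a - b)" for m a b
    using dvd_add_right_iff[OF that, of "m + b"] by (simp add: algebra_simps)
  have nxt: "int n dvd (m + int (nxt k)) \<longleftrightarrow> int n dvd (m + 1 + int k)" for m
    using dvd[OF nxt_dvd[of k], of m] by (simp add: ac_simps)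
  have prv: "int n dvd (m + int (prv k)) \<longleftrightarrow> int n dvd (m - 1 + int k)" for m
    using dvd[OF prv_dvd[of k], of m] by (simp add: algebra_simps)
  have ph1: "cis (\<gamma> * of_int m) = ph m" "cis (- (\<gamma> * of_int m)) = cnj (ph m)" for m
    by (simp_all add: ph_def cis_cnj)
  have comm: "ph (m * int (nxt k)) = ph (int k * m) * ph m" "ph (m * int (prv k)) = ph (int k * m) * cnj (ph m)" for m
    using ph_nxt[of k m] ph_prv[of k m] by (simp_all add: mult.commute)
  show ?case
    unfolding lat.shift_act_single wrap_single
    using r4
    by (elim disjE)
      (simp_all add: r2 lattice_shift_def lattice_phase_def clock_shift_def wrap_single distrib_left right_diff_distrib
        ph_add ph_uminus rt_add rt_uminus diff_conv_add_uminus ph_nxt ph_prv comm nxt prv ph1 mult_ac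
        del: add_2_eq_Suc' add_uminus_conv_diff)
next
  case (add x y)
  then show ?case by (simp add: lat.act_add wrap_add clock_shift_def distrib_left)
qed

lemma sum_of_bool_dvd: "(\<Sum>k<n. of_bool (int n dvd b + int k)) = (1 :: complex)"
proof -
  define k0 where "k0 = nat ((- b) mod int n)"
  have k0: "int k0 = (- b) mod int n" "k0 < n" using n_pos by (simp_all add: k0_def nat_less_iff)
  have "int n dvd b + int k \<longleftrightarrow> k = k0" if "k < n" for k
  proof -
    have "int n dvd b + int k \<longleftrightarrow> int k mod int n = (- b) mod int n"
      by (simp add: mod_eq_dvd_iff add.commute)
    also have "\<dots> \<longleftrightarrow> k = k0" using that k0 by auto
    finally show ?thesis .
  qed
  then have "(\<Sum>k<n. of_bool (int n dvd b + int k)) = (\<Sum>k<n. if k = k0 then 1 else (0 :: complex))"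
    by (intro sum.cong) auto
  then show ?thesis using k0 by simp
qed

text \<open>Orthogonality of the characters of (\<int>/N)^2 removes all pairs of distinct lattice
  points, provided that none of them agree modulo N. For equal points exactly one k below n survives
  the divisibility condition.\<close>

lemma wrap_average:
  assumes sep: "\<And>g g'. g \<in> Poly_Mapping.keys x \<Longrightarrow> g' \<in> Poly_Mapping.keys y \<Longrightarrow>
    \<bar>fst g' - fst g\<bar> < int N \<and> \<bar>snd g' - snd g\<bar> < int N"
  shows "(\<Sum>p<N. \<Sum>s<N. fip (wrap N p s x) (wrap N p s y)) = (of_nat N)\<^sup>2 * pm_inner x y"
proof -
  let ?x = "Poly_Mapping.lookup x" and ?y = "Poly_Mapping.lookup y"
  let ?X = "Poly_Mapping.keys x" and ?Y = "Poly_Mapping.keys y"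
  define c where "c k g g' = cnj (?x g) * ?y g' * ph (int k * (fst g' - fst g)) *
    (of_bool (int n dvd snd g + int k) * of_bool (int n dvd snd g' + int k))" for k :: nat and g g'
  have prod: "cnj (?x g * (rt N (int p * fst g) * rt N (int s * snd g) * ph (int k * fst g) * of_bool (int n dvd snd g + int k)))
      * (?y g' * (rt N (int p * fst g') * rt N (int s * snd g') * ph (int k * fst g') * of_bool (int n dvd snd g' + int k)))
      = c k g g' * (rt N (int p * (fst g' - fst g)) * rt N (int s * (snd g' - snd g)))" for p s k g g'
    by (simp add: c_def distrib_left ph_add ph_uminus rt_add rt_uminus diff_conv_add_uminus mult_ac
        del: add_uminus_conv_diff)
  have "(\<Sum>p<N. \<Sum>s<N. fip (wrap N p s x) (wrap N p s y))
      = (\<Sum>p<N. \<Sum>s<N. \<Sum>k<n. \<Sum>g\<in>?X. \<Sum>g'\<in>?Y. c k g g' * (rt N (int p * (fst g' - fst g)) * rt N (int s * (snd g' - snd g))))"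
    unfolding fip_def wrap_def cnj_sum sum_product prod ..
  also have "\<dots> = (\<Sum>k<n. \<Sum>p<N. \<Sum>s<N. \<Sum>g\<in>?X. \<Sum>g'\<in>?Y. c k g g' * (rt N (int p * (fst g' - fst g)) * rt N (int s * (snd g' - snd g))))"
    by (rule sum_swap3)
  also have "\<dots> = (\<Sum>k<n. \<Sum>g\<in>?X. \<Sum>p<N. \<Sum>s<N. \<Sum>g'\<in>?Y. c k g g' * (rt N (int p * (fst g' - fst g)) * rt N (int s * (snd g' - snd g))))"
    by (rule sum.cong[OF refl], rule sum_swap3)
  also have "\<dots> = (\<Sum>k<n. \<Sum>g\<in>?X. \<Sum>g'\<in>?Y. \<Sum>p<N. \<Sum>s<N. c k g g' * (rt N (int p * (fst g' - fst g)) * rt N (int s * (snd g' - snd g))))"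
    by (rule sum.cong[OF refl], rule sum.cong[OF refl], rule sum_swap3)
  also have "\<dots> = (\<Sum>k<n. \<Sum>g\<in>?X. \<Sum>g'\<in>?Y. if g' = g then (of_nat N)\<^sup>2 * (cnj (?x g) * ?y g * of_bool (int n dvd snd g + int k)) else 0)"
  proof (intro sum.cong refl)
    fix k g g' assume k: "k \<in> {..<n}" and g: "g \<in> ?X" and g': "g' \<in> ?Y"
    have "int N dvd d \<longleftrightarrow> d = 0" if "\<bar>d\<bar> < int N" for d
      using that dvd_imp_le_int[of d "int N"] by auto
    then have "int N dvd (fst g' - fst g) \<longleftrightarrow> fst g' = fst g" "int N dvd (snd g' - snd g) \<longleftrightarrow> snd g' = snd g"
      using sep[OF g g'] by auto
    then have "(\<Sum>p<N. \<Sum>s<N. rt N (int p * (fst g' - fst g)) * rt N (int s * (snd g' - snd g)))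
        = (if g' = g then (of_nat N)\<^sup>2 else 0)"
      unfolding sum_product[symmetric] rt_orthogonal[OF N_pos] by (auto simp: power2_eq_square prod_eq_iff)
    then have "(\<Sum>p<N. \<Sum>s<N. c k g g' * (rt N (int p * (fst g' - fst g)) * rt N (int s * (snd g' - snd g))))
        = c k g g' * (if g' = g then (of_nat N)\<^sup>2 else 0)"
      unfolding sum_distrib_left[symmetric] by simp
    then show "(\<Sum>p<N. \<Sum>s<N. c k g g' * (rt N (int p * (fst g' - fst g)) * rt N (int s * (snd g' - snd g))))
        = (if g' = g then (of_nat N)\<^sup>2 * (cnj (?x g) * ?y g * of_bool (int n dvd snd g + int k)) else 0)"
      by (auto simp: c_def)
  qed
  also have "\<dots> = (\<Sum>k<n. \<Sum>g\<in>?X. (of_nat N)\<^sup>2 * (cnj (?x g) * ?y g * of_bool (int n dvd snd g + int k)))"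
    by (intro sum.cong refl) (auto simp: in_keys_iff)
  also have "\<dots> = (\<Sum>g\<in>?X. \<Sum>k<n. (of_nat N)\<^sup>2 * (cnj (?x g) * ?y g) * of_bool (int n dvd snd g + int k))"
    by (subst sum.swap) (simp add: mult.assoc)
  also have "\<dots> = (of_nat N)\<^sup>2 * pm_inner x y"
    unfolding sum_distrib_left[symmetric] sum_of_bool_dvd by (simp add: pm_inner_def sum_distrib_left)
  finally show ?thesis .
qed

end

text \<open>The lattice form is an average of forms with parameters z and w among the roots of unity
  of order N, and \<open>form_le_maximum\<close> bounds each of them by the same M.\<close>

lemma universal_seminorm_le_maximum:
  assumes M: "\<And>x. form 1 1 x \<le> M * sq_norm x"
  shows "universal_seminorm \<gamma> harper \<le> M"
proof (rule universal_seminorm_harper_le)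
  fix x :: "int \<times> int \<Rightarrow>\<^sub>0 complex"
  define K where "K = Poly_Mapping.keys x \<union> Poly_Mapping.keys (lat.hop x)"
  have "finite K" by (simp add: K_def)
  \<comment> \<open>N has to exceed every coordinate difference within the two supports; the sum of
    all of them plus 1 does.\<close>
  define N where "N = nat (\<Sum>q\<in>K \<times> K. \<bar>fst (fst q) - fst (snd q)\<bar> + \<bar>snd (fst q) - snd (snd q)\<bar>) + 1"
  have sep: "\<bar>fst g' - fst g\<bar> < int N \<and> \<bar>snd g' - snd g\<bar> < int N" if "g \<in> K" "g' \<in> K" for g g'
  proof -
    have "\<bar>fst (fst (g', g)) - fst (snd (g', g))\<bar> + \<bar>snd (fst (g', g)) - snd (snd (g', g))\<bar>
        \<le> (\<Sum>q\<in>K \<times> K. \<bar>fst (fst q) - fst (snd q)\<bar> + \<bar>snd (fst q) - snd (snd q)\<bar>)"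
      by (rule member_le_sum) (use that \<open>finite K\<close> in auto)
    then show ?thesis unfolding N_def by auto
  qed
  have N: "0 < N" by (simp add: N_def)
  have le: "Re (fip (wrap N p s x) (wrap N p s (lat.hop x))) \<le> M * sq_norm (wrap N p s x)" for p s
  proof -
    have "fip (wrap N p s x) (wrap N p s (lat.hop x))
        = (\<Sum>r<4. fip (wrap N p s x) (clock_shift (rt N (int p)) (rt N (int s)) r (wrap N p s x)))"
    proof -
      have "wrap N p s (lat.hop x) k = (\<Sum>r<4. wrap N p s (lat.shift_act r x) k)" for k
        by (simp add: lat.hop_def eval_nat_numeral wrap_add[OF N])
      then show ?thesis
        by (simp add: fip_def wrap_shift_act[OF N] sum_distrib_left) (rule sum.swap)
    qed
    then have "Re (fip (wrap N p s x) (wrap N p s (lat.hop x))) = form (rt N (int p)) (rt N (int s)) (wrap N p s x)"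
      by (simp add: form_def)
    also have "\<dots> \<le> M * sq_norm (wrap N p s x)"
      by (rule form_le_maximum[OF M]) simp_all
    finally show ?thesis .
  qed
  have "(real N)\<^sup>2 * Re (pm_inner x (lat.hop x)) = Re ((of_nat N)\<^sup>2 * pm_inner x (lat.hop x))"
    by (simp flip: of_nat_power)
  also have "(of_nat N)\<^sup>2 * pm_inner x (lat.hop x) = (\<Sum>p<N. \<Sum>s<N. fip (wrap N p s x) (wrap N p s (lat.hop x)))"
    by (rule wrap_average[OF N, symmetric]) (use sep in \<open>auto simp: K_def\<close>)
  also have "Re \<dots> \<le> (\<Sum>p<N. \<Sum>s<N. M * sq_norm (wrap N p s x))"
    by (simp only: Re_sum) (intro sum_mono le)
  also have "\<dots> = M * Re (\<Sum>p<N. \<Sum>s<N. fip (wrap N p s x) (wrap N p s x))"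
    by (simp add: sum_distrib_left)
  also have "(\<Sum>p<N. \<Sum>s<N. fip (wrap N p s x) (wrap N p s x)) = (of_nat N)\<^sup>2 * pm_inner x x"
    by (rule wrap_average[OF N]) (use sep in \<open>auto simp: K_def\<close>)
  also have "M * Re ((of_nat N)\<^sup>2 * pm_inner x x) = (real N)\<^sup>2 * (M * Re (pm_inner x x))"
    by (simp flip: of_nat_power)
  finally show "Re (pm_inner x (lat.hop x)) \<le> M * Re (pm_inner x x)"
    using N by (simp add: mult_le_cancel_left)
qed

end

section \<open>A maximizer fixed by the Fourier transform\<close>

context root_of_unity
begin

interpretation one: phase_rep fscale fip "clock_shift 1 1" "cis \<gamma>"
  by (rule clock_shift_phase_rep) simp_all

lemma dft_add: "dft (x + y) = dft x + dft y"
  by (simp add: dft_def fun_eq_iff distrib_left sum.distrib add_divide_distrib)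

lemma dft_four: "k < n \<Longrightarrow> dft (dft (dft (dft x))) k = x k"
  using n_pos by (simp add: dft_dft) (metis bot_nat_0.not_eq_extremum diff_diff_cancel diff_less
      diff_zero less_imp_le mod_less mod_self zero_less_diff)

text \<open>The maximizers of the form are the null vectors of the positive form \<open>M \<langle>x, y\<rangle> - \<langle>x, h y\<rangle>\<close>; hence
  they form a subspace, which is invariant under the Fourier transform. The sum of the Fourier orbit of a
  nonnegative maximizer does not vanish at 0.\<close>

lemma symmetric_maximizer:
  obtains s where "fip s s \<noteq> 0"
    "\<And>r. fip s (clock_shift 1 1 r s) = of_real (universal_seminorm \<gamma> harper / 4) * fip s s"
proof -
  obtain y0 M where y0: "fip y0 y0 = 1" "form 1 1 y0 = M" and M: "\<And>x. form 1 1 x \<le> M * sq_norm x"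
    using form_maximizer by blast
  define y where "y = modulus y0"
  have y1: "sq_norm y = 1" using y0 by (simp add: y_def sq_norm_modulus)
  have yM: "form 1 1 y = M"
    using form_le_modulus[of 1 1 y0] M[of y] y0 y1 by (simp add: y_def)
  have MS: "M = universal_seminorm \<gamma> harper"
    using universal_seminorm_le_maximum[OF M] form_le_universal[of y] y1 yM by simp
  define b where "b x w = of_real M * fip x w - fip x (one.hop w)" for x w
  interpret b: semi_inner fscale b
  proof
    fix a :: complex and x w w' :: "nat \<Rightarrow> complex"
    show "b x (w + w') = b x w + b x w'"
      by (simp add: b_def one.ip_add_right one.hop_add algebra_simps)
    show "b x (fscale a w) = a * b x w"
      by (simp add: b_def one.ip_scale_right one.hop_scale algebra_simps)
    have "fip w (one.hop x) = cnj (fip x (one.hop w))"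
      using one.ip_cnj[of "one.hop x" w] one.ip_hop[of x w] by (metis complex_cnj_cnj)
    then show "b w x = cnj (b x w)"
      using one.ip_cnj[of w x] by (simp add: b_def)
    show "0 \<le> Re (b x x)"
      using M[of x] by (simp add: b_def form_eq_hop)
  qed
  have nrm_b: "(b.nrm x)\<^sup>2 = M * sq_norm x - form 1 1 x" for x
    by (simp add: b.nrm_sq b_def form_eq_hop)
  have dft_b: "b.nrm (dft x) = b.nrm x" for x
  proof -
    have "(b.nrm (dft x))\<^sup>2 = (b.nrm x)\<^sup>2" by (simp only: nrm_b fip_dft form_dft[of 1 x])
    then show ?thesis by (simp add: power2_eq_iff_nonneg)
  qed
  have y_b: "b.nrm y = 0" using nrm_b[of y] y1 yM by simp
  define s where "s = y + dft y + dft (dft y) + dft (dft (dft y))"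
  have "b.nrm s \<le> b.nrm y + b.nrm (dft y) + b.nrm (dft (dft y)) + b.nrm (dft (dft (dft y)))"
    unfolding s_def by (meson add_mono b.nrm_triangle order_refl order_trans)
  then have "b.nrm s = 0" using b.nrm_nonneg[of s] by (simp add: dft_b y_b)
  then have "b s s = 0" by (simp add: b.ip_self)
  then have hop_s: "fip s (one.hop s) = of_real M * fip s s" by (simp add: b_def)
  have dft_s: "dft s k = s k" if "k < n" for k
    using dft_four[OF that, of y] by (simp add: s_def dft_add add_ac)
  \<comment> \<open>The transform fixes \<open>s\<close> and advances the letters by one, so all
    four letters have the same expectation in \<open>s\<close>, a quarter of that of h.\<close>
  have step: "fip s (clock_shift 1 1 (Suc r) s) = fip s (clock_shift 1 1 r s)" for r
  proof -
    have "fip s (clock_shift 1 1 r s) = fip (dft s) (clock_shift 1 1 (Suc r) (dft s))"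
      by (simp only: fip_dft[symmetric, of s "clock_shift 1 1 r s"] dft_clock_shift)
    also have "\<dots> = fip s (clock_shift 1 1 (Suc r) s)"
      by (intro fip_cong clock_shift_cong dft_s)
    finally show ?thesis ..
  qed
  have const: "fip s (clock_shift 1 1 r s) = fip s (clock_shift 1 1 0 s)" for r
    by (induction r) (simp_all add: step)
  have "fip s (one.hop s) = (\<Sum>r<(4::nat). fip s (clock_shift 1 1 r s))"
    by (simp add: one.hop_def one.ip_sum_right)
  also have "\<dots> = (\<Sum>r<(4::nat). fip s (clock_shift 1 1 0 s))"
    by (rule sum.cong[OF refl const])
  finally have hop4: "fip s (one.hop s) = 4 * fip s (clock_shift 1 1 0 s)" by simp
  then have E: "fip s (clock_shift 1 1 r s) = of_real (M / 4) * fip s s" for r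
    unfolding const[of r] using hop_s hop4 by simp
  have nonneg: "0 \<le> Re (y k)" for k by (simp add: y_def modulus_def)
  have dft0: "Re (dft x 0) = (\<Sum>k<n. Re (x k)) / sqrt (real n)" for x
    by (simp add: dft_def Re_divide_of_real)
  have y_pos: "0 < (\<Sum>k<n. Re (y k))"
  proof (rule ccontr)
    assume "\<not> 0 < (\<Sum>k<n. Re (y k))"
    then have "(\<Sum>k<n. Re (y k)) = 0" using sum_nonneg[of "{..<n}" "\<lambda>k. Re (y k)"] nonneg by force
    then have "Re (y k) = 0" if "k < n" for k
      using sum_nonneg_eq_0_iff[of "{..<n}" "\<lambda>k. Re (y k)"] nonneg that by simp
    then have "y k = 0" if "k < n" for k using that by (simp add: y_def modulus_def)
    then show False using y1 by (simp add: fip_def)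
  qed
  \<comment> \<open>At 0 no cancellation is possible: the first and third summands are the value of
    \<open>y\<close> there, and the other two are multiples of sums of nonnegative entries, the one
    for \<open>y\<close> being positive.\<close>
  have "0 < Re (s 0)"
  proof -
    have "0 < Re (dft y 0)" using y_pos n_pos by (simp add: dft0)
    moreover have "Re (dft (dft y) 0) = Re (y 0)" using n_pos by (simp add: dft_dft)
    moreover have "0 \<le> Re (dft (dft (dft y)) 0)"
      unfolding dft0 using nonneg by (intro divide_nonneg_nonneg sum_nonneg) (simp_all add: dft_dft)
    ultimately show ?thesis using nonneg[of 0] by (simp add: s_def)
  qed
  then have s0: "s 0 \<noteq> 0" by auto
  have "fip s s \<noteq> 0"
  proof
    assume "fip s s = 0"
    moreover have "Re (fip s s) = (\<Sum>k<n. (cmod (s k))\<^sup>2)"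
      by (simp add: fip_def cmod_power2 flip: power2_eq_square)
    ultimately have "(\<Sum>k<n. (cmod (s k))\<^sup>2) = 0" by simp
    then show False using s0 n_pos by (simp add: sum_nonneg_eq_0_iff)
  qed
  then show thesis using that E MS by blast
qed

text \<open>The matrices of clock and shift with both parameters 1, and the normalized maximizer cut
  off outside the first n coordinates. The band profile is constant.\<close>

lemma extremal_finite_matrices:
  defines "\<kappa> \<equiv> of_real (universal_seminorm \<gamma> harper / 4)"
  obtains a b \<xi> where "unitary_matrix {..<n} (\<lambda>i. n) a" "unitary_matrix {..<n} (\<lambda>i. n) b"
    "\<And>i k. (\<Sum>j<n. b i j * a j k) = cis \<gamma> * (\<Sum>j<n. a i j * b j k)"
    "\<And>i. n \<le> i \<Longrightarrow> \<xi> i = 0" "(\<Sum>i<n. cnj (\<xi> i) * \<xi> i) = 1"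
    "(\<Sum>i<n. \<Sum>j<n. cnj (\<xi> i) * a i j * \<xi> j) = \<kappa>" "(\<Sum>i<n. \<Sum>j<n. cnj (\<xi> i) * b i j * \<xi> j) = \<kappa>"
proof -
  obtain s where s: "fip s s \<noteq> 0" and E: "\<And>r. fip s (clock_shift 1 1 r s) = \<kappa> * fip s s"
    unfolding \<kappa>_def using symmetric_maximizer by metis
  define a where "a i j = (if i = j \<and> i < n then ph (int i) else 0)" for i j
  define b :: "nat \<Rightarrow> nat \<Rightarrow> complex" where "b i j = (if i < n \<and> j = nxt i then 1 else 0)" for i j
  define c where "c = complex_of_real (1 / one.nrm s)"
  have nrm: "one.nrm s \<noteq> 0" using s one.ip_self[of s] by auto
  define \<xi> where "\<xi> i = (if i < n then c * s i else 0)" for i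
  have cc: "cnj c * c * fip s s = 1"
    using nrm by (simp add: c_def one.ip_self power2_eq_square)
  have scal: "(\<Sum>i<n. cnj (\<xi> i) * f i) = cnj c * (\<Sum>i<n. cnj (s i) * f i)" for f
    by (simp add: \<xi>_def sum_distrib_left mult.assoc)
  have a_row: "(\<Sum>j<n. a i j * f j) = (if i < n then ph (int i) * f i else 0)" for i f
  proof -
    have "(\<Sum>j<n. a i j * f j) = (\<Sum>j<n. if j = i then (if i < n then ph (int i) * f i else 0) else 0)"
      by (intro sum.cong) (auto simp: a_def)
    then show ?thesis by simp
  qed
  have b_row: "(\<Sum>j<n. b i j * f j) = (if i < n then f (nxt i) else 0)" for i f
  proof -
    have "(\<Sum>j<n. b i j * f j) = (\<Sum>j<n. if j = nxt i then (if i < n then f (nxt i) else 0) else 0)"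
      by (intro sum.cong) (auto simp: b_def)
    then show ?thesis by simp
  qed
  have a_col: "(\<Sum>l<n. cnj (a l i) * a l j) = of_bool (i = j \<and> i \<in> {..<n})" for i j
  proof -
    have "(\<Sum>l<n. cnj (a l i) * a l j) = (\<Sum>l<n. if l = i then of_bool (i = j \<and> i < n) else 0)"
      by (intro sum.cong) (auto simp: a_def)
    then show ?thesis by simp
  qed
  have b_col: "(\<Sum>l<n. cnj (b l i) * b l j) = of_bool (i = j \<and> i \<in> {..<n})" for i j
  proof -
    have "(\<Sum>l<n. cnj (b l i) * b l j) = (\<Sum>l<n. if l = prv i then of_bool (i = j \<and> i < n) else 0)"
    proof (intro sum.cong refl)
      fix l assume l: "l \<in> {..<n}"
      then have "i = nxt l \<longleftrightarrow> i < n \<and> l = prv i" by (metis lessThan_iff nxt_less nxt_prv prv_nxt)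
      moreover have "cnj (b l i) * b l j = of_bool (i = j \<and> i = nxt l)"
        using l by (auto simp: b_def)
      ultimately show "cnj (b l i) * b l j = (if l = prv i then of_bool (i = j \<and> i < n) else 0)" by auto
    qed
    then show ?thesis by simp
  qed
  show thesis
  proof (rule that)
    show "unitary_matrix {..<n} (\<lambda>i. n) a"
      unfolding unitary_matrix_def a_row a_col by (auto simp: a_def)
    show "unitary_matrix {..<n} (\<lambda>i. n) b"
      unfolding unitary_matrix_def b_row b_col by (auto simp: b_def) (metis prv_nxt)
    have nxt1: "ph (int (nxt i)) = ph (int i) * cis \<gamma>" for i
      using ph_nxt[of i 1] by (simp add: ph_def)
    show "(\<Sum>j<n. b i j * a j k) = cis \<gamma> * (\<Sum>j<n. a i j * b j k)" for i k
      unfolding a_row b_row by (auto simp: a_def b_def nxt1)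
    show "n \<le> i \<Longrightarrow> \<xi> i = 0" for i by (simp add: \<xi>_def)
    show "(\<Sum>i<n. cnj (\<xi> i) * \<xi> i) = 1"
      unfolding scal using cc by (simp add: \<xi>_def fip_def sum_distrib_left mult_ac)
    have "(\<Sum>i<n. \<Sum>j<n. cnj (\<xi> i) * a i j * \<xi> j) = cnj c * c * fip s (clock_shift 1 1 0 s)"
      unfolding mult.assoc sum_distrib_left[symmetric] scal a_row
      by (simp add: \<xi>_def fip_def clock_shift_def sum_distrib_left mult_ac)
    then show "(\<Sum>i<n. \<Sum>j<n. cnj (\<xi> i) * a i j * \<xi> j) = \<kappa>"
      using cc by (simp add: E mult_ac)
    have "(\<Sum>i<n. \<Sum>j<n. cnj (\<xi> i) * b i j * \<xi> j) = cnj c * c * fip s (clock_shift 1 1 1 s)"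
      unfolding mult.assoc sum_distrib_left[symmetric] scal b_row
      by (simp add: \<xi>_def fip_def clock_shift_def sum_distrib_left mult_ac)
    then show "(\<Sum>i<n. \<Sum>j<n. cnj (\<xi> i) * b i j * \<xi> j) = \<kappa>"
      using cc by (simp add: E mult_ac)
  qed
qed

end

section \<open>The dilation\<close>

text \<open>The image of the origin under h has the entry 1 at the neighbour (1, 0), contributed by
  u alone. Positivity makes the quotient defining \<open>c\<close> meaningful.\<close>

lemma universal_seminorm_harper_pos: "0 < universal_seminorm \<gamma> harper"
proof (rule ccontr)
  assume neg: "\<not> 0 < universal_seminorm \<gamma> harper"
  interpret lat: phase_perm lattice_shift "lattice_phase \<gamma>" "cis \<gamma>"
    by (rule phase_perm_lattice)
  have "lat.rep_norm harper \<le> universal_seminorm \<gamma> harper"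
    by (rule universal_seminorm_upper[OF lat.cstar_seminorm_rep_norm lat.vanishes_on_relations_rep_norm])
      (simp add: cis_conv_exp)
  then have "lat.rep_norm harper = 0" using neg lat.rep_norm_nonneg[of harper] by linarith
  then have "lat.nrm (lat.hop origin) = 0"
    using lat.nrm_rep_le[of harper origin] lat.nrm_nonneg[of "lat.hop origin"] by (simp add: lat.rep_harper)
  then have "Re (pm_inner (lat.hop origin) (lat.hop origin)) = 0"
    using lat.nrm_sq[of "lat.hop origin"] by simp
  moreover have "Re (pm_inner x x) = (\<Sum>g\<in>Poly_Mapping.keys x. (cmod (Poly_Mapping.lookup x g))\<^sup>2)"
    for x :: "int \<times> int \<Rightarrow>\<^sub>0 complex"
    unfolding pm_inner_def by (simp add: cmod_power2 flip: power2_eq_square)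
  ultimately have "Poly_Mapping.lookup (lat.hop origin) (1, 0) = 0"
    by (auto simp: sum_nonneg_eq_0_iff in_keys_iff)
  moreover have "Poly_Mapping.lookup (lat.hop origin) (1, 0) = 1"
  proof -
    have "lattice_phase \<gamma> r (1, 0) * Poly_Mapping.lookup origin (lattice_shift r (1, 0)) = (if r = 0 then 1 else 0)"
      if "r < 4" for r
      using that by (auto simp: lattice_shift_def lattice_phase_def lookup_single when_def)
    then have "Poly_Mapping.lookup (lat.hop origin) (1, 0) = (\<Sum>r<4::nat. if r = 0 then 1 else 0)"
      unfolding lookup_lattice_hop by (intro sum.cong) auto
    then show ?thesis by simp
  qed
  ultimately show False by simp
qed

text \<open>The common end of both halves: infinite matrices with the first basis vector, or
  matrices of size n with the Fourier-invariant vector.\<close>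

lemma (in hilbert_space) dilation_from_matrices:
  fixes c :: real and K :: "(nat \<Rightarrow> 'a \<times> complex) hspace"
  assumes a: "unitary_matrix I \<beta> a" and b: "unitary_matrix I \<beta> b"
    and U: "unitary_op H U" and V: "unitary_op H V" and UV: "q_commuting q H U V"
    and ba: "\<And>i k. (\<Sum>j<\<beta> i. b i j * a j k) = \<omega> * (\<Sum>j<\<beta> i. a i j * b j k)"
    and \<xi>: "\<And>i. i \<notin> I \<Longrightarrow> \<xi> i = 0" "\<And>i. i \<ge> N \<Longrightarrow> \<xi> i = 0" "(\<Sum>i<N. cnj (\<xi> i) * \<xi> i) = 1"
      "(\<Sum>i<N. \<Sum>j<N. cnj (\<xi> i) * a i j * \<xi> j) = \<kappa>" "(\<Sum>i<N. \<Sum>j<N. cnj (\<xi> i) * b i j * \<xi> j) = \<kappa>"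
    and c: "of_real c * \<kappa> = 1" "0 \<le> c" and nontrivial: "carrier H \<noteq> {\<zero>}"
    and K: "K = ell2 I (transport (\<lambda>x. (x, 0)) fst H)"
  shows "\<exists>B\<^sub>1 B\<^sub>2. hilbert_space K \<and> is_dilation H U V K B\<^sub>1 B\<^sub>2 \<and> q_commuting (\<omega> * q) K B\<^sub>1 B\<^sub>2 \<and>
    scalar_multiple_of_unitary K B\<^sub>1 \<and> scalar_multiple_of_unitary K B\<^sub>2 \<and>
    op_norm K K B\<^sub>1 = c \<and> op_norm K K B\<^sub>2 = c"
proof -
  let ?e = "\<lambda>x. (x, 0) :: 'a \<times> complex"
  have de: "fst (?e x) = x" for x by simp
  let ?G = "transport ?e fst H"
  interpret G: hilbert_space ?G by (rule hilbert_space_transport[where e = ?e and d = fst, OF de])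
  have "\<exists>i. i \<in> I"
  proof (rule ccontr)
    assume "\<nexists>i. i \<in> I"
    then have "\<xi> i = 0" for i using \<xi>(1) by blast
    then show False using \<xi>(3) by simp
  qed
  then obtain i\<^sub>0 where i\<^sub>0: "i\<^sub>0 \<in> I" ..
  have nt: "carrier ?G \<noteq> {\<zero>\<^bsub>?G\<^esub>}" using nontrivial by (auto simp: inj_image_eq_iff)
  let ?U = "\<lambda>x. ?e (U (fst x))" and ?V = "\<lambda>x. ?e (V (fst x))"
  let ?B\<^sub>1 = "\<lambda>x. of_real c \<odot>\<^bsub>K\<^esub> mat_op ?G \<beta> a ?U x" and ?B\<^sub>2 = "\<lambda>x. of_real c \<odot>\<^bsub>K\<^esub> mat_op ?G \<beta> b ?V x"
  note mats = G.commuting_scaled_mat_ops[OF a b unitary_op_transport[where e = ?e and d = fst, OF de U]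
      unitary_op_transport[where e = ?e and d = fst, OF de V] ba q_commuting_transport[where e = ?e and d = fst, OF de UV]
      i\<^sub>0 nt c(2) K refl refl]
  have "is_dilation H U V K ?B\<^sub>1 ?B\<^sub>2"
    by (rule is_dilation_mat_ops[where e = ?e and d = fst, OF de a b U V \<xi> c(1) refl K refl refl mats(2,3)])
  then show ?thesis using mats by blast
qed

text \<open>Here \<open>H\<close> has no room for operators of norm \<open>c\<close>, and the dilation space is built over \<open>\<complex>\<close> instead.\<close>

lemma dilation_of_zero_space:
  fixes H :: "'a hspace" and c :: real
  assumes H: "hilbert_space H" and trivial: "carrier H = {\<zero>\<^bsub>H\<^esub>}"
    and U: "unitary_op H U" and V: "unitary_op H V" and c: "0 \<le> c"
  shows "\<exists>(K :: (nat \<Rightarrow> 'a \<times> complex) hspace) B\<^sub>1 B\<^sub>2. hilbert_space K \<and> is_dilation H U V K B\<^sub>1 B\<^sub>2 \<and>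
    q_commuting (cis \<theta>) K B\<^sub>1 B\<^sub>2 \<and> scalar_multiple_of_unitary K B\<^sub>1 \<and> scalar_multiple_of_unitary K B\<^sub>2 \<and>
    op_norm K K B\<^sub>1 = c \<and> op_norm K K B\<^sub>2 = c"
proof -
  interpret H: hilbert_space H by (rule H)
  interpret C: hilbert_space complex_hspace by (rule hilbert_space_complex)
  let ?e = "\<lambda>z. (\<zero>\<^bsub>H\<^esub>, z) :: 'a \<times> complex"
  have de: "snd (?e z) = z" for z by simp
  let ?G = "transport ?e snd complex_hspace"
  interpret G: hilbert_space ?G by (rule C.hilbert_space_transport[where e = ?e and d = snd, OF de])
  \<comment> \<open>Identity operators take the place of \<open>U\<close> and \<open>V\<close> here,
    so the matrices alone have to supply the whole phase, and their parameter is
    \<open>\<theta>\<close>.\<close>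
  obtain a b where a: "unitary_matrix UNIV (\<lambda>i. 4 * i + 5) a" and b: "unitary_matrix UNIV (\<lambda>i. 4 * i + 5) b"
    and ba: "\<And>i k. (\<Sum>j<4 * i + 5. b i j * a j k) = cis \<theta> * (\<Sum>j<4 * i + 5. a i j * b j k)"
    by (rule extremal_commuting_matrices[of \<theta>]) (rule that)
  have id: "unitary_op ?G (\<lambda>x. x)" by (rule G.unitary_opI[where S = "\<lambda>x. x"]) auto
  have comm: "q_commuting 1 ?G (\<lambda>x. x) (\<lambda>x. x)" by (simp add: q_commuting_def)
  have nt: "carrier ?G \<noteq> {\<zero>\<^bsub>?G\<^esub>}" 
  proof -
    have "?e 1 \<in> carrier ?G" "?e 1 \<noteq> \<zero>\<^bsub>?G\<^esub>" by simp_all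
    then show ?thesis by blast
  qed
  define K where "K = ell2 UNIV ?G"
  define B\<^sub>1 where "B\<^sub>1 = (\<lambda>x. of_real c \<odot>\<^bsub>K\<^esub> mat_op ?G (\<lambda>i. 4 * i + 5) a (\<lambda>x. x) x)"
  define B\<^sub>2 where "B\<^sub>2 = (\<lambda>x. of_real c \<odot>\<^bsub>K\<^esub> mat_op ?G (\<lambda>i. 4 * i + 5) b (\<lambda>x. x) x)"
  note mats = G.commuting_scaled_mat_ops[OF a b id id ba comm UNIV_I nt c K_def B\<^sub>1_def B\<^sub>2_def]
  interpret K: hilbert_space K by (rule mats(1))
  have "is_dilation H U V K B\<^sub>1 B\<^sub>2"
    unfolding is_dilation_def
  proof (intro conjI mats(2,3) exI[of _ "\<lambda>x. \<zero>\<^bsub>K\<^esub>"] ballI)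
    have "hnorm H \<zero>\<^bsub>H\<^esub> = 0" "hnorm K \<zero>\<^bsub>K\<^esub> = 0"
      using H.hnorm_eq_0_iff[OF H.zero_closed] K.hnorm_eq_0_iff[OF K.zero_closed] by blast+
    then show "isometric_op H K (\<lambda>x. \<zero>\<^bsub>K\<^esub>)"
      unfolding isometric_op_def bounded_op_def by (simp add: trivial)
    fix x assume x: "x \<in> carrier H"
    have "B\<^sub>1 \<zero>\<^bsub>K\<^esub> \<in> carrier K" "B\<^sub>2 \<zero>\<^bsub>K\<^esub> \<in> carrier K"
      using mats(2,3) by (simp_all add: bounded_op_def)
    moreover have "U x = \<zero>\<^bsub>H\<^esub>" "V x = \<zero>\<^bsub>H\<^esub>"
      using H.unitary_op_closed[OF U x] H.unitary_op_closed[OF V x] by (simp_all add: trivial)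
    ultimately show "U x = adj H K (\<lambda>x. \<zero>\<^bsub>K\<^esub>) (B\<^sub>1 \<zero>\<^bsub>K\<^esub>)" "V x = adj H K (\<lambda>x. \<zero>\<^bsub>K\<^esub>) (B\<^sub>2 \<zero>\<^bsub>K\<^esub>)"
      by (intro H.adj_eqI[symmetric]; simp)+
  qed
  then show ?thesis using mats by auto
qed

theorem theorem6p1:
  fixes \<theta> \<theta>' \<gamma> c :: real and q q' :: complex
    and H :: "'a hspace" and U V :: "'a \<Rightarrow> 'a"
    and A :: "(nat \<Rightarrow> star_poly) set cstar_alg" and u v :: "(nat \<Rightarrow> star_poly) set"
  assumes "q = exp (\<i> * of_real \<theta>)" and "q' = exp (\<i> * of_real \<theta>')" and "\<gamma> = \<theta>' - \<theta>"
    and "hilbert_space H" and "unitary_op H U" and "unitary_op H V" and "q_commuting q H U V"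
    and "A = rotation_algebra \<gamma>" and "u = rotation_u \<gamma>" and "v = rotation_v \<gamma>"
    and "c = 4 / cnorm A (u \<oplus>\<^bsub>A\<^esub> star A u \<oplus>\<^bsub>A\<^esub> v \<oplus>\<^bsub>A\<^esub> star A v)"
  shows "(\<exists>(K :: (nat \<Rightarrow> 'a \<times> complex) hspace) B\<^sub>1 B\<^sub>2.
            hilbert_space K \<and> is_dilation H U V K B\<^sub>1 B\<^sub>2 \<and> q_commuting q' K B\<^sub>1 B\<^sub>2 \<and>
            scalar_multiple_of_unitary K B\<^sub>1 \<and> scalar_multiple_of_unitary K B\<^sub>2 \<and>
            op_norm K K B\<^sub>1 = c \<and> op_norm K K B\<^sub>2 = c) \<and>
    (\<forall>n. primitive_root_of_unity n (q' / q) \<and> carrier H \<noteq> {\<zero>\<^bsub>H\<^esub>} \<longrightarrow>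
         (\<exists>(L :: (nat \<Rightarrow> complex) hspace) (K :: (nat \<Rightarrow> 'a \<times> complex) hspace) t B\<^sub>1 B\<^sub>2.
            hilbert_space L \<and> has_dim L n \<and> hilbert_space K \<and> tensor_product H L K t \<and>
            is_dilation H U V K B\<^sub>1 B\<^sub>2 \<and> q_commuting q' K B\<^sub>1 B\<^sub>2 \<and>
            scalar_multiple_of_unitary K B\<^sub>1 \<and> scalar_multiple_of_unitary K B\<^sub>2 \<and>
            op_norm K K B\<^sub>1 = c \<and> op_norm K K B\<^sub>2 = c))"
proof (intro conjI allI impI)
  interpret H: hilbert_space H by fact
  let ?S = "universal_seminorm \<gamma> harper"
  have c_eq: "c = 4 / ?S" using assms(11) cnorm_harper[OF assms(8-10)] by simp
  have S: "0 < ?S" by (rule universal_seminorm_harper_pos)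
  have c0: "0 \<le> c" and c1: "of_real c * of_real (?S / 4) = (1 :: complex)"
    using S by (simp_all add: c_eq flip: of_real_mult)
  have q: "q = cis \<theta>" "q' = cis \<theta>'" using assms(1,2) by (simp_all add: cis_conv_exp)
  \<comment> \<open>The reason for the choice of \<open>\<gamma>\<close>: the phase of the matrices
    times that of the given pair is the prescribed one.\<close>
  have q': "cis \<gamma> * q = q'" by (simp add: q assms(3) cis_mult)
  have ratio: "q' / q = cis \<gamma>" by (simp add: q assms(3) cis_divide)
  show "\<exists>(K :: (nat \<Rightarrow> 'a \<times> complex) hspace) B\<^sub>1 B\<^sub>2.
            hilbert_space K \<and> is_dilation H U V K B\<^sub>1 B\<^sub>2 \<and> q_commuting q' K B\<^sub>1 B\<^sub>2 \<and>
            scalar_multiple_of_unitary K B\<^sub>1 \<and> scalar_multiple_of_unitary K B\<^sub>2 \<and>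
            op_norm K K B\<^sub>1 = c \<and> op_norm K K B\<^sub>2 = c"
  proof (cases "carrier H = {\<zero>\<^bsub>H\<^esub>}")
    case True
    from dilation_of_zero_space[OF assms(4) this assms(5,6) c0] show ?thesis unfolding q(2) .
  next
    case False
    obtain a b where a: "unitary_matrix UNIV (\<lambda>i. 4 * i + 5) a" and b: "unitary_matrix UNIV (\<lambda>i. 4 * i + 5) b"
      and ba: "\<And>i k. (\<Sum>j<4 * i + 5. b i j * a j k) = cis \<gamma> * (\<Sum>j<4 * i + 5. a i j * b j k)"
      and \<kappa>: "a 0 0 = of_real (?S / 4)" "b 0 0 = of_real (?S / 4)"
      using extremal_commuting_matrices[of \<gamma>] by blast
    \<comment> \<open>The prescribed expectations are the entries at 0 0, so the first basis vector
      serves, with a support of length 1.\<close>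
    define \<xi> :: "nat \<Rightarrow> complex" where "\<xi> i = of_bool (i = 0)" for i
    from H.dilation_from_matrices[OF a b assms(5-7) ba, of \<xi> "Suc 0" "of_real (?S / 4)" c, OF _ _ _ _ _ c1 c0 False refl]
    show ?thesis unfolding q' by (auto simp: \<xi>_def \<kappa>)
  qed
  fix n assume n: "primitive_root_of_unity n (q' / q) \<and> carrier H \<noteq> {\<zero>\<^bsub>H\<^esub>}"
  then interpret root_of_unity n \<gamma>
    by unfold_locales (auto simp: primitive_root_of_unity_def ratio)
  interpret C: hilbert_space complex_hspace by (rule hilbert_space_complex)
  obtain a b \<xi> where a: "unitary_matrix {..<n} (\<lambda>i. n) a" and b: "unitary_matrix {..<n} (\<lambda>i. n) b"
    and ba: "\<And>i k. (\<Sum>j<n. b i j * a j k) = cis \<gamma> * (\<Sum>j<n. a i j * b j k)"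
    and \<xi>: "\<And>i. n \<le> i \<Longrightarrow> \<xi> i = 0" "(\<Sum>i<n. cnj (\<xi> i) * \<xi> i) = 1"
    and \<kappa>: "(\<Sum>i<n. \<Sum>j<n. cnj (\<xi> i) * a i j * \<xi> j) = of_real (?S / 4)"
      "(\<Sum>i<n. \<Sum>j<n. cnj (\<xi> i) * b i j * \<xi> j) = of_real (?S / 4)"
    using extremal_finite_matrices by blast
  define K :: "(nat \<Rightarrow> 'a \<times> complex) hspace" where "K = ell2 {..<n} (transport (\<lambda>x. (x, 0)) fst H)"
  have \<xi>0: "\<xi> i = 0" if "i \<notin> {..<n}" for i using \<xi>(1) that by simp
  from H.dilation_from_matrices[OF a b assms(5-7) ba \<xi>0 \<xi> \<kappa> c1 c0 _ K_def] n
  obtain B\<^sub>1 B\<^sub>2 where B: "hilbert_space K" "is_dilation H U V K B\<^sub>1 B\<^sub>2" "q_commuting q' K B\<^sub>1 B\<^sub>2"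
    "scalar_multiple_of_unitary K B\<^sub>1" "scalar_multiple_of_unitary K B\<^sub>2" "op_norm K K B\<^sub>1 = c" "op_norm K K B\<^sub>2 = c"
    unfolding q' by blast
  have "tensor_product H (ell2 {..<n} complex_hspace) K (\<lambda>x y i. (y i \<odot>\<^bsub>H\<^esub> x, 0))"
    unfolding K_def by (rule H.tensor_product_ell2) simp
  then show "\<exists>(L :: (nat \<Rightarrow> complex) hspace) (K :: (nat \<Rightarrow> 'a \<times> complex) hspace) t B\<^sub>1 B\<^sub>2.
            hilbert_space L \<and> has_dim L n \<and> hilbert_space K \<and> tensor_product H L K t \<and>
            is_dilation H U V K B\<^sub>1 B\<^sub>2 \<and> q_commuting q' K B\<^sub>1 B\<^sub>2 \<and>
            scalar_multiple_of_unitary K B\<^sub>1 \<and> scalar_multiple_of_unitary K B\<^sub>2 \<and>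
            op_norm K K B\<^sub>1 = c \<and> op_norm K K B\<^sub>2 = c"
    using B C.hilbert_space_ell2[of "{..<n}"] has_dim_ell2[of n] by blast
qed

end
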